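(* For each $n\in\mathbb N$, $\mathbf{PL}_n=\mathrm{Logic}(\mathsf{Convex}_n)$. In particular (soundness) every formula of $\mathbf{PL}_n$ is valid on every convex polyhedron of dimension at most $n$, and (completeness) if $\varphi\notin\mathbf{PL}_n$ there is a convex polyhedron $P$ of dimension at most $n$ on which $\varphi$ is not valid.
   Context: Kripke frames are posets; a subset $U$ of a poset $F$ is an upset if $x\in U$, $x\le y$ imply $y\in U$. The height of a poset is the supremum of $|X|-1$ over chains $X$. A p-morphism $f\colon F\to G$ is a map with $f(\uparrow x)=\uparrow f(x)$ for all $x$; an up-reduction of $F$ onto $G$ is a surjective p-morphism from an upset of $F$ onto $G$. For a finite rooted poset $Q$, $\chi(Q)$ denotes its Jankov–Fine formula, characterised by: a frame $F$ validates $\chi(Q)$ iff there is no up-reduction of $F$ onto $Q$. $\mathbf{BD}_n$ is the logic of all finite frames of height at most $n$. The 3-fork is the poset $\{r,a,b,c\}$ with $r<a,r<b,r<c$ only. The Scott frame is the poset $\{r,u_1,u_2,v\}$ with $r<u_1<u_2$, $r<v$ (and $r<u_2$) only. $\mathbf{PL}$ is the smallest intermediate logic containing $\chi(\text{3-fork})$ and $\chi(\text{Scott frame})$; $\mathbf{PL}_n$ is the smallest intermediate logic containing $\mathbf{BD}_n$ and $\mathbf{PL}$. A polyhedron is a finite union of convex hulls of finite subsets of some $\mathbb R^d$; it is convex if it is a convex set. Its dimension is the maximal dimension of a simplex in any triangulation of it. An open subpolyhedron of $P$ is $P\setminus Q$ with $Q$ a polyhedron contained in $P$; $\mathrm{Sub}_o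 P$ (open subpolyhedra) is a Heyting algebra of open sets of $P$, and a formula is valid on $P$ if it is valid on $\mathrm{Sub}_o P$. $\mathrm{Logic}(\mathbf C)$ is the set of formulas valid on all members of the class $\mathbf C$. $\mathsf{Convex}_n$ is the class of convex polyhedra of dimension at most $n$. *)

theory Defs
  imports "HOL-Analysis.Analysis" "HOL-Library.Function_Algebras"
begin

text \<open>We realise every R^d at once inside the real vector space nat => real
  (pointwise operations); R^d is the subspace of vectors vanishing at all indices >= d.\<close>

instantiation "fun" :: (type, real_vector) real_vector
begin
definition scaleR_fun :: "real \<Rightarrow> ('a \<Rightarrow> 'b) \<Rightarrow> 'a \<Rightarrow> 'b"
  where "scaleR_fun r f = (\<lambda>x. scaleR r (f x))"
instance
  by standard (auto simp: scaleR_fun_def fun_eq_iff scaleR_add_right scaleR_add_left)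
end

type_synonym vec = "nat \<Rightarrow> real"

definition Rd :: "nat \<Rightarrow> vec set" where
  "Rd d = {x. \<forall>i\<ge>d. x i = 0}"

datatype form = Var nat | Bot | Conj form form | Disj form form | Imp form form

definition Top :: form where "Top = Imp Bot Bot"
definition Iff :: "form \<Rightarrow> form \<Rightarrow> form" where "Iff a b = Conj (Imp a b) (Imp b a)"

fun subst :: "(nat \<Rightarrow> form) \<Rightarrow> form \<Rightarrow> form" where
  "subst s (Var p) = s p"
| "subst s Bot = Bot"
| "subst s (Conj a b) = Conj (subst s a) (subst s b)"
| "subst s (Disj a b) = Disj (subst s a) (subst s b)"
| "subst s (Imp a b) = Imp (subst s a) (subst s b)"

inductive ipc_axiom :: "form \<Rightarrow> bool" where
  "ipc_axiom (Imp a (Imp b a))"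
| "ipc_axiom (Imp (Imp a (Imp b c)) (Imp (Imp a b) (Imp a c)))"
| "ipc_axiom (Imp (Conj a b) a)"
| "ipc_axiom (Imp (Conj a b) b)"
| "ipc_axiom (Imp a (Imp b (Conj a b)))"
| "ipc_axiom (Imp a (Disj a b))"
| "ipc_axiom (Imp b (Disj a b))"
| "ipc_axiom (Imp (Imp a c) (Imp (Imp b c) (Imp (Disj a b) c)))"
| "ipc_axiom (Imp Bot a)"

inductive_set logic_gen :: "form set \<Rightarrow> form set" for G where
  ax: "ipc_axiom a \<Longrightarrow> a \<in> logic_gen G"
| hyp: "a \<in> G \<Longrightarrow> subst s a \<in> logic_gen G"
| mp: "a \<in> logic_gen G \<Longrightarrow> Imp a b \<in> logic_gen G \<Longrightarrow> b \<in> logic_gen G"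

definition poset :: "nat set \<Rightarrow> (nat \<Rightarrow> nat \<Rightarrow> bool) \<Rightarrow> bool" where
  "poset W R \<longleftrightarrow> (\<forall>x\<in>W. R x x) \<and> (\<forall>x\<in>W. \<forall>y\<in>W. R x y \<and> R y x \<longrightarrow> x = y)
     \<and> (\<forall>x\<in>W. \<forall>y\<in>W. \<forall>z\<in>W. R x y \<and> R y z \<longrightarrow> R x z)"

definition upset :: "nat set \<Rightarrow> (nat \<Rightarrow> nat \<Rightarrow> bool) \<Rightarrow> nat set \<Rightarrow> bool" where
  "upset W R U \<longleftrightarrow> U \<subseteq> W \<and> (\<forall>x\<in>U. \<forall>y\<in>W. R x y \<longrightarrow> y \<in> U)"

definition height_le :: "nat set \<Rightarrow> (nat \<Rightarrow> nat \<Rightarrow> bool) \<Rightarrow> nat \<Rightarrow> bool" where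
  "height_le W R n \<longleftrightarrow> (\<forall>X. X \<subseteq> W \<and> (\<forall>x\<in>X. \<forall>y\<in>X. R x y \<or> R y x) \<longrightarrow> finite X \<and> card X \<le> n + 1)"

fun kforces :: "nat set \<Rightarrow> (nat \<Rightarrow> nat \<Rightarrow> bool) \<Rightarrow> (nat \<Rightarrow> nat set) \<Rightarrow> nat \<Rightarrow> form \<Rightarrow> bool" where
  "kforces W R V w (Var p) = (w \<in> V p)"
| "kforces W R V w Bot = False"
| "kforces W R V w (Conj a b) = (kforces W R V w a \<and> kforces W R V w b)"
| "kforces W R V w (Disj a b) = (kforces W R V w a \<or> kforces W R V w b)"
| "kforces W R V w (Imp a b) = (\<forall>u\<in>W. R w u \<longrightarrow> kforces W R V u a \<longrightarrow> kforces W R V u b)"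

definition kvalid :: "nat set \<Rightarrow> (nat \<Rightarrow> nat \<Rightarrow> bool) \<Rightarrow> form \<Rightarrow> bool" where
  "kvalid W R a \<longleftrightarrow> (\<forall>V. (\<forall>p. upset W R (V p)) \<longrightarrow> (\<forall>w\<in>W. kforces W R V w a))"

text \<open>BD_n: the logic of all finite frames (posets) of height at most n.
  (Every finite poset is isomorphic to one carried by a set of naturals.)\<close>
definition BD :: "nat \<Rightarrow> form set" where
  "BD n = {a. \<forall>W R. finite W \<and> poset W R \<and> height_le W R n \<longrightarrow> kvalid W R a}"

text \<open>For a finite rooted poset (Q, le) with root r, the Jankov formula of the
  subdirectly irreducible Heyting algebra Up(Q) of its upsets: one variable p_U per
  upset U, delta describes the operation tables, and the conclusion is the variable of
  the second-largest element (Q minus the root).\<close>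

definition code :: "nat set \<Rightarrow> nat" where "code U = (\<Sum>i\<in>U. 2 ^ i)"
definition pv :: "nat set \<Rightarrow> form" where "pv U = Var (code U)"

definition himp :: "nat set \<Rightarrow> (nat \<Rightarrow> nat \<Rightarrow> bool) \<Rightarrow> nat set \<Rightarrow> nat set \<Rightarrow> nat set" where
  "himp Q le U V = {x\<in>Q. \<forall>y\<in>Q. le x y \<and> y \<in> U \<longrightarrow> y \<in> V}"

definition upsets_list :: "nat set \<Rightarrow> (nat \<Rightarrow> nat \<Rightarrow> bool) \<Rightarrow> nat set list" where
  "upsets_list Q le = filter (upset Q le) (map set (subseqs (sorted_list_of_set Q)))"

definition bigconj :: "form list \<Rightarrow> form" where
  "bigconj xs = foldr Conj xs Top"

definition jankov :: "nat set \<Rightarrow> (nat \<Rightarrow> nat \<Rightarrow> bool) \<Rightarrow> nat \<Rightarrow> form" where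
  "jankov Q le r =
     (let us = upsets_list Q le;
          delta = bigconj
            (Iff (pv {}) Bot #
             concat (map (\<lambda>U. concat (map (\<lambda>V.
               [Iff (pv (U \<inter> V)) (Conj (pv U) (pv V)),
                Iff (pv (U \<union> V)) (Disj (pv U) (pv V)),
                Iff (pv (himp Q le U V)) (Imp (pv U) (pv V))]) us)) us))
      in Imp delta (pv (Q - {r})))"

definition fork3_le :: "nat \<Rightarrow> nat \<Rightarrow> bool" where
  "fork3_le x y \<longleftrightarrow> x = y \<or> x = 0"

definition scott_le :: "nat \<Rightarrow> nat \<Rightarrow> bool" where
  "scott_le x y \<longleftrightarrow> x = y \<or> x = 0 \<or> (x = 1 \<and> y = 2)"

definition chi_fork3 :: form where "chi_fork3 = jankov {0,1,2,3} fork3_le 0"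
definition chi_scott :: form where "chi_scott = jankov {0,1,2,3} scott_le 0"

definition PL :: "form set" where "PL = logic_gen {chi_fork3, chi_scott}"

definition PLn :: "nat \<Rightarrow> form set" where
  "PLn n = logic_gen (BD n \<union> {chi_fork3, chi_scott})"

definition polyhedron :: "vec set \<Rightarrow> bool" where
  "polyhedron P \<longleftrightarrow> (\<exists>d \<S>. finite \<S> \<and> (\<forall>S\<in>\<S>. finite S \<and> S \<subseteq> Rd d) \<and> P = \<Union>((\<lambda>S. convex hull S) ` \<S>))"

text \<open>A triangulation of P, given by the vertex sets of its simplices.\<close>
definition triangulation :: "vec set set \<Rightarrow> vec set \<Rightarrow> bool" where
  "triangulation K P \<longleftrightarrow> finite K
     \<and> (\<forall>V\<in>K. finite V \<and> V \<noteq> {} \<and> \<not> affine_dependent V)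
     \<and> (\<forall>V\<in>K. \<forall>W. W \<subseteq> V \<and> W \<noteq> {} \<longrightarrow> W \<in> K)
     \<and> (\<forall>V\<in>K. \<forall>W\<in>K. convex hull V \<inter> convex hull W = convex hull (V \<inter> W))
     \<and> \<Union>((\<lambda>V. convex hull V) ` K) = P"

text \<open>Dimension: the maximal dimension (number of vertices minus one) of a simplex
  in a triangulation (independent of the triangulation; 0 for the empty polyhedron).\<close>
definition poly_dim :: "vec set \<Rightarrow> nat" where
  "poly_dim P = Sup {card V - 1 | V K. triangulation K P \<and> V \<in> K}"

definition Sub_o :: "vec set \<Rightarrow> vec set set" where
  "Sub_o P = {P - Q | Q. polyhedron Q \<and> Q \<subseteq> P}"

text \<open>Evaluation in the Heyting algebra Sub_o P; implication is the Heyting implication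
  (the largest element c with c inter a contained in b).\<close>
fun heval :: "vec set \<Rightarrow> (nat \<Rightarrow> vec set) \<Rightarrow> form \<Rightarrow> vec set" where
  "heval P v (Var p) = v p"
| "heval P v Bot = {}"
| "heval P v (Conj a b) = heval P v a \<inter> heval P v b"
| "heval P v (Disj a b) = heval P v a \<union> heval P v b"
| "heval P v (Imp a b) = \<Union>{c \<in> Sub_o P. c \<inter> heval P v a \<subseteq> heval P v b}"

definition poly_valid :: "vec set \<Rightarrow> form \<Rightarrow> bool" where
  "poly_valid P a \<longleftrightarrow> (\<forall>v. (\<forall>p. v p \<in> Sub_o P) \<longrightarrow> heval P v a = P)"

definition Logic :: "vec set set \<Rightarrow> form set" where
  "Logic C = {a. \<forall>P\<in>C. poly_valid P a}"

definition Convex :: "nat \<Rightarrow> vec set set" where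
  "Convex n = {P. polyhedron P \<and> convex P \<and> poly_dim P \<le> n}"

end

theory Submission
  imports Defs "HOL-Library.Nat_Bijection"
begin

text \<open>
A finite list \<open>L\<close> of affine functions cuts a convex polyhedron \<open>P\<close> into sign cells, ordered by
\<open>\<sigma> \<le> \<tau>\<close> iff \<open>\<tau>\<close> agrees with \<open>\<sigma>\<close> wherever \<open>\<sigma>\<close> is nonzero. By convexity, if the cell of \<open>y\<close> lies
above that of \<open>x\<close> then the half-open segment from \<open>x\<close> to \<open>y\<close> stays in the cell of \<open>y\<close>; hence the map
to the poset of cells is open, and a formula is valid on \<open>P\<close> iff it is valid on all these posets.

Soundness: a chain of cells yields affinely independent points, so the cell posets have height at most the
dimension; and if the cells strictly above a cell split into two parts, points of the two parts must lie on
exactly opposite sides of that cell, so both parts are singletons. The latter property is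
equivalent to the validity of the two Jankov formulas.

Completeness: since \<open>BD\<^sub>n\<close> is locally finite, a formula outside \<open>PL\<^sub>n\<close> fails on a finite canonical frame
of depth at most \<open>n\<close> with the splitting property. Such a frame is an open image of a polyhedral cone:
the points above a given point are walked along in one coordinate, gluing the cones constructed for them side by side
along regions labelled by maximal points, and the result is contracted to the apex in a new coordinate.
\<close>

subsection \<open>Kripke semantics\<close>

text \<open>What shapes the completeness proof is the dimension: each increase of depth may cost
  only one coordinate, however many points have to be arranged. Coordinate 0 is therefore reused at
  every level for laying pieces side by side, and the one new coordinate serves first as the unit of
  length by which pieces are moved apart and then as the distance from the new apex. Pieces are
  glued only where both carry the same maximal label: such a label asks for no other label nearby,
  so the seam creates no new condition. The splitting property connects the maximal points above a
  point, except when just two points lie above it, and these fit on the two sides of the apex. On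
  the soundness side \<open>poly_dim\<close> is a supremum over all triangulations. Bounding chains
  of cells needs the existence of a triangulation and the fact that every triangulation of a convex
  set has a simplex at least as large as any affinely independent set in it. Closedness of polyhedra
  is used only along lines, where it reduces to finitely many inequalities in one real
  variable.\<close>

fun vars :: "form \<Rightarrow> nat set" where
  "vars (Var p) = {p}"
| "vars Bot = {}"
| "vars (Conj a b) = vars a \<union> vars b"
| "vars (Disj a b) = vars a \<union> vars b"
| "vars (Imp a b) = vars a \<union> vars b"

lemma finite_vars [simp]: "finite (vars a)"
  by (induction a) auto

lemma poset_refl: "poset W R \<Longrightarrow> x \<in> W \<Longrightarrow> R x x"
  and poset_antisym: "poset W R \<Longrightarrow> x \<in> W \<Longrightarrow> y \<in> W \<Longrightarrow> R x y \<Longrightarrow> R y x \<Longrightarrow> x = y"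
  and poset_trans: "poset W R \<Longrightarrow> x \<in> W \<Longrightarrow> y \<in> W \<Longrightarrow> z \<in> W \<Longrightarrow> R x y \<Longrightarrow> R y z \<Longrightarrow> R x z"
  unfolding poset_def by blast+

lemma upsetI: "U \<subseteq> W \<Longrightarrow> (\<And>x y. x \<in> U \<Longrightarrow> y \<in> W \<Longrightarrow> R x y \<Longrightarrow> y \<in> U) \<Longrightarrow> upset W R U"
  and upsetD: "upset W R U \<Longrightarrow> x \<in> U \<Longrightarrow> y \<in> W \<Longrightarrow> R x y \<Longrightarrow> y \<in> U"
  and upset_subset: "upset W R U \<Longrightarrow> U \<subseteq> W"
  unfolding upset_def by blast+

lemma upset_principal: "poset W R \<Longrightarrow> x \<in> W \<Longrightarrow> upset W R {u\<in>W. R x u}"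
  by (rule upsetI) (auto intro: poset_trans)

lemma kforces_mono:
  assumes "poset W R" "\<And>p. upset W R (V p)" "w \<in> W" "u \<in> W" "R w u" "kforces W R V w a"
  shows "kforces W R V u a"
  using assms(3-)
proof (induction a arbitrary: w u)
  case (Var p)
  then show ?case using assms(2)[of p] by (auto simp: upset_def)
next
  case (Imp a b)
  show ?case unfolding kforces.simps
  proof (intro ballI impI)
    fix v assume v: "v \<in> W" "R u v" and a: "kforces W R V v a"
    have "R w v" using poset_trans[OF assms(1) Imp.prems(1,2) v(1) Imp.prems(3) v(2)] .
    then show "kforces W R V v b" using Imp.prems(4) v(1) a by simp
  qed
next
  case (Conj a b)
  then show ?case by (metis kforces.simps(3))
next
  case (Disj a b)
  then show ?case by (metis kforces.simps(4))
qed simp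

lemma kforces_cong:
  assumes "\<And>p u. p \<in> vars a \<Longrightarrow> u \<in> W \<Longrightarrow> u \<in> V p \<longleftrightarrow> u \<in> V' p" "w \<in> W"
  shows "kforces W R V w a \<longleftrightarrow> kforces W R V' w a"
  using assms by (induction a arbitrary: w) auto

lemma kforces_subst:
  assumes "w \<in> W"
  shows "kforces W R V w (subst s a)
    \<longleftrightarrow> kforces W R (\<lambda>p. {u\<in>W. kforces W R V u (s p)}) w a"
  using assms by (induction a arbitrary: w) auto

lemma upset_forced:
  assumes "poset W R" "\<And>p. upset W R (V p)"
  shows "upset W R {u\<in>W. kforces W R V u a}"
  unfolding upset_def using kforces_mono[OF assms] by auto

lemma kvalid_subst:
  assumes "poset W R" "kvalid W R a"
  shows "kvalid W R (subst s a)"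
  unfolding kvalid_def
proof (intro allI impI ballI)
  fix V :: "nat \<Rightarrow> nat set" and w assume V: "\<forall>p. upset W R (V p)" and w: "w \<in> W"
  have "\<forall>p. upset W R {u\<in>W. kforces W R V u (s p)}"
    using upset_forced[OF assms(1)] V by auto
  then show "kforces W R V w (subst s a)"
    using assms(2)[unfolded kvalid_def, rule_format, of "\<lambda>p. {u\<in>W. kforces W R V u (s p)}"] w
    by (simp add: kforces_subst)
qed

lemma kvalid_ipc_axiom:
  assumes "poset W R" "ipc_axiom a"
  shows "kvalid W R a"
  unfolding kvalid_def
proof (intro allI impI ballI)
  fix V :: "nat \<Rightarrow> nat set" and w assume "\<forall>p. upset W R (V p)" and w: "w \<in> W"
  then have V: "\<And>p. upset W R (V p)" by auto
  note mono = kforces_mono[OF assms(1) V]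
  have refl: "\<And>x. x \<in> W \<Longrightarrow> R x x"
    and trans: "\<And>x y z. x \<in> W \<Longrightarrow> y \<in> W \<Longrightarrow> z \<in> W \<Longrightarrow> R x y \<Longrightarrow> R y z \<Longrightarrow> R x z"
    using assms(1) unfolding poset_def by blast+
  from assms(2) w show "kforces W R V w a"
  proof (cases)
    case (1 a b)
    then show ?thesis using mono by auto
  next
    case (2 a b c)
    then show ?thesis by simp (meson refl trans w)
  next
    case (5 a b)
    then show ?thesis using mono by auto
  next
    case (8 a c b)
    then show ?thesis by simp (meson refl trans w)
  qed auto
qed

lemma kvalid_mp:
  assumes "poset W R" "kvalid W R a" "kvalid W R (Imp a b)"
  shows "kvalid W R b"
  using assms unfolding kvalid_def poset_def by (meson kforces.simps(5))

lemma kvalid_logic_gen: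
  assumes "poset W R" "\<And>g. g \<in> G \<Longrightarrow> kvalid W R g" "a \<in> logic_gen G"
  shows "kvalid W R a"
  using assms(3)
  by (induction) (use assms in \<open>auto intro: kvalid_ipc_axiom kvalid_subst kvalid_mp\<close>)

section \<open>Depth of points and the bounded depth formulas\<close>

definition above :: "nat set \<Rightarrow> (nat \<Rightarrow> nat \<Rightarrow> bool) \<Rightarrow> nat \<Rightarrow> nat set" where
  "above W R x = {u\<in>W. R x u \<and> u \<noteq> x}"

primrec depth_le :: "nat set \<Rightarrow> (nat \<Rightarrow> nat \<Rightarrow> bool) \<Rightarrow> nat \<Rightarrow> nat \<Rightarrow> bool" where
  "depth_le W R 0 x \<longleftrightarrow> above W R x = {}"
| "depth_le W R (Suc m) x \<longleftrightarrow> (\<forall>u\<in>above W R x. depth_le W R m u)"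

lemma depth_le_Suc: "depth_le W R m x \<Longrightarrow> depth_le W R (Suc m) x"
  by (induction m arbitrary: x) auto

lemma depth_le_mono: "m \<le> k \<Longrightarrow> depth_le W R m x \<Longrightarrow> depth_le W R k x"
  by (induction rule: dec_induct) (blast intro: depth_le_Suc)+

text \<open>Failure of the bound \<open>m\<close> means \<open>m + 1\<close> strict steps upwards,
  hence \<open>m + 2\<close> points. The chain is started at \<open>x\<close> so that the induction
  can put a new least element below it.\<close>

lemma long_chain_if_not_depth_le:
  assumes "poset W R" "x \<in> W" "\<not> depth_le W R m x"
  shows "\<exists>X\<subseteq>W. (\<forall>u\<in>X. \<forall>v\<in>X. R u v \<or> R v u) \<and> finite X \<and> card X = m + 2 \<and> x \<in> X
    \<and> (\<forall>u\<in>X. R x u)"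
  using assms(2,3)
proof (induction m arbitrary: x)
  case 0
  then obtain u where u: "u \<in> W" "R x u" "u \<noteq> x" by (auto simp: above_def)
  then have "R x x" "R u u" using poset_refl[OF assms(1)] 0(1) by auto
  then show ?case using u 0(1) by (intro exI[of _ "{x,u}"]) simp
next
  case (Suc m)
  then obtain u where u: "u \<in> W" "R x u" "u \<noteq> x" "\<not> depth_le W R m u" by (auto simp: above_def)
  from Suc.IH[OF u(1,4)] obtain X where X: "X \<subseteq> W" "\<forall>u\<in>X. \<forall>v\<in>X. R u v \<or> R v u"
    "finite X" "card X = m + 2" "u \<in> X" "\<forall>v\<in>X. R u v" by blast
  have x: "\<forall>v\<in>X. R x v" using X(1,6) u Suc.prems(1) poset_trans[OF assms(1)] by blast
  have "x \<notin> X" using X(6) u Suc.prems(1) poset_antisym[OF assms(1)] by blast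
  moreover have "R x x" using poset_refl[OF assms(1)] Suc.prems(1) .
  ultimately show ?case using X x Suc.prems(1)
    by (intro exI[of _ "insert x X"]) simp
qed

lemma depth_le_if_height_le:
  assumes "poset W R" "height_le W R n" "x \<in> W"
  shows "depth_le W R n x"
proof (rule ccontr)
  assume "\<not> ?thesis"
  from long_chain_if_not_depth_le[OF assms(1,3) this]
  obtain X where "X \<subseteq> W" "\<forall>u\<in>X. \<forall>v\<in>X. R u v \<or> R v u" "card X = n + 2" by blast
  then have "card X \<le> n + 1" using assms(2) unfolding height_le_def by blast
  then show False using \<open>card X = n + 2\<close> by simp
qed

text \<open>The usual axioms of bounded depth, with one fresh variable for each level.\<close>

primrec bd_form :: "nat \<Rightarrow> form" where
  "bd_form 0 = Disj (Var 0) (Imp (Var 0) Bot)"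
| "bd_form (Suc m) = Disj (Var (Suc m)) (Imp (Var (Suc m)) (bd_form m))"

lemma kforces_bd_form:
  assumes "poset W R" "\<And>p. upset W R (V p)" "x \<in> W" "depth_le W R m x"
  shows "kforces W R V x (bd_form m)"
  using assms(3,4)
proof (induction m arbitrary: x)
  case 0
  then show ?case by (auto simp: above_def)
next
  case (Suc m)
  show ?case
  proof (cases "x \<in> V (Suc m)")
    case False
    have "kforces W R V u (bd_form m)" if "u \<in> W" "R x u" "u \<in> V (Suc m)" for u
      using Suc.IH[OF that(1)] Suc.prems that False by (auto simp: above_def)
    then show ?thesis by auto
  qed auto
qed

lemma bd_form_in_BD: "bd_form n \<in> BD n"
  unfolding BD_def kvalid_def
  using kforces_bd_form depth_le_if_height_le by blast

text \<open>Along a long chain, the variable of each level is made true on the upset generated by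
  the next point. Since \<open>bd_form m\<close> uses only variables up to \<open>m\<close>, the
  value of variable \<open>Suc m\<close> can be reset without disturbing the refutation at that
  point.\<close>

lemma not_kforces_bd_form:
  assumes "poset W R" "x \<in> W" "\<not> depth_le W R m x"
  shows "\<exists>V. (\<forall>p. upset W R (V p)) \<and> \<not> kforces W R V x (bd_form m)"
  using assms(2,3)
proof (induction m arbitrary: x)
  case 0
  then obtain u where u: "u \<in> W" "R x u" "u \<noteq> x" by (auto simp: above_def)
  define V where "V = (\<lambda>p::nat. {v\<in>W. R u v})"
  have "\<forall>p. upset W R (V p)" using upset_principal[OF assms(1) u(1)] by (simp add: V_def)
  moreover have "x \<notin> V 0" "u \<in> V 0"
    using u 0(1) poset_refl[OF assms(1)] poset_antisym[OF assms(1)] by (auto simp: V_def)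
  ultimately show ?case using u by (intro exI[of _ V]) auto
next
  case (Suc m)
  then obtain u where u: "u \<in> W" "R x u" "u \<noteq> x" "\<not> depth_le W R m u" by (auto simp: above_def)
  from Suc.IH[OF u(1,4)] obtain V where V: "\<forall>p. upset W R (V p)"
    "\<not> kforces W R V u (bd_form m)" by blast
  define V' where "V' = V(Suc m := {v\<in>W. R u v})"
  have vars: "vars (bd_form k) \<subseteq> {..k}" for k by (induction k) auto
  have up: "\<forall>p. upset W R (V' p)"
    using V(1) upset_principal[OF assms(1) u(1)] unfolding V'_def by simp
  have *: "\<not> kforces W R V' u (bd_form m)"
    using V(2) kforces_cong[of "bd_form m" W V V' u R] vars[of m] u(1)
    by (metis V'_def atMost_iff fun_upd_other not_less_eq_eq order_refl subsetD)
  moreover have "x \<notin> V' (Suc m)" "u \<in> V' (Suc m)"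
    using u Suc.prems(1) poset_refl[OF assms(1)] poset_antisym[OF assms(1)] by (auto simp: V'_def)
  ultimately show ?case using u up by (intro exI[of _ V']) auto
qed

subsection \<open>Jankov formulas\<close>

lemma upsets_list_iff:
  assumes "finite Q"
  shows "U \<in> set (upsets_list Q le) \<longleftrightarrow> upset Q le U"
proof -
  have "set (map set (subseqs (sorted_list_of_set Q))) = Pow Q"
    using assms by (simp add: subseqs_powset)
  then show ?thesis unfolding upsets_list_def set_filter by (auto simp: upset_def)
qed

lemma kforces_Top [simp]: "kforces W R V w Top"
  by (simp add: Top_def)

lemma kforces_bigconj: "kforces W R V w (bigconj xs) \<longleftrightarrow> (\<forall>a\<in>set xs. kforces W R V w a)"
  unfolding bigconj_def by (induction xs) auto

lemma code_eq_iff: "finite U \<Longrightarrow> finite V \<Longrightarrow> code U = code V \<longleftrightarrow> U = V"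
  using set_encode_eq[of U V] by (simp add: code_def set_encode_def)

definition jankov_diagram :: "nat set \<Rightarrow> (nat \<Rightarrow> nat \<Rightarrow> bool) \<Rightarrow> form list" where
  "jankov_diagram Q le = (let us = upsets_list Q le in
     Iff (pv {}) Bot #
            concat (map (\<lambda>U. concat (map (\<lambda>V.
               [Iff (pv (U \<inter> V)) (Conj (pv U) (pv V)),
                Iff (pv (U \<union> V)) (Disj (pv U) (pv V)),
                Iff (pv (himp Q le U V)) (Imp (pv U) (pv V))]) us)) us))"

lemma jankov_eq: "jankov Q le r = Imp (bigconj (jankov_diagram Q le)) (pv (Q - {r}))"
  by (simp add: jankov_def jankov_diagram_def Let_def)

lemma kforces_jankov_diagram:
  assumes "finite Q"
  shows "kforces W R V w (bigconj (jankov_diagram Q le)) \<longleftrightarrow>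
    kforces W R V w (Iff (pv {}) Bot) \<and>
    (\<forall>A B. upset Q le A \<and> upset Q le B \<longrightarrow>
      kforces W R V w (Iff (pv (A \<inter> B)) (Conj (pv A) (pv B))) \<and>
      kforces W R V w (Iff (pv (A \<union> B)) (Disj (pv A) (pv B))) \<and>
      kforces W R V w (Iff (pv (himp Q le A B)) (Imp (pv A) (pv B))))"
  unfolding kforces_bigconj jankov_diagram_def Let_def
  using upsets_list_iff[OF assms] by (simp add: Ball_def) blast

lemma kforces_Iff:
  "kforces W R V w (Iff a b) \<longleftrightarrow> (\<forall>u\<in>W. R w u \<longrightarrow> (kforces W R V u a \<longleftrightarrow> kforces W R V u b))"
  by (auto simp: Iff_def)

text \<open>A p-morphism \<open>f\<close> from the points above \<open>x\<close> onto
  \<open>Q\<close> pulls upsets back to upsets and commutes with the Heyting operations. The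
  valuation that sends \<open>pv U\<close> to the preimage of \<open>U\<close> therefore makes the
  whole diagram true at \<open>x\<close>, while \<open>f x\<close> is the root and lies outside
  \<open>Q - {r}\<close>.\<close>

lemma not_kvalid_jankov_if_pmorphism:
  assumes W: "poset W R" and Q: "finite Q" "poset Q le" and x: "x \<in> W"
    and f: "\<And>u. u \<in> W \<Longrightarrow> R x u \<Longrightarrow> f u \<in> Q"
    and mono: "\<And>u v. u \<in> W \<Longrightarrow> v \<in> W \<Longrightarrow> R x u \<Longrightarrow> R u v \<Longrightarrow> le (f u) (f v)"
    and lift: "\<And>u q. u \<in> W \<Longrightarrow> R x u \<Longrightarrow> q \<in> Q \<Longrightarrow> le (f u) q \<Longrightarrow> \<exists>v\<in>W. R u v \<and> f v = q"
    and r: "f x = r" and root: "\<And>q. q \<in> Q \<Longrightarrow> le r q"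
  shows "\<not> kvalid W R (jankov Q le r)"
proof
  assume valid: "kvalid W R (jankov Q le r)"
  define V where "V = (\<lambda>p. {u\<in>W. R x u \<and> (\<exists>U. upset Q le U \<and> p = code U \<and> f u \<in> U)})"
  have refl: "\<And>x. x \<in> W \<Longrightarrow> R x x"
    and trans: "\<And>x y z. x \<in> W \<Longrightarrow> y \<in> W \<Longrightarrow> z \<in> W \<Longrightarrow> R x y \<Longrightarrow> R y z \<Longrightarrow> R x z"
    using W unfolding poset_def by blast+
  have "upset W R (V p)" for p
  proof (rule upsetI)
    fix u v assume u: "u \<in> V p" and v: "v \<in> W" "R u v"
    then obtain U where U: "u \<in> W" "R x u" "upset Q le U" "p = code U" "f u \<in> U"
      by (auto simp: V_def)
    have "R x v" using trans[OF x U(1) v(1) U(2) v(2)] .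
    moreover have "f v \<in> U" using upsetD[OF U(3,5) f mono] U v calculation by blast
    ultimately show "v \<in> V p" using U v by (auto simp: V_def)
  qed (auto simp: V_def)
  then have "kforces W R V x (jankov Q le r)" using valid x by (auto simp: kvalid_def)
  moreover have pv: "kforces W R V u (pv U) \<longleftrightarrow> f u \<in> U" if "upset Q le U" "u \<in> W" "R x u" for U u
  proof -
    have fin: "finite U'" if "upset Q le U'" for U'
      using that Q(1) finite_subset unfolding upset_def by blast
    show ?thesis using that fin code_eq_iff unfolding pv_def V_def by auto
  qed
  moreover have "kforces W R V x (bigconj (jankov_diagram Q le))"
  proof -
    have ops: "upset Q le {}" "upset Q le A \<Longrightarrow> upset Q le B \<Longrightarrow> upset Q le (A \<inter> B)"
      "upset Q le A \<Longrightarrow> upset Q le B \<Longrightarrow> upset Q le (A \<union> B)"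
      for A B
      unfolding upset_def by blast+
    have ops': "upset Q le (himp Q le A B)" for A B
    proof (rule upsetI)
      fix a b assume a: "a \<in> himp Q le A B" and b: "b \<in> Q" "le a b"
      then have "le a y" if "y \<in> Q" "le b y" for y
        using poset_trans[OF Q(2), of a b y] that by (simp add: himp_def)
      then show "b \<in> himp Q le A B" using a b by (auto simp: himp_def)
    qed (auto simp: himp_def)
    \<comment> \<open>Preimages commute with implication; one direction is the place where
      \<open>lift\<close> is used.\<close>
    have himp: "f u \<in> himp Q le A B \<longleftrightarrow> (\<forall>v\<in>W. R u v \<longrightarrow> f v \<in> A \<longrightarrow> f v \<in> B)"
      if "u \<in> W" "R x u" "upset Q le A" for A B u
      using lift[OF that(1,2)] f[OF that(1,2)] f mono[OF that(1) _ that(2)] that trans[OF x that(1)]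
      unfolding himp_def upset_def by blast
    show ?thesis
      unfolding kforces_jankov_diagram[OF Q(1)] kforces_Iff kforces.simps
    proof (intro conjI allI impI ballI)
      fix A B u assume AB: "upset Q le A \<and> upset Q le B" and u: "u \<in> W" "R x u"
      have Rxv: "R x v" if "v \<in> W" "R u v" for v using trans[OF x u(1) that(1) u(2) that(2)] .
      show "kforces W R V u (pv (A \<inter> B)) = (kforces W R V u (pv A) \<and> kforces W R V u (pv B))"
        "kforces W R V u (pv (A \<union> B)) = (kforces W R V u (pv A) \<or> kforces W R V u (pv B))"
        using AB u by (simp_all add: pv ops)
      have "f u \<in> himp Q le A B \<longleftrightarrow> (\<forall>v\<in>W. R u v \<longrightarrow> f v \<in> A \<longrightarrow> f v \<in> B)"
        by (rule himp) (use u AB in auto)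
      then show "kforces W R V u (pv (himp Q le A B)) =
         (\<forall>v\<in>W. R u v \<longrightarrow> kforces W R V v (pv A) \<longrightarrow> kforces W R V v (pv B))"
        using AB u Rxv by (simp add: pv ops')
    qed (simp add: pv ops)
  qed
  moreover have "upset Q le (Q - {r})"
  proof (rule upsetI)
    fix a b assume a: "a \<in> Q - {r}" and b: "b \<in> Q" "le a b"
    show "b \<in> Q - {r}" using poset_antisym[OF Q(2) _ _ b(2)] a b root by auto
  qed auto
  ultimately show False using refl[OF x] x r unfolding jankov_eq by (auto simp: pv)
qed

text \<open>Among the points of \<open>S\<close> above \<open>s\<close>, one with the fewest points
  above it: a point of \<open>S\<close> strictly above would have strictly fewer.\<close>

lemma maximal_witness:
  assumes "finite W" "poset W R" "S \<subseteq> W" "s \<in> S"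
  shows "\<exists>m\<in>S. R s m \<and> (\<forall>u\<in>above W R m. u \<notin> S)"
proof -
  let ?S = "{u\<in>S. R s u}"
  have "s \<in> ?S" using assms unfolding poset_def by blast
  then obtain m where m: "m \<in> ?S" "\<forall>u\<in>?S. card {v\<in>W. R m v} \<le> card {v\<in>W. R u v}"
    using ex_has_least_nat[of "\<lambda>u. u \<in> ?S" s "\<lambda>u. card {v\<in>W. R u v}"] by blast
  have "u \<notin> S" if u: "u \<in> above W R m" for u
  proof
    assume "u \<in> S"
    have mW: "m \<in> W" "s \<in> W" "u \<in> W" "R s m" "R m u" "m \<noteq> u"
      using m(1) assms u unfolding above_def by auto
    then have "R s u" using assms(2) unfolding poset_def by blast
    moreover have "{v\<in>W. R u v} \<subset> {v\<in>W. R m v}"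
      using mW assms(2) unfolding poset_def by blast
    then have "card {v\<in>W. R u v} < card {v\<in>W. R m v}" using assms(1) by (simp add: psubset_card_mono)
    ultimately show False using m(2) \<open>u \<in> S\<close> by fastforce
  qed
  then show ?thesis using m(1) by blast
qed

text \<open>The algebraic form of a refutation. On the points above \<open>w\<close> the map
  \<open>A\<close> acts as a Heyting homomorphism on the upsets of \<open>Q\<close>, and the second
  largest upset goes to a set that contains everything strictly above \<open>w\<close> but not
  \<open>w\<close>.\<close>

definition jankov_refutes ::
  "nat set \<Rightarrow> (nat \<Rightarrow> nat \<Rightarrow> bool) \<Rightarrow> nat set \<Rightarrow> (nat \<Rightarrow> nat \<Rightarrow> bool) \<Rightarrow> nat \<Rightarrow> (nat set \<Rightarrow> nat set) \<Rightarrow> nat \<Rightarrow> bool"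
  where "jankov_refutes W R Q le r A w \<longleftrightarrow>
    w \<in> W \<and> w \<notin> A (Q - {r}) \<and> above W R w \<subseteq> A (Q - {r}) \<and> A {} = {} \<and>
    (\<forall>U. upset W R (A U)) \<and>
    (\<forall>S T. upset Q le S \<and> upset Q le T \<longrightarrow> A (S \<inter> T) = A S \<inter> A T \<and> A (S \<union> T) = A S \<union> A T \<and>
      (\<forall>u\<in>W. R w u \<longrightarrow> (u \<in> A (himp Q le S T) \<longleftrightarrow> (\<forall>v\<in>W. R u v \<longrightarrow> v \<in> A S \<longrightarrow> v \<in> A T))))"

lemma jankov_refutesD:
  assumes "jankov_refutes W R Q le r A w"
  shows "w \<in> W" "w \<notin> A (Q - {r})" "above W R w \<subseteq> A (Q - {r})" "A {} = {}"
    "\<And>U. upset W R (A U)"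
    "\<And>S T. upset Q le S \<Longrightarrow> upset Q le T \<Longrightarrow> A (S \<inter> T) = A S \<inter> A T"
    "\<And>S T. upset Q le S \<Longrightarrow> upset Q le T \<Longrightarrow> A (S \<union> T) = A S \<union> A T"
    "\<And>S T u. upset Q le S \<Longrightarrow> upset Q le T \<Longrightarrow> u \<in> W \<Longrightarrow> R w u \<Longrightarrow> u \<in> A (himp Q le S T)
       \<longleftrightarrow> (\<forall>v\<in>W. R u v \<longrightarrow> v \<in> A S \<longrightarrow> v \<in> A T)"
  using assms unfolding jankov_refutes_def by simp_all

text \<open>A refuting point is moved up to a maximal point \<open>w\<close> that still fails
  \<open>pv (Q - {r})\<close>. The diagram persists upwards and so holds at
  \<open>w\<close>.\<close>

lemma jankov_refutation:
  assumes W: "finite W" "poset W R" and Q: "finite Q" and nv: "\<not> kvalid W R (jankov Q le r)"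
  shows "\<exists>A w. jankov_refutes W R Q le r A w"
proof -
  have trans: "\<And>x y z. x \<in> W \<Longrightarrow> y \<in> W \<Longrightarrow> z \<in> W \<Longrightarrow> R x y \<Longrightarrow> R y z \<Longrightarrow> R x z"
    using W unfolding poset_def by blast+
  from nv obtain V x where V: "\<And>p. upset W R (V p)" and x: "x \<in> W"
    "\<not> kforces W R V x (jankov Q le r)" unfolding kvalid_def by blast
  then obtain y where y: "y \<in> W" "kforces W R V y (bigconj (jankov_diagram Q le))"
    "\<not> kforces W R V y (pv (Q - {r}))" unfolding jankov_eq by auto
  obtain w where w: "w \<in> {u\<in>W. \<not> kforces W R V u (pv (Q - {r}))}" "R y w"
    and wm: "\<forall>u\<in>above W R w. u \<notin> {u\<in>W. \<not> kforces W R V u (pv (Q - {r}))}"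
    using maximal_witness[OF W, of "{u\<in>W. \<not> kforces W R V u (pv (Q - {r}))}" y] y(1,3) by blast
  have diag: "kforces W R V w (bigconj (jankov_diagram Q le))"
    using kforces_mono[OF W(2) V y(1) _ w(2) y(2)] w(1) by blast
  define A where "A = (\<lambda>U. {u\<in>W. R w u \<and> kforces W R V u (pv U)})"
  have A: "above W R w \<subseteq> A (Q - {r})" using wm by (auto simp: A_def above_def)
  have "A {} = {}" using diag by (auto simp: A_def kforces_jankov_diagram[OF Q] kforces_Iff)
  moreover have "upset W R (A U)" for U
  proof (rule upsetI)
    fix u v assume u: "u \<in> A U" and v: "v \<in> W" "R u v"
    then show "v \<in> A U"
      using kforces_mono[OF W(2) V, where w = u and u = v and a = "pv U"] w(1) trans[of w u v]
      by (simp add: A_def)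
  qed (auto simp: A_def)
  moreover have "A (S \<inter> T) = A S \<inter> A T \<and> A (S \<union> T) = A S \<union> A T \<and>
      (\<forall>u\<in>W. R w u \<longrightarrow> (u \<in> A (himp Q le S T) \<longleftrightarrow> (\<forall>v\<in>W. R u v \<longrightarrow> v \<in> A S \<longrightarrow> v \<in> A T)))"
    if ST: "upset Q le S" "upset Q le T" for S T
  proof (intro conjI ballI impI)
    note d = diag[unfolded kforces_jankov_diagram[OF Q] kforces_Iff, THEN conjunct2, rule_format, OF conjI[OF ST]]
    show "A (S \<inter> T) = A S \<inter> A T" "A (S \<union> T) = A S \<union> A T"
      using d by (auto simp: A_def)
    fix u assume u: "u \<in> W" "R w u"
    have "R w v" if "v \<in> W" "R u v" for v using trans[of w u v] u that w(1) by blast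
    then show "u \<in> A (himp Q le S T) \<longleftrightarrow> (\<forall>v\<in>W. R u v \<longrightarrow> v \<in> A S \<longrightarrow> v \<in> A T)"
      using d u by (simp add: A_def)
  qed
  ultimately have "jankov_refutes W R Q le r A w"
    using A w(1) unfolding jankov_refutes_def by (simp add: A_def)
  then show ?thesis by blast
qed

definition pl_frame :: "nat set \<Rightarrow> (nat \<Rightarrow> nat \<Rightarrow> bool) \<Rightarrow> bool" where
  "pl_frame W R \<longleftrightarrow> (\<forall>x\<in>W. \<forall>A B. upset W R A \<and> upset W R B \<and> A \<union> B = above W R x \<and> A \<inter> B = {}
     \<and> A \<noteq> {} \<and> B \<noteq> {} \<longrightarrow> is_singleton A \<and> is_singleton B)"

lemma upset_Un: "upset W R A \<Longrightarrow> upset W R B \<Longrightarrow> upset W R (A \<union> B)"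
  and upset_Int: "upset W R A \<Longrightarrow> upset W R B \<Longrightarrow> upset W R (A \<inter> B)"
  unfolding upset_def by blast+

lemma upset_above: "poset W R \<Longrightarrow> x \<in> W \<Longrightarrow> upset W R (above W R x)"
  unfolding upset_def above_def poset_def by blast

text \<open>Otherwise \<open>A {1}\<close>, \<open>A {2}\<close> and \<open>A {3}\<close> cut the
  points strictly above \<open>w\<close> into three disjoint nonempty upsets. Grouping the last two
  gives a splitting with a part that is not a singleton.\<close>

lemma pl_frame_chi_fork3:
  assumes "finite W" "poset W R" "pl_frame W R"
  shows "kvalid W R chi_fork3"
proof (rule ccontr)
  let ?Q = "{0,1,2,3::nat}"
  assume nv: "\<not> ?thesis"
  obtain A w where jr: "jankov_refutes W R ?Q fork3_le 0 A w"
    using jankov_refutation[OF assms(1,2) _ nv[unfolded chi_fork3_def]] by auto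
  note w = jankov_refutesD(1-4)[OF jr] and up = jankov_refutesD(5)[OF jr]
    and Int = jankov_refutesD(6)[OF jr] and Un = jankov_refutesD(7)[OF jr]
    and himp = jankov_refutesD(8)[OF jr]
  have us: "upset ?Q fork3_le S" if "S \<subseteq> {1,2,3}" for S
    using that unfolding upset_def fork3_le_def by auto
  have Q: "?Q - {0} = {1} \<union> ({2} \<union> {3})" by auto
  have A: "A (?Q - {0}) = A {1} \<union> (A {2} \<union> A {3})"
  proof -
    have "A ({1} \<union> ({2} \<union> {3})) = A {1} \<union> A ({2} \<union> {3})" by (rule Un; rule us; simp)
    moreover have "A ({2} \<union> {3}) = A {2} \<union> A {3}" by (rule Un; rule us; simp)
    ultimately show ?thesis unfolding Q by argo
  qed
  have disj: "A {i} \<inter> A {j} = {}" if "i \<in> {1,2,3}" "j \<in> {1,2,3}" "i \<noteq> j" for i j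
    using Int[of "{i}" "{j}"] us that w(4) by auto
  have Rww: "R w w" using assms(2) w(1) unfolding poset_def by blast
  have h: "himp ?Q fork3_le {i} {} = {1,2,3} - {i}" if "i \<in> {1,2,3}" for i
    using that unfolding himp_def fork3_le_def by auto
  have sub: "A ({1,2,3} - {i}) \<subseteq> A (?Q - {0})" if "i \<in> {1,2,3}" for i
  proof -
    have "?Q - {0} = ({1,2,3} - {i}) \<union> {i}" using that by auto
    then show ?thesis using Un[of "{1,2,3} - {i}" "{i}"] us that by auto
  qed
  \<comment> \<open>If \<open>A {i}\<close> had no point above \<open>w\<close>, then
    \<open>w\<close> would satisfy the negation of \<open>{i}\<close>, which is the upset of the two
    other tips and lies inside \<open>?Q - {0}\<close>.\<close>
  have ne: "\<exists>u. u \<in> A {i} \<and> u \<in> above W R w" if "i \<in> {1,2,3}" for i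
  proof (rule ccontr)
    assume n: "\<not> ?thesis"
    have "w \<notin> A {i}" using w(2) A that by auto
    then have "\<forall>v\<in>W. R w v \<longrightarrow> v \<in> A {i} \<longrightarrow> v \<in> A {}" using n by (auto simp: above_def)
    then have "w \<in> A ({1,2,3} - {i})" using himp[of "{i}" "{}" w] us[of "{i}"] us[of "{}"] that w(1) Rww h by auto
    then show False using sub[OF that] w(2) by auto
  qed
  let ?a = "above W R w"
  have "is_singleton (?a \<inter> (A {2} \<union> A {3}))"
  proof -
    have "upset W R (?a \<inter> A {1})" "upset W R (?a \<inter> (A {2} \<union> A {3}))"
      using upset_above[OF assms(2) w(1)] up by (auto intro: upset_Int upset_Un)
    moreover have "(?a \<inter> A {1}) \<union> (?a \<inter> (A {2} \<union> A {3})) = ?a"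
      using w(3) A by auto
    moreover have "(?a \<inter> A {1}) \<inter> (?a \<inter> (A {2} \<union> A {3})) = {}"
      using disj[of 1 2] disj[of 1 3] by auto
    moreover have "?a \<inter> A {1} \<noteq> {}" "?a \<inter> (A {2} \<union> A {3}) \<noteq> {}"
      using ne[of 1] ne[of 2] by auto
    ultimately show ?thesis using assms(3) w(1) unfolding pl_frame_def by meson
  qed
  moreover obtain u v where "u \<in> A {2}" "u \<in> ?a" "v \<in> A {3}" "v \<in> ?a"
    using ne[of 2] ne[of 3] by auto
  ultimately have "u = v" unfolding is_singleton_def by (metis IntI UnI1 UnI2 singletonD)
  then show False using disj[of 2 3] \<open>u \<in> A {2}\<close> \<open>v \<in> A {3}\<close> by auto
qed

text \<open>The splitting into \<open>A {1,2}\<close> and \<open>A {3}\<close> leaves a single point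
  \<open>t\<close> in the first part. It is maximal and therefore lies in \<open>A {2}\<close>, so
  \<open>A {1,2}\<close> and \<open>A {2}\<close> agree above \<open>w\<close>. The implication from
  \<open>{1,2}\<close> to \<open>{2}\<close> then puts \<open>w\<close> into \<open>A {2,3}\<close>,
  which is excluded.\<close>

lemma pl_frame_chi_scott:
  assumes "finite W" "poset W R" "pl_frame W R"
  shows "kvalid W R chi_scott"
proof (rule ccontr)
  let ?Q = "{0,1,2,3::nat}"
  assume nv: "\<not> ?thesis"
  obtain A w where jr: "jankov_refutes W R ?Q scott_le 0 A w"
    using jankov_refutation[OF assms(1,2) _ nv[unfolded chi_scott_def]] by auto
  note w = jankov_refutesD(1-4)[OF jr] and up = jankov_refutesD(5)[OF jr]
    and Int = jankov_refutesD(6)[OF jr] and Un = jankov_refutesD(7)[OF jr]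
    and himp = jankov_refutesD(8)[OF jr]
  have us: "upset ?Q scott_le {}" "upset ?Q scott_le {2}" "upset ?Q scott_le {3}"
      "upset ?Q scott_le {1,2}" "upset ?Q scott_le {2,3}"
    unfolding upset_def scott_le_def by auto
  have Q: "?Q - {0} = {1,2} \<union> {3}" by auto
  have A: "A (?Q - {0}) = A {1,2} \<union> A {3}"
    unfolding Q by (rule Un; rule us)
  have A23: "A {2,3} = A {2} \<union> A {3}" using Un[OF us(2,3)] by (simp add: insert_commute)
  have A2: "A {2} \<subseteq> A {1,2}" using Int[OF us(2,4)] by auto
  have disj: "A {1,2} \<inter> A {3} = {}"
    using Int[OF us(4,3)] w(4) by auto
  have h: "himp ?Q scott_le {3} {} = {1,2}" "himp ?Q scott_le {1,2} {} = {3}"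
    "himp ?Q scott_le {2} {} = {3}" "himp ?Q scott_le {1,2} {2} = {2,3}"
    unfolding himp_def scott_le_def by auto
  have Rww: "R w w" using assms(2) w(1) unfolding poset_def by blast
  have wn: "w \<notin> A {1,2}" "w \<notin> A {3}" using w(2) A by auto
  let ?a = "above W R w"
  have "?a \<inter> A {1,2} \<noteq> {}"
    using himp[OF us(4,1) w(1) Rww] h wn by (auto simp: above_def)
  moreover have "?a \<inter> A {3} \<noteq> {}"
    using himp[OF us(3,1) w(1) Rww] h wn by (auto simp: above_def)
  moreover have "upset W R (?a \<inter> A {1,2})" "upset W R (?a \<inter> A {3})"
      using upset_above[OF assms(2) w(1)] up by (auto intro: upset_Int upset_Un)
  moreover have "(?a \<inter> A {1,2}) \<union> (?a \<inter> A {3}) = ?a" using w(3) A by auto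
  moreover have "(?a \<inter> A {1,2}) \<inter> (?a \<inter> A {3}) = {}" using disj by auto
  ultimately have "is_singleton (?a \<inter> A {1,2})"
    using assms(3) w(1) unfolding pl_frame_def by meson
  then obtain t where t: "?a \<inter> A {1,2} = {t}" by (auto simp: is_singleton_def)
  have tW: "t \<in> W" "R w t" "t \<in> A {1,2}" using t by (auto simp: above_def)
  have tmax: "v = t" if "v \<in> W" "R t v" for v
  proof -
    have "v \<in> ?a" using that upset_above[OF assms(2) w(1)] t unfolding upset_def by blast
    moreover have "v \<in> A {1,2}" using up[of "{1,2}"] that tW unfolding upset_def by blast
    ultimately show ?thesis using t by blast
  qed
  \<comment> \<open>In the Scott frame the negation of \<open>{2}\<close> is \<open>{3}\<close>, and
    a maximal point outside \<open>A {2}\<close> satisfies this negation.\<close>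
  have "t \<in> A {2}"
  proof (rule ccontr)
    assume "t \<notin> A {2}"
    then have "t \<in> A {3}" using himp[OF us(2,1) tW(1,2)] tmax h by auto
    then show False using disj tW by auto
  qed
  have "v \<in> A {2}" if "v \<in> W" "R w v" "v \<in> A {1,2}" for v
  proof -
    have "v \<in> ?a \<inter> A {1,2}" using that wn by (auto simp: above_def)
    then have "v = t" unfolding t by blast
    then show ?thesis using \<open>t \<in> A {2}\<close> by blast
  qed
  then have "\<forall>v\<in>W. R w v \<longrightarrow> v \<in> A {1,2} \<longrightarrow> v \<in> A {2}" by blast
  then have "w \<in> A {2,3}" using himp[OF us(4,2) w(1) Rww] h by auto
  then show False using A23 A2 wn by auto
qed

text \<open>Let the points strictly above \<open>x\<close> split into \<open>A\<close> and
  \<open>B\<close>, where \<open>A\<close> is not a singleton. If some point of \<open>A\<close> is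
  not maximal, \<open>A\<close> collapses onto the chain \<open>1 < 2\<close> of the Scott frame;
  otherwise \<open>A\<close> consists of several maximal points and maps onto two tips of the
  3-fork. In both cases \<open>B\<close> collapses onto the tip 3.\<close>

lemma pl_frame_if_chi_valid:
  assumes fin: "finite W" and W: "poset W R" and fork: "kvalid W R chi_fork3" and scott: "kvalid W R chi_scott"
  shows "pl_frame W R"
proof -
  have refl: "R x x" if "x \<in> W" for x using W that unfolding poset_def by blast
  have single: "is_singleton A"
    if x: "x \<in> W" and A: "upset W R A" and B: "upset W R B" and AB: "A \<union> B = above W R x" "A \<inter> B = {}"
      and ne: "A \<noteq> {}" "B \<noteq> {}" for x A B
  proof (rule ccontr)
    assume ns: "\<not> is_singleton A"
    have xn: "x \<notin> A" "x \<notin> B" using AB by (auto simp: above_def)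
    have sub: "A \<subseteq> W" "B \<subseteq> W" using A B by (auto simp: upset_def)
    have Rx: "R x u" if "u \<in> A \<or> u \<in> B" for u using AB that by (auto simp: above_def)
    have cases: "u = x \<or> u \<in> A \<or> u \<in> B" if "u \<in> W" "R x u" for u
      using AB that by (auto simp: above_def)
    show False
    proof (cases "\<exists>u\<in>A. above W R u \<noteq> {}")
      case True
      define f :: "nat \<Rightarrow> nat" where
        "f = (\<lambda>u. if u = x then 0 else if u \<in> B then 3 else if above W R u = {} then 2 else 1)"
      obtain s where s: "s \<in> A" "above W R s \<noteq> {}" using True by blast
      obtain b where b: "b \<in> B" using ne by blast
      have maxabove: "\<exists>t\<in>A. R u t \<and> above W R t = {}" if u: "u \<in> A" for u
      proof -
        have "u \<in> W" using u sub by blast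
        from maximal_witness[OF fin W order_refl this]
        obtain t where t: "t \<in> W" "R u t" "\<forall>v\<in>above W R t. v \<notin> W" by blast
        have "above W R t \<subseteq> W" unfolding above_def by blast
        then have "above W R t = {}" using t(3) by blast
        moreover have "t \<in> A" using A t u unfolding upset_def by blast
        ultimately show ?thesis using t(2) by blast
      qed
      obtain t where t: "t \<in> A" "above W R t = {}" using maxabove[OF s(1)] by blast
      have "\<not> kvalid W R (jankov {0,1,2,3} scott_le 0)"
      proof (rule not_kvalid_jankov_if_pmorphism[OF W _ _ x, where f = f])
        show "poset {0,1,2,3} scott_le" by (auto simp: poset_def scott_le_def)
        show "scott_le (f u) (f v)" if "u \<in> W" "v \<in> W" "R x u" "R u v" for u v
          using cases[OF that(1,3)]
        proof (elim disjE)
          assume u: "u \<in> A"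
          then have v: "v \<in> A" using A that unfolding upset_def by blast
          have "v = u" if "above W R u = {}" using that \<open>v \<in> W\<close> \<open>R u v\<close> by (auto simp: above_def)
          then show ?thesis using u v xn AB by (auto simp: scott_le_def f_def)
        next
          assume u: "u \<in> B"
          then have "v \<in> B" using B that unfolding upset_def by blast
          then show ?thesis using u xn unfolding f_def scott_le_def by auto
        qed (auto simp: f_def scott_le_def)
        show "\<exists>v\<in>W. R u v \<and> f v = q" if u: "u \<in> W" "R x u" "q \<in> {0,1,2,3}" "scott_le (f u) q" for u q
        proof (cases "u = x")
          case True
          have "f x = 0" "f s = 1" "f t = 2" "f b = 3" using s t b xn AB by (auto simp: f_def)
          moreover have "R x x" "R x s" "R x t" "R x b" "s \<in> W" "t \<in> W" "b \<in> W"
            using refl x Rx s t b sub by auto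
          ultimately show ?thesis using that(3) True x by blast
        next
          case False
          then have f0: "f u \<noteq> 0" by (auto simp: f_def)
          show ?thesis
          proof (cases "f u = q")
            case False
            then have fu: "f u = 1" "q = 2" using f0 u(4) by (auto simp: scott_le_def)
            then have "u \<in> A" using \<open>u \<noteq> x\<close> cases[OF u(1,2)] by (auto simp: f_def split: if_splits)
            then obtain v where "v \<in> A" "R u v" "above W R v = {}" using maxabove by blast
            moreover have "f v = 2" using calculation xn AB by (auto simp: f_def)
            ultimately show ?thesis using fu sub by blast
          qed (use refl u in auto)
        qed
      qed (auto simp: f_def scott_le_def)
      then show False using scott by (simp add: chi_scott_def)
    next
      case False
      then have mx: "\<And>u v. u \<in> A \<Longrightarrow> v \<in> W \<Longrightarrow> R u v \<Longrightarrow> v = u" by (auto simp: above_def)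
      obtain a where a: "a \<in> A" using ne by blast
      obtain a' where a': "a' \<in> A" "a' \<noteq> a" using ns a unfolding is_singleton_def by blast
      define f :: "nat \<Rightarrow> nat" where
        "f = (\<lambda>u. if u = x then 0 else if u \<in> B then 3 else if u = a then 2 else 1)"
      obtain b where b: "b \<in> B" using ne by blast
      have "\<not> kvalid W R (jankov {0,1,2,3} fork3_le 0)"
      proof (rule not_kvalid_jankov_if_pmorphism[OF W _ _ x, where f = f])
        show "poset {0,1,2,3} fork3_le" by (auto simp: poset_def fork3_le_def)
        show "fork3_le (f u) (f v)" if "u \<in> W" "v \<in> W" "R x u" "R u v" for u v
          using cases[OF that(1,3)]
        proof (elim disjE)
          assume u: "u \<in> A"
          then show ?thesis using mx[OF u that(2,4)] by (auto simp: fork3_le_def)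
        next
          assume u: "u \<in> B"
          then have "v \<in> B" using B that unfolding upset_def by blast
          then show ?thesis using u xn unfolding f_def fork3_le_def by auto
        qed (auto simp: f_def fork3_le_def)
        show "\<exists>v\<in>W. R u v \<and> f v = q" if "u \<in> W" "R x u" "q \<in> {0,1,2,3}" "fork3_le (f u) q" for u q
        proof (cases "u = x")
          case True
          have "f x = 0" "f a' = 1" "f a = 2" "f b = 3" using a a' b xn AB by (auto simp: f_def)
          moreover have "R x x" "R x a'" "R x a" "R x b" "a \<in> W" "a' \<in> W" "b \<in> W"
            using refl x Rx a a' b sub by auto
          ultimately show ?thesis using that(3) True x by blast
        next
          case False
          then have "f u \<noteq> 0" by (auto simp: f_def)
          then show ?thesis using that refl unfolding fork3_le_def by auto
        qed
      qed (auto simp: f_def fork3_le_def)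
      then show False using fork by (simp add: chi_fork3_def)
    qed
  qed
  show ?thesis unfolding pl_frame_def
  proof (intro ballI allI impI)
    fix x A B assume x: "x \<in> W"
      and *: "upset W R A \<and> upset W R B \<and> A \<union> B = above W R x \<and> A \<inter> B = {} \<and> A \<noteq> {} \<and> B \<noteq> {}"
    then show "is_singleton A \<and> is_singleton B"
      using single[OF x, of A B] single[OF x, of B A] by (simp add: Un_commute Int_commute)
  qed
qed

subsection \<open>The finite canonical model\<close>

text \<open>The code of a bisimulation type: the variables of \<open>X\<close> true at
  \<open>w\<close>, together with the set of types of the points strictly above. Only
  \<open>m\<close> levels are unfolded, which is enough to decide all formulas over \<open>X\<close>
  when the depth of \<open>w\<close> is at most \<open>m\<close>.\<close>

fun tycode :: "nat set \<Rightarrow> nat \<Rightarrow> nat set \<Rightarrow> (nat \<Rightarrow> nat \<Rightarrow> bool) \<Rightarrow> (nat \<Rightarrow> nat set) \<Rightarrow> nat \<Rightarrow> nat" where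
  "tycode X 0 W R V w = set_encode {p\<in>X. w \<in> V p}"
| "tycode X (Suc m) W R V w = prod_encode (set_encode {p\<in>X. w \<in> V p},
     set_encode (tycode X m W R V ` above W R w))"

lemma finite_above: "finite W \<Longrightarrow> finite (above W R w)"
  by (simp add: above_def)

text \<open>A type of level \<open>Suc m\<close> is a subset of \<open>X\<close> with a set of types
  of level \<open>m\<close>. This bounds the number of types uniformly over all finite
  frames.\<close>

lemma finite_tycode:
  assumes "finite X"
  shows "finite {tycode X m W R V w | W R V w. finite W}"
proof (induction m)
  case 0
  have "{tycode X 0 W R V w | W R V w. finite W} \<subseteq> set_encode ` Pow X" by auto
  then show ?case using assms finite_subset by blast
next
  case (Suc m)
  let ?T = "{tycode X m W R V w | W R V w. finite W}"
  have "{tycode X (Suc m) W R V w | W R V w. finite W}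
      \<subseteq> (\<lambda>(A, B). prod_encode (set_encode A, set_encode B)) ` (Pow X \<times> Pow ?T)"
  proof
    fix c assume "c \<in> {tycode X (Suc m) W R V w | W R V w. finite W}"
    then obtain W R V w where c: "c = tycode X (Suc m) W R V w" "finite W" by blast
    have "tycode X m W R V ` above W R w \<in> Pow ?T" using c(2) by blast
    moreover have "{p\<in>X. w \<in> V p} \<in> Pow X" by blast
    ultimately show "c \<in> (\<lambda>(A, B). prod_encode (set_encode A, set_encode B)) ` (Pow X \<times> Pow ?T)"
      unfolding c(1) tycode.simps by force
  qed
  then show ?case using assms Suc finite_subset by blast
qed

text \<open>An implication at \<open>w\<close> speaks about \<open>w\<close> itself, which is
  settled by the inner induction on the formula, and about the points strictly above, whose types
  match on both sides and which are settled by the outer induction on the depth.\<close>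

lemma tycode_forces:
  assumes "finite W" "finite W'" "poset W R" "poset W' R'" "finite X"
    "w \<in> W" "w' \<in> W'" "depth_le W R m w" "depth_le W' R' m w'"
    "tycode X m W R V w = tycode X m W' R' V' w'" "vars a \<subseteq> X"
  shows "kforces W R V w a \<longleftrightarrow> kforces W' R' V' w' a"
  using assms(6-)
proof (induction m arbitrary: w w' a)
  case 0
  have V: "{p\<in>X. w \<in> V p} = {p\<in>X. w' \<in> V' p}"
    using 0(5) assms(5) by (simp add: set_encode_eq)
  have "u = w" if "u \<in> W" "R w u" for u using that 0 by (auto simp: above_def)
  moreover have "u = w'" if "u \<in> W'" "R' w' u" for u using that 0 by (auto simp: above_def)
  moreover note poset_refl[OF assms(3) 0(1)] poset_refl[OF assms(4) 0(2)]
  ultimately show ?case using 0(6,1,2) V by (induction a) auto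
next
  case (Suc m)
  have V: "{p\<in>X. w \<in> V p} = {p\<in>X. w' \<in> V' p}"
    and T: "tycode X m W R V ` above W R w = tycode X m W' R' V' ` above W' R' w'"
    using Suc.prems(5) assms(1,2,5) by (auto simp: set_encode_eq finite_above)
  have IH: "kforces W R V u a \<longleftrightarrow> kforces W' R' V' u' a"
    if "u \<in> above W R w" "u' \<in> above W' R' w'" "tycode X m W R V u = tycode X m W' R' V' u'" "vars a \<subseteq> X"
    for u u' a
    using Suc.IH[of u u' a] that Suc.prems(3,4) by (auto simp: above_def)
  have r: "R w w" "R' w' w'" using poset_refl assms Suc.prems by blast+
  show ?case using Suc.prems(6)
  proof (induction a)
    case (Imp a b)
    have sub: "vars a \<subseteq> X" "vars b \<subseteq> X" using Imp.prems by auto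
    have eq: "kforces W R V w (Imp a b) \<longleftrightarrow> (kforces W R V w a \<longrightarrow> kforces W R V w b)
       \<and> (\<forall>u\<in>above W R w. kforces W R V u a \<longrightarrow> kforces W R V u b)"
      using r Suc.prems(1) by (auto simp: above_def)
    have eq': "kforces W' R' V' w' (Imp a b) \<longleftrightarrow> (kforces W' R' V' w' a \<longrightarrow> kforces W' R' V' w' b)
       \<and> (\<forall>u\<in>above W' R' w'. kforces W' R' V' u a \<longrightarrow> kforces W' R' V' u b)"
      using r Suc.prems(2) by (auto simp: above_def)
    have "\<exists>u'\<in>above W' R' w'. tycode X m W R V u = tycode X m W' R' V' u'" if "u \<in> above W R w" for u
      using T that by blast
    moreover have "\<exists>u\<in>above W R w. tycode X m W R V u = tycode X m W' R' V' u'"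
      if "u' \<in> above W' R' w'" for u' using T that by force
    ultimately have "(\<forall>u\<in>above W R w. kforces W R V u a \<longrightarrow> kforces W R V u b) \<longleftrightarrow>
      (\<forall>u\<in>above W' R' w'. kforces W' R' V' u a \<longrightarrow> kforces W' R' V' u b)"
      using IH[OF _ _ _ sub(1)] IH[OF _ _ _ sub(2)] by metis
    then show ?case unfolding eq eq' using Imp.IH sub by blast
  qed (use V in auto)
qed

text \<open>Modulo \<open>BD n\<close>, a formula over \<open>X\<close> is determined by the set
  \<open>ext a\<close> of types, taken over all finite frames of height at most \<open>n\<close>, at
  which it is true. There are finitely many types and hence finitely many such sets; one formula is
  picked for each.\<close>

lemma BD_locally_finite:
  assumes "finite X"
  shows "\<exists>\<Phi>. finite \<Phi> \<and> (\<forall>b\<in>\<Phi>. vars b \<subseteq> X)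
    \<and> (\<forall>a. vars a \<subseteq> X \<longrightarrow> (\<exists>b\<in>\<Phi>. Imp a b \<in> BD n \<and> Imp b a \<in> BD n))"
proof -
  define ext where "ext = (\<lambda>a. {tycode X n W R V w | W R V w. finite W \<and> poset W R \<and> height_le W R n
      \<and> w \<in> W \<and> kforces W R V w a})"
  define F where "F = {a. vars a \<subseteq> X}"
  have "ext ` F \<subseteq> Pow {tycode X n W R V w | W R V w. finite W}"
    unfolding ext_def by blast
  then have fin: "finite (ext ` F)" using finite_tycode[OF assms] finite_subset by blast
  then obtain \<Phi> where \<Phi>: "\<Phi> \<subseteq> F" "finite \<Phi>" "ext ` F = ext ` \<Phi>"
    by (metis finite_subset_image order_refl)
  have key: "Imp a b \<in> BD n" if ab: "a \<in> F" "b \<in> F" "ext a = ext b" for a b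
    unfolding BD_def kvalid_def
  proof (intro CollectI allI impI ballI)
    fix W R and V :: "nat \<Rightarrow> nat set" and w assume W: "finite W \<and> poset W R \<and> height_le W R n" and "\<forall>p. upset W R (V p)" "w \<in> W"
    have "kforces W R V u b" if u: "u \<in> W" "kforces W R V u a" for u
    proof -
      have "tycode X n W R V u \<in> ext b" using that ab(3) W unfolding ext_def by blast
      then obtain W' R' V' u' where W': "finite W'" "poset W' R'" "height_le W' R' n" "u' \<in> W'"
         "kforces W' R' V' u' b" "tycode X n W R V u = tycode X n W' R' V' u'"
        unfolding ext_def by blast
      show ?thesis
        using tycode_forces[of W W' R R' X u u' n V V' b] W W' u(1) assms ab(2)
        by (simp add: depth_le_if_height_le F_def)
    qed
    then show "kforces W R V w (Imp a b)" by simp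
  qed
  have "\<exists>b\<in>\<Phi>. Imp a b \<in> BD n \<and> Imp b a \<in> BD n" if "vars a \<subseteq> X" for a
  proof -
    have "a \<in> F" using that by (simp add: F_def)
    then obtain b where "b \<in> \<Phi>" "ext a = ext b" using \<Phi>(3) by blast
    then show ?thesis using key \<open>a \<in> F\<close> \<Phi>(1) by (metis subsetD)
  qed
  moreover have "\<forall>b\<in>\<Phi>. vars b \<subseteq> X" using \<Phi>(1) by (auto simp: F_def)
  ultimately show ?thesis using \<Phi>(2) by blast
qed

section \<open>Theories over finitely many variables and the canonical frame\<close>

lemma subst_subst: "subst s (subst t a) = subst (\<lambda>p. subst s (t p)) a"
  by (induction a) auto

lemma subst_id: "(\<And>p. p \<in> vars a \<Longrightarrow> s p = Var p) \<Longrightarrow> subst s a = a"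
  by (induction a) auto

lemma vars_subst: "vars (subst s a) = (\<Union>p\<in>vars a. vars (s p))"
  by (induction a) auto

lemma ipc_axiom_subst: "ipc_axiom a \<Longrightarrow> ipc_axiom (subst s a)"
  by (induction rule: ipc_axiom.induct) (auto intro: ipc_axiom.intros)

lemma logic_gen_subst: "a \<in> logic_gen G \<Longrightarrow> subst s a \<in> logic_gen G"
proof (induction rule: logic_gen.induct)
  case (ax a)
  then show ?case by (intro logic_gen.ax ipc_axiom_subst)
next
  case (hyp a t)
  then show ?case by (simp add: subst_subst logic_gen.hyp)
next
  case (mp a b)
  then show ?case by (auto intro: logic_gen.mp)
qed

lemma logic_gen_incl: "a \<in> G \<Longrightarrow> a \<in> logic_gen G"
  using logic_gen.hyp[of a G Var] subst_id[of a Var] by simp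

text \<open>Theories are confined to formulas over \<open>X\<close>. With \<open>X\<close> finite
  and \<open>BD n\<close> among the axioms only finitely many theories remain, and this makes the
  canonical model finite.\<close>

definition theory_on :: "form set \<Rightarrow> nat set \<Rightarrow> form set \<Rightarrow> bool" where
  "theory_on L X T \<longleftrightarrow> T \<subseteq> {a. vars a \<subseteq> X} \<and> (\<forall>a\<in>L. vars a \<subseteq> X \<longrightarrow> a \<in> T)
     \<and> (\<forall>a b. a \<in> T \<longrightarrow> Imp a b \<in> T \<longrightarrow> b \<in> T)"

definition prime_on :: "form set \<Rightarrow> nat set \<Rightarrow> form set \<Rightarrow> bool" where
  "prime_on L X T \<longleftrightarrow> theory_on L X T \<and> Bot \<notin> T \<and> (\<forall>a b. Disj a b \<in> T \<longrightarrow> a \<in> T \<or> b \<in> T)"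

lemma theory_on_ax:
  assumes "theory_on (logic_gen G) X T" "ipc_axiom a" "vars a \<subseteq> X"
  shows "a \<in> T"
  using assms logic_gen.ax unfolding theory_on_def by blast

lemma theory_on_mp: "theory_on L X T \<Longrightarrow> Imp a b \<in> T \<Longrightarrow> a \<in> T \<Longrightarrow> b \<in> T"
  unfolding theory_on_def by blast

lemma theory_on_vars: "theory_on L X T \<Longrightarrow> a \<in> T \<Longrightarrow> vars a \<subseteq> X"
  unfolding theory_on_def by blast

lemma theory_on_impI:
  assumes "theory_on (logic_gen G) X T" "b \<in> T" "vars a \<subseteq> X"
  shows "Imp a b \<in> T"
  using theory_on_mp[OF assms(1) theory_on_ax[OF assms(1) ipc_axiom.intros(1)[of b a]]]
    theory_on_vars[OF assms(1,2)] assms by simp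

text \<open>The deduction theorem in set form: \<open>{c. Imp a c \<in> T}\<close> is the theory
  obtained by adding \<open>a\<close> to \<open>T\<close>. The first two axiom schemes do the
  work.\<close>

lemma theory_on_extend:
  assumes T: "theory_on (logic_gen G) X T" and a: "vars a \<subseteq> X"
  shows "theory_on (logic_gen G) X {c. Imp a c \<in> T}" "T \<subseteq> {c. Imp a c \<in> T}" "Imp a a \<in> T"
proof -
  show "T \<subseteq> {c. Imp a c \<in> T}" using theory_on_impI[OF T] a by blast
  have K: "Imp a (Imp a a) \<in> T" "Imp a (Imp (Imp a a) a) \<in> T"
    by (rule theory_on_ax[OF T], auto intro: ipc_axiom.intros simp: a)+
  have S: "Imp (Imp a (Imp c d)) (Imp (Imp a c) (Imp a d)) \<in> T" if "vars c \<subseteq> X" "vars d \<subseteq> X" for c d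
    by (rule theory_on_ax[OF T]) (auto intro: ipc_axiom.intros simp: a that subsetD)
  show "Imp a a \<in> T" using S[of "Imp a a" a] a K theory_on_mp[OF T] by (metis Un_least vars.simps(5))
  have "Imp a d \<in> T" if cd: "Imp a c \<in> T" "Imp a (Imp c d) \<in> T" for c d
  proof -
    have "vars c \<subseteq> X" "vars d \<subseteq> X" using theory_on_vars[OF T cd(2)] by simp_all
    then have "Imp (Imp a (Imp c d)) (Imp (Imp a c) (Imp a d)) \<in> T" by (rule S)
    from theory_on_mp[OF T theory_on_mp[OF T this cd(2)] cd(1)] show ?thesis .
  qed
  moreover have "vars c \<subseteq> X" if "Imp a c \<in> T" for c using theory_on_vars[OF T that] by simp
  moreover have "Imp a c \<in> T" if "c \<in> logic_gen G" "vars c \<subseteq> X" for c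
  proof -
    have "c \<in> T" using T that unfolding theory_on_def by blast
    then show ?thesis by (rule theory_on_impI[OF T _ a])
  qed
  ultimately show "theory_on (logic_gen G) X {c. Imp a c \<in> T}"
    unfolding theory_on_def mem_Collect_eq by (intro conjI allI ballI impI subsetI CollectI) blast+
qed

lemma theory_on_conj_iff:
  assumes T: "theory_on (logic_gen G) X T" and "vars a \<subseteq> X" "vars b \<subseteq> X"
  shows "Conj a b \<in> T \<longleftrightarrow> a \<in> T \<and> b \<in> T"
proof
  assume "Conj a b \<in> T"
  moreover have "Imp (Conj a b) a \<in> T" "Imp (Conj a b) b \<in> T"
    by (rule theory_on_ax[OF T], use assms in \<open>auto intro: ipc_axiom.intros\<close>)+
  ultimately show "a \<in> T \<and> b \<in> T" using theory_on_mp[OF T] by blast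
next
  have "Imp a (Imp b (Conj a b)) \<in> T"
    by (rule theory_on_ax[OF T]) (use assms in \<open>auto intro: ipc_axiom.intros\<close>)
  then show "a \<in> T \<and> b \<in> T \<Longrightarrow> Conj a b \<in> T" using theory_on_mp[OF T] by blast
qed

lemma prime_on_disj_iff:
  assumes T: "prime_on (logic_gen G) X T" and "vars a \<subseteq> X" "vars b \<subseteq> X"
  shows "Disj a b \<in> T \<longleftrightarrow> a \<in> T \<or> b \<in> T"
proof -
  have th: "theory_on (logic_gen G) X T" using T by (simp add: prime_on_def)
  have "Imp a (Disj a b) \<in> T" "Imp b (Disj a b) \<in> T"
    by (rule theory_on_ax[OF th], use assms in \<open>auto intro: ipc_axiom.intros\<close>)+
  then show ?thesis using T theory_on_mp[OF th] unfolding prime_on_def by blast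
qed

text \<open>Every formula over \<open>X\<close> has an equivalent modulo \<open>BD n\<close> in the
  finite set, so a theory is determined by the representatives it contains.\<close>

lemma finitely_many_theories:
  assumes "finite X" "BD n \<subseteq> G"
  shows "\<exists>\<Phi>. finite \<Phi> \<and> (\<forall>b\<in>\<Phi>. vars b \<subseteq> X) \<and>
    (\<forall>S T. theory_on (logic_gen G) X S \<longrightarrow> theory_on (logic_gen G) X T \<longrightarrow> S \<inter> \<Phi> \<subseteq> T \<longrightarrow> S \<subseteq> T)"
proof -
  obtain \<Phi> where \<Phi>: "finite \<Phi>" "\<forall>b\<in>\<Phi>. vars b \<subseteq> X"
    "\<And>a. vars a \<subseteq> X \<Longrightarrow> \<exists>b\<in>\<Phi>. Imp a b \<in> BD n \<and> Imp b a \<in> BD n"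
    using BD_locally_finite[OF assms(1), of n] by blast
  have "S \<subseteq> T" if S: "theory_on (logic_gen G) X S" and T: "theory_on (logic_gen G) X T"
    and sub: "S \<inter> \<Phi> \<subseteq> T" for S T
  proof
    fix a assume a: "a \<in> S"
    have va: "vars a \<subseteq> X" using theory_on_vars[OF S a] .
    obtain b where b: "b \<in> \<Phi>" "Imp a b \<in> BD n" "Imp b a \<in> BD n" using \<Phi>(3)[OF va] by blast
    have "vars b \<subseteq> X" using \<Phi>(2) b(1) by blast
    then have "Imp a b \<in> S" "Imp b a \<in> T"
      using b va S T assms(2) logic_gen_incl[of _ G] unfolding theory_on_def by auto
    then show "a \<in> T" using theory_on_mp S T a b(1) sub by blast
  qed
  then show ?thesis using \<Phi>(1,2) by blast
qed

lemma finite_theories: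
  assumes "finite X" "BD n \<subseteq> G"
  shows "finite {T. theory_on (logic_gen G) X T}"
proof -
  obtain \<Phi> where \<Phi>: "finite \<Phi>"
    "\<forall>S T. theory_on (logic_gen G) X S \<longrightarrow> theory_on (logic_gen G) X T \<longrightarrow> S \<inter> \<Phi> \<subseteq> T \<longrightarrow> S \<subseteq> T"
    using finitely_many_theories[OF assms] by (elim exE conjE)
  have "inj_on (\<lambda>T. T \<inter> \<Phi>) {T. theory_on (logic_gen G) X T}"
  proof (rule inj_onI, rule subset_antisym)
    fix S T assume "S \<in> {T. theory_on (logic_gen G) X T}" "T \<in> {T. theory_on (logic_gen G) X T}" "S \<inter> \<Phi> = T \<inter> \<Phi>"
    then show "S \<subseteq> T" "T \<subseteq> S" using \<Phi>(2)[rule_format, of S T] \<Phi>(2)[rule_format, of T S] by auto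
  qed
  moreover have "(\<lambda>T. T \<inter> \<Phi>) ` {T. theory_on (logic_gen G) X T} \<subseteq> Pow \<Phi>" by blast
  ultimately show ?thesis using \<Phi>(1) by (meson finite_Pow_iff inj_on_finite)
qed

text \<open>Among the finitely many theories there is a maximal one that avoids \<open>a\<close>. It
  is prime: every formula outside it implies \<open>a\<close> in it, so a disjunction of two such
  formulas would imply \<open>a\<close> as well.\<close>

lemma prime_extension:
  assumes "finite X" "BD n \<subseteq> G" and T: "theory_on (logic_gen G) X T" and a: "a \<notin> T" "vars a \<subseteq> X"
  shows "\<exists>S. prime_on (logic_gen G) X S \<and> T \<subseteq> S \<and> a \<notin> S"
proof -
  let ?C = "{S. theory_on (logic_gen G) X S \<and> T \<subseteq> S \<and> a \<notin> S}"
  have "finite ?C" by (rule finite_subset[OF _ finite_theories[OF assms(1,2)]]) blast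
  moreover have "T \<in> ?C" using T a by blast
  then have "?C \<noteq> {}" by (metis empty_iff)
  ultimately have "\<exists>S\<in>?C. \<forall>S'\<in>?C. S \<subseteq> S' \<longrightarrow> S = S'"
    by (rule finite_has_maximal)
  then obtain S where S: "S \<in> ?C" "\<forall>S'\<in>?C. S \<subseteq> S' \<longrightarrow> S = S'"
    by (elim bexE)
  have th: "theory_on (logic_gen G) X S" using S(1) by blast
  have ext: "Imp b a \<in> S" if b: "vars b \<subseteq> X" "b \<notin> S" for b
  proof (rule ccontr)
    assume "Imp b a \<notin> S"
    then have "{c. Imp b c \<in> S} \<in> ?C" using theory_on_extend[OF th b(1)] S(1) by auto
    then have "S = {c. Imp b c \<in> S}" using S(2) theory_on_extend(2)[OF th b(1)] by blast
    then show False using theory_on_extend(3)[OF th b(1)] b(2) by blast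
  qed
  have "Imp Bot a \<in> S" by (rule theory_on_ax[OF th]) (auto intro: ipc_axiom.intros simp: a(2) subsetD)
  then have "Bot \<notin> S" using theory_on_mp[OF th] S(1) by blast
  moreover have "b \<in> S \<or> c \<in> S" if d: "Disj b c \<in> S" for b c
  proof (rule ccontr)
    assume "\<not> ?thesis"
    moreover have v: "vars b \<subseteq> X" "vars c \<subseteq> X" using theory_on_vars[OF th d] by auto
    ultimately have "Imp b a \<in> S" "Imp c a \<in> S" using ext by blast+
    moreover have "Imp (Imp b a) (Imp (Imp c a) (Imp (Disj b c) a)) \<in> S"
      by (rule theory_on_ax[OF th]) (use v a in \<open>auto intro: ipc_axiom.intros\<close>)
    ultimately show False using theory_on_mp[OF th] d S(1) by blast
  qed
  ultimately have "prime_on (logic_gen G) X S" using th by (simp add: prime_on_def)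
  then show ?thesis using S(1) by blast
qed

definition bigdisj :: "form list \<Rightarrow> form" where
  "bigdisj xs = foldr Disj xs Bot"

lemma bigconj_in_theory:
  assumes "theory_on (logic_gen G) X T" "\<forall>a\<in>set xs. vars a \<subseteq> X"
  shows "vars (bigconj xs) \<subseteq> X \<and> (bigconj xs \<in> T \<longleftrightarrow> set xs \<subseteq> T)"
  using assms(2)
proof (induction xs)
  case Nil
  then show ?case using theory_on_extend(3)[OF assms(1), of Bot] by (simp add: bigconj_def Top_def)
next
  case (Cons a xs)
  then show ?case using theory_on_conj_iff[OF assms(1), of a "bigconj xs"] by (simp add: bigconj_def)
qed

lemma bigdisj_in_prime:
  assumes "prime_on (logic_gen G) X T" "\<forall>a\<in>set xs. vars a \<subseteq> X"
  shows "vars (bigdisj xs) \<subseteq> X \<and> (bigdisj xs \<in> T \<longleftrightarrow> (\<exists>a\<in>set xs. a \<in> T))"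
  using assms(2)
proof (induction xs)
  case Nil
  then show ?case using assms(1) by (simp add: bigdisj_def prime_on_def)
next
  case (Cons a xs)
  then show ?case using prime_on_disj_iff[OF assms(1), of a "bigdisj xs"] by (simp add: bigdisj_def)
qed

text \<open>The points are the prime theories over the variables of \<open>\<phi>\<close>. As there
  are finitely many, every upset is defined by a formula, so every valuation comes from a
  substitution. Closure of the logic under substitution then makes it valid under all valuations of
  the frame and not only under the canonical one.\<close>

lemma finite_model_property:
  assumes BD: "BD n \<subseteq> G" and \<phi>: "\<phi> \<notin> logic_gen G"
  shows "\<exists>W R. finite W \<and> poset W R \<and> (\<forall>a\<in>logic_gen G. kvalid W R a) \<and> \<not> kvalid W R \<phi>"
proof -
  let ?L = "logic_gen G"
  define X where "X = vars \<phi>"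
  have X: "finite X" by (simp add: X_def)
  define P where "P = {T. prime_on ?L X T}"
  have finP: "finite P"
    by (rule finite_subset[OF _ finite_theories[OF X BD]]) (auto simp: P_def prime_on_def)
  then obtain e :: "nat \<Rightarrow> form set" and W where e: "bij_betw e W P" and W: "finite W"
    using ex_bij_betw_nat_finite by blast
  define R where "R = (\<lambda>i j. e i \<subseteq> e j)"
  have eP: "prime_on ?L X (e i)" if "i \<in> W" for i
    using bij_betwE[OF e] that unfolding P_def by simp
  have eT: "theory_on ?L X (e i)" if "i \<in> W" for i using eP[OF that] by (simp add: prime_on_def)
  have surj: "\<exists>i\<in>W. e i = T" if "prime_on ?L X T" for T
  proof -
    have "T \<in> e ` W" using e that unfolding bij_betw_def P_def by simp
    then show ?thesis by blast
  qed
  have pos: "poset W R"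
    unfolding poset_def R_def using e by (auto simp: bij_betw_def inj_on_def)
  \<comment> \<open>The truth lemma is needed for arbitrary substitutions into formulas over
    \<open>X\<close>, since an arbitrary valuation of the frame will be represented by one.\<close>
  have truth: "kforces W R (\<lambda>p. {i\<in>W. s p \<in> e i}) i a \<longleftrightarrow> subst s a \<in> e i"
    if s: "\<And>p. vars (s p) \<subseteq> X" and "i \<in> W" for s i a
    using that(2)
  proof (induction a arbitrary: i)
    case Bot
    then show ?case using eP by (simp add: prime_on_def)
  next
    case (Conj a b)
    have "vars (subst s a) \<subseteq> X" "vars (subst s b) \<subseteq> X" using s unfolding vars_subst by blast+
    then show ?case using Conj theory_on_conj_iff[OF eT] by simp
  next
    case (Disj a b)
    have "vars (subst s a) \<subseteq> X" "vars (subst s b) \<subseteq> X" using s unfolding vars_subst by blast+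
    then show ?case using Disj prime_on_disj_iff[OF eP] by simp
  next
    case (Imp a b)
    have v: "vars (subst s a) \<subseteq> X" "vars (subst s b) \<subseteq> X" using s unfolding vars_subst by blast+
    have "Imp (subst s a) (subst s b) \<in> e i
        \<longleftrightarrow> (\<forall>j\<in>W. e i \<subseteq> e j \<longrightarrow> subst s a \<in> e j \<longrightarrow> subst s b \<in> e j)" (is "?l \<longleftrightarrow> ?r")
    proof
      show "?l \<Longrightarrow> ?r" using theory_on_mp[OF eT] by blast
      show ?l if ?r
      proof (rule ccontr)
        assume n: "\<not> ?l"
        note x = theory_on_extend[OF eT[OF Imp.prems] v(1)]
        obtain S where S: "prime_on ?L X S" "{c. Imp (subst s a) c \<in> e i} \<subseteq> S" "subst s b \<notin> S"
          using prime_extension[OF X BD x(1), of "subst s b"] n v by blast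
        then obtain j where "j \<in> W" "e j = S" using surj by blast
        then show False using that S x(2,3) by blast
      qed
    qed
    then show ?case using Imp by (simp add: R_def)
  qed auto
  obtain \<Phi> where \<Phi>: "finite \<Phi>" "\<forall>b\<in>\<Phi>. vars b \<subseteq> X"
    "\<forall>S T. theory_on ?L X S \<longrightarrow> theory_on ?L X T \<longrightarrow> S \<inter> \<Phi> \<subseteq> T \<longrightarrow> S \<subseteq> T"
    using finitely_many_theories[OF X BD] by (elim exE conjE)
  \<comment> \<open>The conjunction of the representatives in \<open>e i\<close> defines the upset
    generated by \<open>i\<close>; a general upset is a finite disjunction of such formulas.\<close>
  have principal: "\<exists>\<alpha>. vars \<alpha> \<subseteq> X \<and> (\<forall>j\<in>W. \<alpha> \<in> e j \<longleftrightarrow> e i \<subseteq> e j)" if i: "i \<in> W" for i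
  proof -
    obtain xs where xs: "set xs = e i \<inter> \<Phi>" using finite_list[of "e i \<inter> \<Phi>"] \<Phi>(1) by auto
    have v: "\<forall>a\<in>set xs. vars a \<subseteq> X" using xs \<Phi>(2) by blast
    show ?thesis
    proof (intro exI[of _ "bigconj xs"] conjI ballI)
      show "vars (bigconj xs) \<subseteq> X" using bigconj_in_theory[OF eT[OF i] v] by blast
      fix j assume j: "j \<in> W"
      show "bigconj xs \<in> e j \<longleftrightarrow> e i \<subseteq> e j"
        using bigconj_in_theory[OF eT[OF j] v] xs \<Phi>(3)[rule_format, OF eT[OF i] eT[OF j]] by blast
    qed
  qed
  have definable: "\<exists>\<alpha>. vars \<alpha> \<subseteq> X \<and> (\<forall>j\<in>W. \<alpha> \<in> e j \<longleftrightarrow> j \<in> U)" if U: "upset W R U" for U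
  proof -
    obtain \<alpha> where \<alpha>: "\<And>i. i \<in> W \<Longrightarrow> vars (\<alpha> i) \<subseteq> X" "\<And>i j. i \<in> W \<Longrightarrow> j \<in> W \<Longrightarrow> \<alpha> i \<in> e j \<longleftrightarrow> e i \<subseteq> e j"
      using principal by metis
    have UW: "U \<subseteq> W" using upset_subset[OF U] .
    then obtain xs where xs: "set xs = U" using finite_list[OF finite_subset[OF _ W], of U] by auto
    have v: "\<forall>a\<in>set (map \<alpha> xs). vars a \<subseteq> X" using xs UW \<alpha>(1) by auto
    have "bigdisj (map \<alpha> xs) \<in> e j \<longleftrightarrow> j \<in> U" if j: "j \<in> W" for j
    proof -
      have "bigdisj (map \<alpha> xs) \<in> e j \<longleftrightarrow> (\<exists>i\<in>U. e i \<subseteq> e j)"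
      proof -
        have "bigdisj (map \<alpha> xs) \<in> e j \<longleftrightarrow> (\<exists>i\<in>U. \<alpha> i \<in> e j)"
          using bigdisj_in_prime[OF eP[OF j] v] xs by simp
        then show ?thesis using UW \<alpha>(2)[OF _ j] by (metis subsetD)
      qed
      also have "\<dots> \<longleftrightarrow> j \<in> U" using upsetD[OF U _ j] unfolding R_def by blast
      finally show ?thesis .
    qed
    moreover have "vars (bigdisj (map \<alpha> xs)) \<subseteq> X"
    proof (cases "W = {}")
      case True
      then have "xs = []" using UW xs by auto
      then show ?thesis by (simp add: bigdisj_def)
    next
      case False
      then obtain j where "j \<in> W" by blast
      then show ?thesis using bigdisj_in_prime[OF eP _] v by blast
    qed
    ultimately show ?thesis by blast
  qed
  have "kvalid W R a" if a: "a \<in> ?L" for a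
    unfolding kvalid_def
  proof (intro allI impI ballI)
    fix V :: "nat \<Rightarrow> nat set" and i assume V: "\<forall>p. upset W R (V p)" and i: "i \<in> W"
    have "\<forall>p. \<exists>\<alpha>. vars \<alpha> \<subseteq> X \<and> (\<forall>j\<in>W. \<alpha> \<in> e j \<longleftrightarrow> j \<in> V p)" using definable V by blast
    then obtain s where s: "\<And>p. vars (s p) \<subseteq> X" "\<And>p j. j \<in> W \<Longrightarrow> s p \<in> e j \<longleftrightarrow> j \<in> V p" by metis
    have "vars (subst s a) \<subseteq> X" using s unfolding vars_subst by blast
    then have "subst s a \<in> e i"
      using logic_gen_subst[OF a] eT[OF i] unfolding theory_on_def by blast
    then have "kforces W R (\<lambda>p. {i\<in>W. s p \<in> e i}) i a" using truth[of s i a] s(1) i by blast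
    then show "kforces W R V i a"
      by (subst kforces_cong[where V' = "\<lambda>p. {i\<in>W. s p \<in> e i}"]) (use s i in auto)
  qed
  moreover have "\<not> kvalid W R \<phi>"
  proof
    assume v: "kvalid W R \<phi>"
    \<comment> \<open>Variables outside \<open>X\<close> are sent to \<open>Bot\<close> so that all
      values are formulas over \<open>X\<close>; on \<open>\<phi>\<close> itself the substitution is
      the identity.\<close>
    define s where "s = (\<lambda>p. if p \<in> X then Var p else Bot)"
    have s: "\<And>p. vars (s p) \<subseteq> X" and s\<phi>: "subst s \<phi> = \<phi>"
      by (auto simp: s_def X_def intro: subst_id)
    have "theory_on ?L X (?L \<inter> {a. vars a \<subseteq> X})"
      unfolding theory_on_def using logic_gen.mp by auto
    then obtain T where "prime_on ?L X T" "\<phi> \<notin> T"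
      using prime_extension[OF X BD] \<phi> by (metis IntD1 X_def order_refl)
    then obtain i where i: "i \<in> W" "\<phi> \<notin> e i" using surj by blast
    have "\<forall>p. upset W R {i\<in>W. s p \<in> e i}" by (auto simp: upset_def R_def)
    then have "kforces W R (\<lambda>p. {i\<in>W. s p \<in> e i}) i \<phi>" using v i unfolding kvalid_def by simp
    then show False using truth[of s i \<phi>] s i(1) s\<phi> i(2) by simp
  qed
  ultimately show ?thesis using W pos by blast
qed

text \<open>The two Jankov formulas give the splitting property of the finite frame; the depth bound
  comes from \<open>bd_form n\<close>, which belongs to \<open>BD n\<close>.\<close>

lemma PLn_finite_model:
  assumes "\<phi> \<notin> PLn n"
  shows "\<exists>W R. finite W \<and> poset W R \<and> pl_frame W R \<and> (\<forall>x\<in>W. depth_le W R n x) \<and> \<not> kvalid W R \<phi>"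
proof -
  let ?G = "BD n \<union> {chi_fork3, chi_scott}"
  obtain W R where W: "finite W" "poset W R" "\<forall>a\<in>logic_gen ?G. kvalid W R a" "\<not> kvalid W R \<phi>"
    using finite_model_property[of n ?G \<phi>] assms unfolding PLn_def by blast
  have "kvalid W R chi_fork3" "kvalid W R chi_scott" "kvalid W R (bd_form n)"
    using W(3) logic_gen_incl[of _ ?G] bd_form_in_BD by auto
  then have pl: "pl_frame W R" and bd: "kvalid W R (bd_form n)"
    using pl_frame_if_chi_valid[OF W(1,2)] by auto
  have "depth_le W R n x" if x: "x \<in> W" for x
  proof (rule ccontr)
    assume "\<not> ?thesis"
    then obtain V where "\<forall>p. upset W R (V p)" "\<not> kforces W R V x (bd_form n)"
      using not_kforces_bd_form[OF W(2) x] by blast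
    then show False using bd x unfolding kvalid_def by simp
  qed
  then show ?thesis using W(1,2,4) pl by blast
qed

subsection \<open>Affine functions and simplices\<close>

definition affine_fun :: "('a::real_vector \<Rightarrow> real) \<Rightarrow> bool" where
  "affine_fun l \<longleftrightarrow> (\<exists>g c. linear g \<and> l = (\<lambda>x. g x + c))"

lemma affine_funI: "linear g \<Longrightarrow> affine_fun (\<lambda>x. g x + c)"
  unfolding affine_fun_def by blast

lemma affine_fun_sum:
  assumes "affine_fun l" "sum u A = 1"
  shows "l (\<Sum>a\<in>A. u a *\<^sub>R f a) = (\<Sum>a\<in>A. u a * l (f a))"
proof -
  obtain g c where g: "linear g" "l = (\<lambda>x. g x + c)" using assms(1) unfolding affine_fun_def by blast
  have "(\<Sum>a\<in>A. u a * (g (f a) + c)) = (\<Sum>a\<in>A. u a * g (f a)) + sum u A * c"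
    by (simp add: distrib_left sum.distrib sum_distrib_right)
  then show ?thesis using assms(2) by (simp add: g linear_sum[OF g(1)] linear_cmul[OF g(1)])
qed

lemma affine_fun_segment:
  assumes "affine_fun l"
  shows "l (x + t *\<^sub>R (y - x)) = (1 - t) * l x + t * l y"
proof -
  obtain g c where g: "linear g" "l = (\<lambda>x. g x + c)" using assms(1) unfolding affine_fun_def by blast
  then show ?thesis
    by (simp add: linear_add[OF g(1)] linear_cmul[OF g(1)] linear_diff[OF g(1)] algebra_simps)
qed

lemma affine_fun_comb:
  assumes "affine_fun l" "u + v = 1"
  shows "l (u *\<^sub>R x + v *\<^sub>R y) = u * l x + v * l y"
proof -
  have u: "u = 1 - v" using assms(2) by simp
  have "u *\<^sub>R x + v *\<^sub>R y = x + v *\<^sub>R (y - x)" unfolding u by (simp add: algebra_simps)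
  then show ?thesis using affine_fun_segment[OF assms(1), of x v y] u by simp
qed

lemma affine_fun_uminus: "affine_fun l \<Longrightarrow> affine_fun (\<lambda>x. - l x)"
  unfolding affine_fun_def
proof (elim exE conjE)
  fix g c assume "linear g" "l = (\<lambda>x. g x + c)"
  then show "\<exists>g c. linear g \<and> (\<lambda>x. - l x) = (\<lambda>x. g x + c)"
    by (intro exI[of _ "\<lambda>x. - g x"] exI[of _ "- c"]) (auto intro: linear_compose_neg)
qed

lemma convex_affine_nonneg:
  assumes "\<And>l. l \<in> A \<Longrightarrow> affine_fun l"
  shows "convex {x. \<forall>l\<in>A. 0 \<le> l x}"
proof (rule convexI)
  fix x y :: 'a and u v :: real
  assume xy: "x \<in> {x. \<forall>l\<in>A. 0 \<le> l x}" "y \<in> {x. \<forall>l\<in>A. 0 \<le> l x}" and u: "0 \<le> u" "0 \<le> v" "u + v = 1"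
  have "0 \<le> l (u *\<^sub>R x + v *\<^sub>R y)" if "l \<in> A" for l
    unfolding affine_fun_comb[OF assms[OF that] u(3)] using xy u that by simp
  then show "u *\<^sub>R x + v *\<^sub>R y \<in> {x. \<forall>l\<in>A. 0 \<le> l x}" by blast
qed

lemma subspace_Rd: "subspace (Rd d)"
  unfolding subspace_def Rd_def by (auto simp: scaleR_fun_def)

lemma Rd_mono: "d \<le> e \<Longrightarrow> Rd d \<subseteq> Rd e"
  unfolding Rd_def by auto

lemma hull_subset_Rd: "S \<subseteq> Rd d \<Longrightarrow> convex hull S \<subseteq> Rd d"
  by (intro hull_minimal subspace_imp_convex subspace_Rd)

lemma Rd_sum: "x \<in> Rd d \<Longrightarrow> x = (\<Sum>i<d. x i *\<^sub>R (\<lambda>j. if j = i then 1 else 0))"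
proof (rule ext)
  fix j assume x: "x \<in> Rd d"
  have "(\<Sum>i<d. x i *\<^sub>R (\<lambda>j. if j = i then 1 else (0::real))) j = (\<Sum>i<d. x i * (if j = i then 1 else 0))"
  proof -
    have "(\<Sum>i\<in>I. x i *\<^sub>R (\<lambda>j. if j = i then 1 else (0::real))) j = (\<Sum>i\<in>I. x i * (if j = i then 1 else 0))"
      if "finite I" for I
      using that by induction (auto simp: scaleR_fun_def)
    then show ?thesis by simp
  qed
  also have "\<dots> = x j" using x by (auto simp: Rd_def if_distrib cong: if_cong)
  finally show "x j = (\<Sum>i<d. x i *\<^sub>R (\<lambda>j. if j = i then 1 else 0)) j" by simp
qed

lemma independent_Rd_bound:
  assumes "independent B" "B \<subseteq> Rd d"
  shows "finite B \<and> card B \<le> d"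
proof -
  let ?E = "(\<lambda>i j. if j = i then 1 else (0::real)) ` {..<d}"
  have "x \<in> span ?E" if "x \<in> Rd d" for x
  proof (subst Rd_sum[OF that], rule span_sum)
    fix i assume "i \<in> {..<d}"
    then show "x i *\<^sub>R (\<lambda>j. if j = i then 1 else 0) \<in> span ?E"
      by (intro span_scale span_base) blast
  qed
  then have "finite B \<and> card B \<le> card ?E"
    using assms by (intro independent_span_bound) auto
  moreover have "card ?E \<le> d" using card_image_le[of "{..<d}"] by fastforce
  ultimately show ?thesis by linarith
qed

text \<open>The functionals dual to the basis \<open>B\<close>, extended linearly to all sequences,
  so that half-spaces of \<open>Rd d\<close> are described by functions defined everywhere.\<close>

lemma coordinates_on_Rd:
  assumes "independent B" "B \<subseteq> Rd d" "Rd d \<subseteq> span B"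
  shows "\<exists>g. (\<forall>b\<in>B. linear (g b)) \<and> (\<forall>b\<in>B. \<forall>b'\<in>B. g b b' = (if b = b' then 1 else (0::real)))
    \<and> (\<forall>x\<in>Rd d. x = (\<Sum>b\<in>B. g b x *\<^sub>R b))"
proof -
  have fin: "finite B" using independent_Rd_bound assms by blast
  have ex: "\<exists>h. linear h \<and> (\<forall>b'\<in>B. h b' = (if b = b' then 1 else (0::real)))" for b
    using linear_independent_extend[OF assms(1), of "\<lambda>b'. if b = b' then 1 else (0::real)"] .
  define g where "g = (\<lambda>b. SOME h. linear h \<and> (\<forall>b'\<in>B. h b' = (if b = b' then 1 else (0::real))))"
  have "linear (g b) \<and> (\<forall>b'\<in>B. g b b' = (if b = b' then 1 else (0::real)))" for b
    unfolding g_def by (rule someI_ex[OF ex])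
  then have g: "\<And>b. b \<in> B \<Longrightarrow> linear (g b)"
    "\<And>b b'. b \<in> B \<Longrightarrow> b' \<in> B \<Longrightarrow> g b b' = (if b = b' then 1 else (0::real))"
    by blast+
  have "x = (\<Sum>b\<in>B. g b x *\<^sub>R b)" if x: "x \<in> Rd d" for x
  proof -
    have "x \<in> span B" using x assms(3) by blast
    then obtain u where u: "x = (\<Sum>b\<in>B. u b *\<^sub>R b)" unfolding span_finite[OF fin] by blast
    have "g b x = u b" if b: "b \<in> B" for b
    proof -
      have "g b x = (\<Sum>b'\<in>B. u b' * g b b')"
        unfolding u by (simp add: linear_sum[OF g(1)[OF b]] linear_cmul[OF g(1)[OF b]])
      also have "\<dots> = (\<Sum>b'\<in>B. if b = b' then u b' else 0)" by (rule sum.cong) (auto simp: g(2) b)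
      also have "\<dots> = u b" using fin b by simp
      finally show ?thesis .
    qed
    then show ?thesis using u by simp
  qed
  then show ?thesis using g by (intro exI[of _ g]) simp
qed

text \<open>A description by inequalities: inside \<open>Rd d\<close>, a finite union of finite
  intersections of closed half-spaces. Membership is compared on \<open>Rd d\<close> only, because
  finitely many inequalities cannot cut out this subspace of the infinite-dimensional space.\<close>

definition hrep :: "nat \<Rightarrow> vec set \<Rightarrow> bool" where
  "hrep d Q \<longleftrightarrow> (\<exists>\<A>. finite \<A> \<and> (\<forall>A\<in>\<A>. finite A \<and> (\<forall>l\<in>A. affine_fun l))
     \<and> (\<forall>x\<in>Rd d. x \<in> Q \<longleftrightarrow> (\<exists>A\<in>\<A>. \<forall>l\<in>A. 0 \<le> l x)))"

text \<open>With a vertex \<open>a\<close> as origin, the vectors to the other vertices are extended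
  to a basis of \<open>Rd d\<close>. A point lies in the simplex iff its coordinates along these
  edges are nonnegative with sum at most 1 and its remaining coordinates vanish.\<close>

lemma simplex_halfspaces:
  assumes V: "finite V" "\<not> affine_dependent V" "V \<subseteq> Rd d"
  shows "\<exists>A. finite A \<and> (\<forall>l\<in>A. affine_fun l) \<and> (\<forall>x\<in>Rd d. x \<in> convex hull V \<longleftrightarrow> (\<forall>l\<in>A. 0 \<le> l x))"
proof (cases "V = {}")
  case True
  have "affine_fun (\<lambda>x::vec. 0 + - 1)" by (rule affine_funI) (simp add: linear_iff)
  then show ?thesis using True by (intro exI[of _ "{\<lambda>x::vec. 0 + - 1}"]) auto
next
  case False
  then obtain a where a: "a \<in> V" by blast
  define W where "W = V - {a}"
  define B0 where "B0 = (\<lambda>x. - a + x) ` W"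
  have "independent B0" using V(2) a affine_dependent_iff_dependent2 unfolding B0_def W_def by blast
  moreover have "B0 \<subseteq> Rd d"
  proof
    fix b assume "b \<in> B0"
    then obtain x where "x \<in> V" "b = - a + x" unfolding B0_def W_def by blast
    then show "b \<in> Rd d" using V(3) a subspace_diff[OF subspace_Rd, of x d a] by auto
  qed
  ultimately obtain B where B: "B0 \<subseteq> B" "B \<subseteq> Rd d" "independent B" "Rd d \<subseteq> span B"
    by (metis maximal_independent_subset_extend)
  have fin: "finite B" using independent_Rd_bound B by blast
  obtain g where g': "\<forall>b\<in>B. linear (g b)"
    "\<forall>b\<in>B. \<forall>b'\<in>B. g b b' = (if b = b' then 1 else (0::real))"
    "\<forall>x\<in>Rd d. x = (\<Sum>b\<in>B. g b x *\<^sub>R b)"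
    using coordinates_on_Rd[OF B(3,2,4)] by (elim exE conjE)
  note g = g'[rule_format]
  \<comment> \<open>\<open>p b\<close> is the coordinate along \<open>b\<close> measured from
    \<open>a\<close>. Its negative \<open>q b\<close> is added for \<open>b\<close> outside the
    edges, where the pair forces the coordinate to be 0. The function \<open>r\<close> is 1 minus
    the sum of the edge coordinates, which is the weight of the vertex \<open>a\<close>.\<close>
  define p where "p = (\<lambda>b x. g b x + - g b a)"
  define q where "q = (\<lambda>b x. - p b x)"
  define r where "r = (\<lambda>x. (\<Sum>b\<in>B0. - g b x) + (1 + (\<Sum>b\<in>B0. g b a)))"
  have r: "r x = 1 - (\<Sum>b\<in>B0. p b x)" for x
    by (simp add: r_def p_def sum_negf sum_subtractf)
  have B0f: "finite B0" using B(1) fin finite_subset by blast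
  have aff: "affine_fun (p b)" "affine_fun (q b)" if "b \<in> B" for b
  proof -
    show 1: "affine_fun (p b)" unfolding p_def by (rule affine_funI[OF g(1)[OF that]])
    show "affine_fun (q b)" unfolding q_def by (rule affine_fun_uminus[OF 1])
  qed
  have affr: "affine_fun r"
    unfolding r_def by (rule affine_funI, rule linear_compose_sum)
      (use g(1) B(1) in \<open>auto intro: linear_compose_neg\<close>)
  have pd: "p b x = g b (x - a)" if "b \<in> B" for b x
    by (simp add: p_def linear_diff[OF g(1)[OF that]])
  let ?A = "p ` B \<union> q ` (B - B0) \<union> {r}"
  have finA: "finite ?A" using fin by auto
  have affA: "\<forall>l\<in>?A. affine_fun l" using aff affr by blast
  have "x \<in> convex hull V \<longleftrightarrow> (\<forall>l\<in>?A. 0 \<le> l x)" if x: "x \<in> Rd d" for x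
  proof
    assume "x \<in> convex hull V"
    have "V \<subseteq> {x. \<forall>l\<in>?A. 0 \<le> l x}"
    proof
      fix v assume v: "v \<in> V"
      show "v \<in> {x. \<forall>l\<in>?A. 0 \<le> l x}"
      proof (cases "v = a")
        case True
        have "p b a = 0" for b by (simp add: p_def)
        then show ?thesis using True by (auto simp: q_def r)
      next
        case False
        then have w: "v - a \<in> B0" using v unfolding B0_def W_def by force
        then have pb: "p b v = (if b = v - a then 1 else 0)" if "b \<in> B" for b
          using pd[OF that] g(2)[OF that, of "v - a"] B(1) by auto
        have "(\<Sum>b\<in>B0. p b v) = (\<Sum>b\<in>B0. if b = v - a then 1 else 0)"
          by (rule sum.cong) (use pb B(1) in auto)
        also have "\<dots> = 1" using B0f w by simp
        finally have "r v = 0" by (simp add: r)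
        moreover have "q b v = 0" if "b \<in> B - B0" for b using that pb w by (auto simp: q_def)
        ultimately show ?thesis using pb by auto
      qed
    qed
    then have "convex hull V \<subseteq> {x. \<forall>l\<in>?A. 0 \<le> l x}"
      by (rule hull_minimal) (use affA convex_affine_nonneg[of ?A] in blast)
    then show "\<forall>l\<in>?A. 0 \<le> l x" using \<open>x \<in> convex hull V\<close> by blast
  next
    assume nn: "\<forall>l\<in>?A. 0 \<le> l x"
    have p0: "0 \<le> p b x" if "b \<in> B" for b using nn that by auto
    have pz: "p b x = 0" if "b \<in> B - B0" for b
    proof -
      have "0 \<le> q b x" "0 \<le> p b x" using nn that by blast+
      then show ?thesis by (simp add: q_def)
    qed
    have "x - a \<in> Rd d" using x a V(3) subspace_Rd subspace_diff by blast
    then have "x - a = (\<Sum>b\<in>B. g b (x - a) *\<^sub>R b)" by (rule g(3))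
    also have "\<dots> = (\<Sum>b\<in>B. p b x *\<^sub>R b)" by (simp add: pd)
    also have "\<dots> = (\<Sum>b\<in>B0. p b x *\<^sub>R b)"
      by (rule sum.mono_neutral_right) (use fin B(1) pz in auto)
    finally have xa: "x = a + (\<Sum>b\<in>B0. p b x *\<^sub>R b)" by (simp add: algebra_simps)
    define s where "s = (\<Sum>b\<in>B0. p b x)"
    have s1: "s \<le> 1" using nn r by (auto simp: s_def)
    have inj: "inj_on (\<lambda>x. - a + x) W" by (auto simp: inj_on_def)
    define u where "u = (\<lambda>v. if v = a then 1 - s else p (- a + v) x)"
    have uW: "sum u W = s"
    proof -
      have "sum u W = (\<Sum>v\<in>W. p (- a + v) x)" by (rule sum.cong) (auto simp: u_def W_def)
      then show ?thesis unfolding s_def B0_def sum.reindex[OF inj] by simp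
    qed
    have Vi: "V = insert a W" "a \<notin> W" "finite W" using a V(1) by (auto simp: W_def)
    have "sum u V = 1" using Vi uW by (simp add: u_def)
    moreover have "(\<Sum>v\<in>V. u v *\<^sub>R v) = x"
    proof -
      have "(\<Sum>v\<in>W. u v *\<^sub>R v) = (\<Sum>v\<in>W. p (- a + v) x *\<^sub>R (- a + v) + u v *\<^sub>R a)"
        by (rule sum.cong) (auto simp: u_def W_def algebra_simps)
      also have "\<dots> = (\<Sum>b\<in>B0. p b x *\<^sub>R b) + s *\<^sub>R a"
        unfolding sum.distrib uW[symmetric] B0_def sum.reindex[OF inj] by (simp add: scaleR_sum_left)
      finally have "(\<Sum>v\<in>V. u v *\<^sub>R v) = (1 - s) *\<^sub>R a + ((\<Sum>b\<in>B0. p b x *\<^sub>R b) + s *\<^sub>R a)"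
        using Vi by (simp add: u_def)
      also have "\<dots> = a + (\<Sum>b\<in>B0. p b x *\<^sub>R b)" by (simp add: algebra_simps)
      finally show ?thesis using xa by simp
    qed
    moreover have "\<forall>v\<in>V. 0 \<le> u v"
      using s1 p0 B(1) unfolding u_def B0_def W_def by auto
    ultimately show "x \<in> convex hull V"
      unfolding convex_hull_finite[OF V(1)] by (intro CollectI exI[of _ u] conjI)
  qed
  then show ?thesis using finA affA[rule_format] by (intro exI[of _ ?A] conjI ballI)
qed

lemma hrep_UN:
  assumes "finite K" "\<And>V. V \<in> K \<Longrightarrow> hrep d (f V)"
  shows "hrep d (\<Union>(f ` K))"
  using assms
proof (induction K)
  case empty
  then show ?case unfolding hrep_def by (intro exI[of _ "{}"]) simp
next
  case (insert V K)
  have h: "hrep d (f V)" "hrep d (\<Union>(f ` K))" using insert by auto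
  obtain \<A> where
    A: "finite \<A>" "\<forall>A\<in>\<A>. finite A \<and> (\<forall>l\<in>A. affine_fun l)"
     "\<forall>x\<in>Rd d. x \<in> f V \<longleftrightarrow> (\<exists>A\<in>\<A>. \<forall>l\<in>A. 0 \<le> l x)"
    using h(1) unfolding hrep_def by blast
  obtain \<B> where B: "finite \<B>" "\<forall>A\<in>\<B>. finite A \<and> (\<forall>l\<in>A. affine_fun l)"
     "\<forall>x\<in>Rd d. x \<in> \<Union>(f ` K) \<longleftrightarrow> (\<exists>A\<in>\<B>. \<forall>l\<in>A. 0 \<le> l x)"
    using h(2) unfolding hrep_def by blast
  show ?case unfolding hrep_def
  proof (intro exI[of _ "\<A> \<union> \<B>"] conjI ballI)
    fix x assume x: "x \<in> Rd d"
    have "x \<in> \<Union>(f ` insert V K) \<longleftrightarrow> x \<in> f V \<or> x \<in> \<Union>(f ` K)" by simp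
    also have "\<dots> \<longleftrightarrow> (\<exists>A\<in>\<A> \<union> \<B>. \<forall>l\<in>A. 0 \<le> l x)" using A(3) B(3) x by (simp add: bex_Un)
    finally show "x \<in> \<Union>(f ` insert V K) \<longleftrightarrow> (\<exists>A\<in>\<A> \<union> \<B>. \<forall>l\<in>A. 0 \<le> l x)" .
  qed (use A B in auto)
qed

lemma hrep_simplex:
  assumes "finite V" "\<not> affine_dependent V" "V \<subseteq> Rd d"
  shows "hrep d (convex hull V)"
proof -
  obtain A where "finite A" "\<forall>l\<in>A. affine_fun l" "\<forall>x\<in>Rd d. x \<in> convex hull V \<longleftrightarrow> (\<forall>l\<in>A. 0 \<le> l x)"
    using simplex_halfspaces[OF assms] by blast
  then show ?thesis unfolding hrep_def by (intro exI[of _ "{A}"]) simp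
qed

lemma hrep_triangulation:
  assumes "triangulation K P" "P \<subseteq> Rd d"
  shows "hrep d P"
proof -
  have P: "P = \<Union>((\<lambda>V. convex hull V) ` K)" using assms(1) by (simp add: triangulation_def)
  show ?thesis unfolding P
  proof (rule hrep_UN)
    show "finite K" using assms(1) by (simp add: triangulation_def)
    fix V assume V: "V \<in> K"
    then have "convex hull V \<subseteq> P" unfolding P by blast
    then have "V \<subseteq> Rd d" using hull_subset[of V convex] assms(2) by blast
    then show "hrep d (convex hull V)"
      using V assms(1) by (intro hrep_simplex) (auto simp: triangulation_def)
  qed
qed

lemma segment_in_Rd: "x \<in> Rd d \<Longrightarrow> y \<in> Rd d \<Longrightarrow> y + s *\<^sub>R (x - y) \<in> Rd d"
  by (intro subspace_add subspace_scale subspace_diff subspace_Rd)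

text \<open>Along a line every affine function is affine in the parameter, so only finitely many
  inequalities in one real variable are involved and no topology on the space of sequences.\<close>

lemma hrep_closed_on_line:
  assumes "hrep d Q" "x \<in> Rd d" "y \<in> Rd d"
  shows "closed {s. y + s *\<^sub>R (x - y) \<in> Q}"
proof -
  obtain \<A> where A: "finite \<A>" "\<forall>A\<in>\<A>. finite A \<and> (\<forall>l\<in>A. affine_fun l)"
    "\<forall>x\<in>Rd d. x \<in> Q \<longleftrightarrow> (\<exists>A\<in>\<A>. \<forall>l\<in>A. 0 \<le> l x)"
    using assms(1) unfolding hrep_def by blast
  have "{s. y + s *\<^sub>R (x - y) \<in> Q} = (\<Union>A\<in>\<A>. \<Inter>l\<in>A. {s. 0 \<le> l (y + s *\<^sub>R (x - y))})"
  proof (rule set_eqI)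
    fix s
    show "s \<in> {s. y + s *\<^sub>R (x - y) \<in> Q} \<longleftrightarrow> s \<in> (\<Union>A\<in>\<A>. \<Inter>l\<in>A. {s. 0 \<le> l (y + s *\<^sub>R (x - y))})"
      using A(3)[rule_format, OF segment_in_Rd[OF assms(2,3), of s]] by simp
  qed
  also have "\<dots> = (\<Union>A\<in>\<A>. \<Inter>l\<in>A. {s. 0 \<le> (1 - s) * l y + s * l x})"
  proof -
    have "l (y + s *\<^sub>R (x - y)) = (1 - s) * l y + s * l x" if "A \<in> \<A>" "l \<in> A" for A l s
      using A(2) that affine_fun_segment by blast
    then show ?thesis by simp
  qed
  also have "closed \<dots>"
    by (intro closed_UN closed_INT A(1) ballI closed_Collect_le continuous_intros)
  finally show ?thesis .
qed

subsection \<open>Triangulations of convex polytopes\<close>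

lemma affine_independent_insert':
  fixes a :: "'a::real_vector"
  assumes "\<not> affine_dependent S" "a \<notin> affine hull S"
  shows "\<not> affine_dependent (insert a S)"
proof (cases "S = {}")
  case False
  then obtain b where b: "b \<in> S" by blast
  have ab: "a \<noteq> b" using assms(2) b hull_inc[of b S affine] by blast
  have "\<not> dependent ((\<lambda>x. - b + x) ` (S - {b}))"
    using assms(1) affine_dependent_iff_dependent2[OF b] by blast
  moreover have "- b + a \<notin> span ((\<lambda>x. - b + x) ` (S - {b}))"
    using assms(2) unfolding affine_hull_span2[OF b] by force
  ultimately have "independent (insert (- b + a) ((\<lambda>x. - b + x) ` (S - {b})))"
    by (rule independent_insertI[rotated])
  moreover have "(\<lambda>x. - b + x) ` (insert a S - {b}) = insert (- b + a) ((\<lambda>x. - b + x) ` (S - {b}))"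
    using ab by auto
  ultimately show ?thesis using affine_dependent_iff_dependent2[of b "insert a S"] b by simp
qed simp

text \<open>For \<open>y\<close> in \<open>P\<close>: the segment towards \<open>x\<close> leaves
  \<open>P\<close> immediately, so \<open>y\<close> belongs to the part of the boundary that faces
  \<open>x\<close>.\<close>

definition visible :: "'a::real_vector \<Rightarrow> 'a set \<Rightarrow> 'a \<Rightarrow> bool" where
  "visible x P y \<longleftrightarrow> (\<forall>u. 0 < u \<and> u \<le> 1 \<longrightarrow> y + u *\<^sub>R (x - y) \<notin> P)"

text \<open>If \<open>u\<close> were larger than \<open>u'\<close>, then \<open>y'\<close> would lie
  beyond \<open>y\<close> on the segment from \<open>y\<close> to \<open>x\<close>, and
  \<open>y\<close> would not be visible.\<close>

lemma visible_nearest: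
  assumes y: "visible x P y" and y': "y' \<in> P"
    and u: "u \<le> 1" "0 \<le> u'" "u' < 1" and eq: "y + u *\<^sub>R (x - y) = y' + u' *\<^sub>R (x - y')"
  shows "u \<le> u'"
proof (rule ccontr)
  assume n: "\<not> ?thesis"
  define c where "c = (1 - u) / (1 - u')"
  have c: "0 \<le> c" "c < 1" "(1 - u') * c = 1 - u" using n u by (auto simp: c_def field_simps)
  have "(1 - u') *\<^sub>R (y' - x) = (1 - u) *\<^sub>R (y - x)" using eq by (simp add: algebra_simps)
  also have "\<dots> = (1 - u') *\<^sub>R (c *\<^sub>R (y - x))" by (simp add: c(3))
  finally have "y' - x = c *\<^sub>R (y - x)" by (rule scaleR_left_imp_eq[rotated]) (use u in simp)
  then have "y' = y + (1 - c) *\<^sub>R (x - y)" by (simp add: algebra_simps)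
  then show False using y y' c unfolding visible_def by (metis diff_gt_0_iff_gt diff_le_eq le_add_same_cancel1)
qed

lemma visible_eq:
  assumes "visible x P y" "visible x P y'" "y \<in> P" "y' \<in> P"
    and u: "0 \<le> u" "u < 1" "0 \<le> u'" "u' < 1" and eq: "y + u *\<^sub>R (x - y) = y' + u' *\<^sub>R (x - y')"
  shows "y = y'"
proof -
  have "u = u'"
    using visible_nearest[OF assms(1,4) _ u(3,4) eq] visible_nearest[OF assms(2,3) _ u(1,2) eq[symmetric]] u
    by linarith
  then have "(1 - u) *\<^sub>R (y - y') = 0" using eq by (simp add: algebra_simps)
  then show ?thesis using u by simp
qed

text \<open>If \<open>P\<close> met the half-open segment from \<open>z\<close> to \<open>x\<close>, then averaging that point with the point \<open>y1\<close> of the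
  simplex beyond \<open>y\<close> as seen from \<open>z\<close> would give a point of \<open>P\<close> strictly between \<open>y\<close> and \<open>x\<close>.\<close>

lemma visible_simplex:
  assumes V: "finite V" and P: "convex P" "convex hull V \<subseteq> P"
    and lam: "\<And>v. v \<in> V \<Longrightarrow> 0 < lam v" "sum lam V = 1" and y: "y = (\<Sum>v\<in>V. lam v *\<^sub>R v)"
    and vis: "visible x P y" and z: "z \<in> convex hull V"
  shows "visible x P z"
  unfolding visible_def
proof (intro allI impI notI)
  fix s :: real assume s: "0 < s \<and> s \<le> 1" and inP: "z + s *\<^sub>R (x - z) \<in> P"
  obtain mu where mu: "\<forall>v\<in>V. 0 \<le> mu v" "sum mu V = 1" "z = (\<Sum>v\<in>V. mu v *\<^sub>R v)"
    using z unfolding convex_hull_finite[OF V] by blast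
  have ne: "V \<noteq> {}" using mu(2) by auto
  define m where "m = Min (lam ` V)"
  have m: "0 < m" "\<And>v. v \<in> V \<Longrightarrow> m \<le> lam v" using V ne lam(1) by (auto simp: m_def)
  have mu1: "mu v \<le> 1" if "v \<in> V" for v
    using member_le_sum[of v V mu] mu that V by auto
  have lam1: "lam v \<le> 1" if "v \<in> V" for v
    using member_le_sum[of v V lam] lam that V by (auto intro: less_imp_le)
  obtain v0 where "v0 \<in> V" using ne by blast
  then have m1: "m \<le> 1" using m lam1 by fastforce
  \<comment> \<open>Half the least weight of \<open>y\<close>, small enough to keep the weights
    below nonnegative.\<close>
  define t where "t = m / 2"
  have t: "0 < t" "t < 1" using m m1 by (auto simp: t_def)
  \<comment> \<open>The weights of \<open>y1\<close>, found by solving for it: the mean of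
    \<open>z + s *\<^sub>R (x - z)\<close> and \<open>y1\<close> with weights \<open>t\<close> and
    \<open>1 - t\<close> is to be \<open>y + (t * s) *\<^sub>R (x - y)\<close>.\<close>
  define w where "w = (\<lambda>v. ((1 - t * s) * lam v - t * (1 - s) * mu v) / (1 - t))"
  have w0: "0 \<le> w v" if v: "v \<in> V" for v
  proof -
    have "t * (1 - s) * mu v \<le> t * 1 * 1"
      using t s mu(1) mu1 v by (intro mult_mono) auto
    moreover have "1 / 2 * m \<le> (1 - t * s) * lam v"
    proof (rule mult_mono)
      have "t * s \<le> 1/2 * 1" using t s m1 by (intro mult_mono) (auto simp: t_def)
      then show "1 / 2 \<le> 1 - t * s" "0 \<le> 1 - t * s" by auto
    qed (use m v in auto)
    ultimately have "t * (1 - s) * mu v \<le> (1 - t * s) * lam v" unfolding t_def by linarith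
    then show ?thesis unfolding w_def using t by (intro divide_nonneg_nonneg) auto
  qed
  have "sum w V = ((1 - t * s) * sum lam V - t * (1 - s) * sum mu V) / (1 - t)"
    by (simp add: w_def sum_subtractf sum_distrib_left flip: sum_divide_distrib)
  also have "\<dots> = 1" using t by (simp add: lam mu field_simps)
  finally have w1: "sum w V = 1" .
  define y1 where "y1 = (\<Sum>v\<in>V. w v *\<^sub>R v)"
  have "y1 \<in> convex hull V" unfolding convex_hull_finite[OF V] y1_def using w0 w1 by blast
  then have "y1 \<in> P" using P by blast
  then have "t *\<^sub>R (z + s *\<^sub>R (x - z)) + (1 - t) *\<^sub>R y1 \<in> P"
    using P(1) inP t unfolding convex_def by (metis diff_ge_0_iff_ge less_imp_le add.commute diff_add_cancel)
  moreover have "(1 - t) *\<^sub>R y1 = (1 - t * s) *\<^sub>R y - (t * (1 - s)) *\<^sub>R z"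
  proof -
    have "(1 - t) *\<^sub>R y1 = (\<Sum>v\<in>V. ((1 - t * s) * lam v - t * (1 - s) * mu v) *\<^sub>R v)"
      unfolding y1_def scaleR_sum_right using t by (intro sum.cong) (auto simp: w_def)
    also have "\<dots> = (1 - t * s) *\<^sub>R y - (t * (1 - s)) *\<^sub>R z"
      by (simp add: y mu(3) scaleR_sum_right scaleR_diff_left sum_subtractf)
    finally show ?thesis .
  qed
  moreover have "t *\<^sub>R (z + s *\<^sub>R (x - z)) + ((1 - t * s) *\<^sub>R y - (t * (1 - s)) *\<^sub>R z) = y + (t * s) *\<^sub>R (x - y)"
    by (simp add: algebra_simps)
  ultimately have "y + (t * s) *\<^sub>R (x - y) \<in> P" by simp
  moreover have "0 < t * s" "t * s \<le> 1" using t s by (auto intro: mult_le_one)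
  ultimately show False using vis unfolding visible_def by blast
qed

text \<open>If \<open>x\<close> were in the affine hull, moving the barycentre of \<open>V\<close> a
  little towards \<open>x\<close> would keep its weights nonnegative and so stay in the simplex,
  against the visibility of the barycentre.\<close>

lemma visible_not_in_affine_hull:
  assumes V: "finite V" "V \<noteq> {}" and P: "convex hull V \<subseteq> P"
    and vis: "\<And>y. y \<in> convex hull V \<Longrightarrow> visible x P y"
  shows "x \<notin> affine hull V"
proof
  assume "x \<in> affine hull V"
  then obtain c where c: "sum c V = 1" "x = (\<Sum>v\<in>V. c v *\<^sub>R v)" unfolding affine_hull_finite[OF V(1)] by blast
  define k where "k = 1 / real (card V)"
  have k: "0 < k" "sum (\<lambda>_. k) V = 1" using V by (auto simp: k_def card_gt_0_iff)
  define y where "y = (\<Sum>v\<in>V. k *\<^sub>R v)"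
  define M where "M = 1 + (\<Sum>v\<in>V. \<bar>c v\<bar>)"
  have M: "1 \<le> M" "\<And>v. v \<in> V \<Longrightarrow> \<bar>c v\<bar> \<le> M"
  proof -
    show "1 \<le> M" by (simp add: M_def sum_nonneg)
    show "\<bar>c v\<bar> \<le> M" if "v \<in> V" for v
      using member_le_sum[of v V "\<lambda>v. \<bar>c v\<bar>"] that V by (simp add: M_def)
  qed
  \<comment> \<open>Chosen so that \<open>(1 - u) * k\<close> equals \<open>u * M\<close>, which
    outweighs a negative \<open>u * c v\<close>.\<close>
  define u where "u = k / (k + M)"
  have u: "0 < u" "u \<le> 1" "(1 - u) * k = u * M" using k M by (auto simp: u_def field_simps)
  define w where "w = (\<lambda>v. (1 - u) * k + u * c v)"
  have "0 \<le> w v" if "v \<in> V" for v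
  proof -
    have "0 \<le> u * (M + c v)" using M(2)[OF that] u by (intro mult_nonneg_nonneg) auto
    then show ?thesis by (simp add: w_def u(3) distrib_left)
  qed
  moreover have "sum w V = 1"
  proof -
    have "sum w V = (1 - u) * sum (\<lambda>_. k) V + u * sum c V"
      unfolding w_def sum.distrib sum_distrib_left ..
    then show ?thesis unfolding k(2) c(1) by simp
  qed
  moreover have "(\<Sum>v\<in>V. w v *\<^sub>R v) = y + u *\<^sub>R (x - y)"
  proof -
    have "(\<Sum>v\<in>V. w v *\<^sub>R v) = (1 - u) *\<^sub>R y + u *\<^sub>R x"
      unfolding y_def c(2) by (simp add: w_def scaleR_sum_right scaleR_add_left sum.distrib)
    then show ?thesis by (simp add: algebra_simps)
  qed
  ultimately have "y + u *\<^sub>R (x - y) \<in> convex hull V" unfolding convex_hull_finite[OF V(1)] by blast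
  moreover have "y \<in> convex hull V"
    unfolding convex_hull_finite[OF V(1)] y_def using k by (intro CollectI exI[of _ "\<lambda>_. k"]) auto
  ultimately show False using vis u P unfolding visible_def by blast
qed

lemma triangulationD:
  assumes "triangulation K P"
  shows "finite K" "\<And>V. V \<in> K \<Longrightarrow> finite V" "\<And>V. V \<in> K \<Longrightarrow> V \<noteq> {}"
    "\<And>V. V \<in> K \<Longrightarrow> \<not> affine_dependent V"
    "\<And>V W. V \<in> K \<Longrightarrow> W \<subseteq> V \<Longrightarrow> W \<noteq> {} \<Longrightarrow> W \<in> K"
    "\<And>V W. V \<in> K \<Longrightarrow> W \<in> K \<Longrightarrow> convex hull V \<inter> convex hull W = convex hull (V \<inter> W)"
    "\<Union>((\<lambda>V. convex hull V) ` K) = P"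
proof -
  note D = assms[unfolded triangulation_def]
  note D2 = D[THEN conjunct2] note D3 = D2[THEN conjunct2] note D4 = D3[THEN conjunct2]
  show "finite K" by (rule D[THEN conjunct1])
  show "finite V" "V \<noteq> {}" "\<not> affine_dependent V" if "V \<in> K" for V
    using D2[THEN conjunct1, rule_format, OF that] by blast+
  show "W \<in> K" if "V \<in> K" "W \<subseteq> V" "W \<noteq> {}" for V W
    by (rule D3[THEN conjunct1, rule_format, OF that(1) conjI[OF that(2,3)]])
  show "convex hull V \<inter> convex hull W = convex hull (V \<inter> W)" if "V \<in> K" "W \<in> K" for V W
    by (rule D4[THEN conjunct1, rule_format, OF that])
  show "\<Union>((\<lambda>V. convex hull V) ` K) = P" by (rule D4[THEN conjunct2])
qed

text \<open>In a simplex of least size containing \<open>y\<close> no weight vanishes, since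
  dropping that vertex would leave a smaller simplex of \<open>K\<close> containing
  \<open>y\<close>.\<close>

lemma minimal_carrier:
  assumes "triangulation K P" "y \<in> P"
  shows "\<exists>V lam. V \<in> K \<and> (\<forall>v\<in>V. 0 < lam v) \<and> sum lam V = 1 \<and> y = (\<Sum>v\<in>V. lam v *\<^sub>R v)"
proof -
  note K = triangulationD[OF assms(1)]
  have "\<exists>V. V \<in> K \<and> y \<in> convex hull V" using K(7) assms(2) by blast
  then obtain V where V: "V \<in> K" "y \<in> convex hull V"
    "\<forall>W. W \<in> K \<and> y \<in> convex hull W \<longrightarrow> card V \<le> card W"
    using ex_has_least_nat[of "\<lambda>V. V \<in> K \<and> y \<in> convex hull V" _ card] by blast
  have fin: "finite V" using K(2) V(1) .
  obtain lam where lam: "\<forall>v\<in>V. 0 \<le> lam v" "sum lam V = 1" "y = (\<Sum>v\<in>V. lam v *\<^sub>R v)"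
    using V(2) unfolding convex_hull_finite[OF fin] by blast
  have "0 < lam v" if v: "v \<in> V" for v
  proof (rule ccontr)
    assume "\<not> ?thesis"
    then have 0: "lam v = 0" using lam(1) v by force
    let ?W = "V - {v}"
    have Vi: "V = insert v ?W" "v \<notin> ?W" "finite ?W" using v fin by auto
    have s: "sum lam ?W = 1" using lam(2) 0 sum.remove[OF fin v, of lam] by simp
    have "(\<Sum>v\<in>V. lam v *\<^sub>R v) = (\<Sum>v\<in>?W. lam v *\<^sub>R v)"
      by (rule sum.mono_neutral_right) (use fin 0 in auto)
    then have "(\<forall>v\<in>?W. 0 \<le> lam v) \<and> sum lam ?W = 1 \<and> (\<Sum>v\<in>?W. lam v *\<^sub>R v) = y"
      using lam s by simp
    then have "y \<in> convex hull ?W" unfolding convex_hull_finite[OF Vi(3)] by (intro CollectI exI)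
    moreover have "?W \<noteq> {}" using s by force
    then have "?W \<in> K" by (rule K(5)[OF V(1) Diff_subset])
    ultimately have "card V \<le> card ?W" using V(3) by (intro V(3)[rule_format] conjI)
    then show False using v fin by (metis card_Diff1_less not_less)
  qed
  then show ?thesis using V(1) lam(2,3) by (intro exI[of _ V] exI[of _ lam]) simp
qed

lemma convex_hull_insert_seg:
  fixes x :: "'a::real_vector"
  assumes "V \<noteq> {}"
  shows "convex hull (insert x V) = {y + u *\<^sub>R (x - y) | y u. y \<in> convex hull V \<and> 0 \<le> u \<and> u \<le> 1}"
  unfolding convex_hull_insert[OF assms]
proof (intro set_eqI iffI)
  fix z assume "z \<in> {z. \<exists>u\<ge>0. \<exists>v\<ge>0. \<exists>b. u + v = 1 \<and> b \<in> convex hull V \<and> z = u *\<^sub>R x + v *\<^sub>R b}"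
  then obtain u v b where *: "0 \<le> u" "0 \<le> v" "u + v = 1" "b \<in> convex hull V" "z = u *\<^sub>R x + v *\<^sub>R b" by blast
  have v: "v = 1 - u" using * by simp
  have "z = b + u *\<^sub>R (x - b)" unfolding *(5) v by (simp add: algebra_simps)
  then show "z \<in> {y + u *\<^sub>R (x - y) | y u. y \<in> convex hull V \<and> 0 \<le> u \<and> u \<le> 1}" using * by force
next
  fix z assume "z \<in> {y + u *\<^sub>R (x - y) | y u. y \<in> convex hull V \<and> 0 \<le> u \<and> u \<le> 1}"
  then obtain y u where *: "z = y + u *\<^sub>R (x - y)" "y \<in> convex hull V" "0 \<le> u" "u \<le> 1" by blast
  then have "z = u *\<^sub>R x + (1 - u) *\<^sub>R y" by (simp add: algebra_simps)
  then show "z \<in> {z. \<exists>u\<ge>0. \<exists>v\<ge>0. \<exists>b. u + v = 1 \<and> b \<in> convex hull V \<and> z = u *\<^sub>R x + v *\<^sub>R b}"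
    using * by (intro CollectI exI[of _ u] exI[of _ "1 - u"] exI[of _ y] conjI) auto
qed

text \<open>The placing construction: cones with apex \<open>x\<close> over the visible simplices
  are added to \<open>K\<close>. Such a cone meets \<open>P\<close> only in its base, and two cones
  meet in the cone over the intersection of their bases because the visible point behind a given
  point is unique. A point outside \<open>P\<close> is covered because the last point of
  \<open>P\<close> on the way to it is visible and, by \<open>visible_simplex\<close>, so is the
  whole simplex carrying that point.\<close>

lemma triangulation_insert:
  assumes K: "triangulation K P" and P: "P = convex hull S" "S \<noteq> {}" and x: "x \<notin> P"
    and Rd: "P \<subseteq> Rd d" "x \<in> Rd d"
  shows "\<exists>K'. triangulation K' (convex hull (insert x S))"
proof -
  define N where "N = {V\<in>K. \<forall>y\<in>convex hull V. visible x P y}"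
  define K' where "K' = K \<union> insert x ` N \<union> {{x}}"
  have cP: "convex P" by (simp add: P)
  note finK = triangulationD(1)[OF K] and Kface = triangulationD(5)[OF K]
    and KInt = triangulationD(6)[OF K] and KU = triangulationD(7)[OF K]
  have KV: "finite V \<and> V \<noteq> {} \<and> \<not> affine_dependent V" if "V \<in> K" for V
    using triangulationD(2-4)[OF K that] by blast
  have hP: "convex hull V \<subseteq> P" if "V \<in> K" for V using KU that by blast
  have xV: "x \<notin> V" if "V \<in> K" for V using hP[OF that] hull_subset[of V convex] x by blast
  have NK: "V \<in> K" if "V \<in> N" for V using that by (simp add: N_def)
  have Nvis: "visible x P y" if "V \<in> N" "y \<in> convex hull V" for V y using that by (simp add: N_def)
  have Nface: "W \<in> N" if "V \<in> N" "W \<subseteq> V" "W \<noteq> {}" for V W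
    using that Kface[OF NK[OF that(1)] that(2,3)] hull_mono[OF that(2)] by (auto simp: N_def)
  have cone: "\<exists>y u. y \<in> convex hull V \<and> z = y + u *\<^sub>R (x - y) \<and> 0 \<le> u \<and> u < 1"
    if V: "V \<in> N" "z \<in> convex hull (insert x V)" "z \<noteq> x" for V z
  proof -
    have "V \<noteq> {}" using KV[OF NK[OF V(1)]] by blast
    then obtain y u where yu: "z = y + u *\<^sub>R (x - y)" "y \<in> convex hull V" "0 \<le> u" "u \<le> 1"
      using V(2) by (auto simp: convex_hull_insert_seg)
    have "u \<noteq> 1" using yu(1) V(3) by auto
    then show ?thesis using yu by (intro exI[of _ y] exI[of _ u]) auto
  qed
  have cone_P: "z \<in> convex hull V" if V: "V \<in> N" "z \<in> convex hull (insert x V)" "z \<in> P" for V z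
  proof -
    have "z \<noteq> x" using V(3) x by blast
    then obtain y u where yu: "y \<in> convex hull V" "z = y + u *\<^sub>R (x - y)" "0 \<le> u" "u < 1"
      using cone[OF V(1,2)] by blast
    have "\<not> 0 < u" using Nvis[OF V(1) yu(1)] yu(2,4) V(3) unfolding visible_def by auto
    then have "u = 0" using yu(3) by simp
    then show ?thesis using yu by simp
  qed
  have I1: "convex hull (insert x V) \<inter> convex hull W = convex hull V \<inter> convex hull W"
    if "V \<in> N" "W \<in> K" for V W
    using cone_P[OF that(1)] hP[OF that(2)] hull_mono[of V "insert x V" convex] by blast
  have I2: "convex hull (insert x V) \<inter> convex hull (insert x W) = convex hull (insert x V \<inter> insert x W)"
    if VW: "V \<in> N" "W \<in> N" for V W
  proof
    show "convex hull (insert x V \<inter> insert x W) \<subseteq> convex hull (insert x V) \<inter> convex hull (insert x W)"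
      by (intro Int_greatest hull_mono) auto
    show "convex hull (insert x V) \<inter> convex hull (insert x W) \<subseteq> convex hull (insert x V \<inter> insert x W)"
    proof
      fix z assume z: "z \<in> convex hull (insert x V) \<inter> convex hull (insert x W)"
      show "z \<in> convex hull (insert x V \<inter> insert x W)"
      proof (cases "z = x")
        case True
        then show ?thesis by (simp add: hull_inc)
      next
        case False
        obtain y u where yu: "y \<in> convex hull V" "z = y + u *\<^sub>R (x - y)" "0 \<le> u" "u < 1"
          using cone[OF VW(1)] z False by blast
        obtain y' u' where yu': "y' \<in> convex hull W" "z = y' + u' *\<^sub>R (x - y')" "0 \<le> u'" "u' < 1"
          using cone[OF VW(2)] z False by blast
        have "y = y'"
          by (rule visible_eq[of x P y y' u u'])
            (use yu yu' Nvis VW hP NK in auto)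
        then have y: "y \<in> convex hull (V \<inter> W)" using yu(1) yu'(1) KInt NK VW by blast
        then have "V \<inter> W \<noteq> {}" by auto
        then have "z \<in> convex hull (insert x (V \<inter> W))"
          using y yu unfolding convex_hull_insert_seg[OF \<open>V \<inter> W \<noteq> {}\<close>] by force
        then show ?thesis by (simp add: insert_inter_insert)
      qed
    qed
  qed
  have I3: "convex hull V \<inter> convex hull {x} = convex hull (V \<inter> {x})" if "V \<in> K" for V
    using hP[OF that] xV[OF that] x by auto
  have I1': "convex hull (insert x V) \<inter> convex hull W = convex hull (insert x V \<inter> W)"
    if "V \<in> N" "W \<in> K" for V W
  proof -
    have "insert x V \<inter> W = V \<inter> W" using xV[OF that(2)] by blast
    then show ?thesis using I1[OF that] KInt[OF NK[OF that(1)] that(2)] by simp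
  qed
  have I4: "convex hull (insert x V) \<inter> convex hull {x} = convex hull (insert x V \<inter> {x})" for V
    using hull_inc[of x "insert x V" convex] by auto
  have Int: "convex hull V \<inter> convex hull W = convex hull (V \<inter> W)" if VW: "V \<in> K'" "W \<in> K'" for V W
  proof -
    consider "V \<in> K" | V' where "V' \<in> N" "V = insert x V'" | "V = {x}" using VW(1) unfolding K'_def by blast
    note cV = this
    consider "W \<in> K" | W' where "W' \<in> N" "W = insert x W'" | "W = {x}" using VW(2) unfolding K'_def by blast
    note cW = this
    from cV show ?thesis
    proof cases
      case 1
      note V = this
      from cW show ?thesis
      proof cases
        case 2
        then show ?thesis using I1'[OF 2(1) V] by (simp add: Int_commute)
      qed (use V KInt I3 in auto)
    next
      case (2 V')
      note V = this
      from cW show ?thesis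
      proof cases
        case 1
        then show ?thesis using I1'[OF V(1)] V(2) by simp
      next
        case (2 W')
        then show ?thesis using I2[OF V(1) 2(1)] V(2) by simp
      next
        case 3
        then show ?thesis using I4[of V'] V(2) by simp
      qed
    next
      case 3
      note V = this
      from cW show ?thesis
      proof cases
        case 1
        then show ?thesis using I3[OF 1] V by (simp add: Int_commute)
      next
        case (2 W')
        then show ?thesis using I4[of W'] V by (simp add: Int_commute)
      qed (use V in auto)
    qed
  qed
  have aff: "finite V \<and> V \<noteq> {} \<and> \<not> affine_dependent V" if "V \<in> K'" for V
    using that unfolding K'_def
  proof (elim UnE)
    assume "V \<in> insert x ` N"
    then obtain V' where V': "V' \<in> N" "V = insert x V'" by blast
    have V'K: "finite V'" "V' \<noteq> {}" "\<not> affine_dependent V'" using KV NK[OF V'(1)] by blast+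
    have "x \<notin> affine hull V'"
      by (rule visible_not_in_affine_hull[OF V'K(1,2) hP[OF NK[OF V'(1)]] Nvis[OF V'(1)]])
    then show ?thesis using affine_independent_insert'[OF V'K(3)] V'(2) V'K(1) by simp
  qed (use KV in auto)
  have face: "W \<in> K'" if V: "V \<in> K'" and W: "W \<subseteq> V" "W \<noteq> {}" for V W
  proof -
    consider "V \<in> K" | V' where "V' \<in> N" "V = insert x V'" | "V = {x}" using V unfolding K'_def by blast
    then show ?thesis
    proof cases
      case 1
      then show ?thesis using Kface[OF 1 W] by (simp add: K'_def)
    next
      case (2 V')
      show ?thesis
      proof (cases "x \<in> W")
        case False
        then have "W \<subseteq> V'" using W 2 by blast
        then show ?thesis using Kface[OF NK[OF 2(1)] _ W(2)] by (simp add: K'_def)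
      next
        case True
        show ?thesis
        proof (cases "W = {x}")
          case False
          have "W - {x} \<subseteq> V'" "W - {x} \<noteq> {}" using False True W 2 by auto
          then have "W - {x} \<in> N" using Nface[OF 2(1)] by blast
          moreover have "W = insert x (W - {x})" using True by blast
          ultimately show ?thesis unfolding K'_def by blast
        qed (simp add: K'_def)
      qed
    next
      case 3
      then have "W = {x}" using W by blast
      then show ?thesis by (simp add: K'_def)
    qed
  qed
  have U: "\<Union>((\<lambda>V. convex hull V) ` K') = convex hull (insert x S)"
  proof
    have "convex hull V \<subseteq> convex hull (insert x S)" if "V \<in> K" for V
      using hP[OF that] hull_mono[of S "insert x S" convex] P(1) by blast
    moreover have "convex hull (insert x V) \<subseteq> convex hull (insert x S)" if "V \<in> N" for V
    proof (rule hull_minimal)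
      have "V \<subseteq> convex hull V" by (rule hull_subset)
      also have "\<dots> \<subseteq> convex hull S" using hP[OF NK[OF that]] P(1) by simp
      also have "\<dots> \<subseteq> convex hull (insert x S)" by (rule hull_mono) blast
      finally show "insert x V \<subseteq> convex hull (insert x S)" by (simp add: hull_inc)
    qed simp
    moreover have "convex hull {x} \<subseteq> convex hull (insert x S)" by (rule hull_mono) blast
    ultimately show "\<Union>((\<lambda>V. convex hull V) ` K') \<subseteq> convex hull (insert x S)"
      unfolding K'_def by blast
    show "convex hull (insert x S) \<subseteq> \<Union>((\<lambda>V. convex hull V) ` K')"
    proof
      fix z assume "z \<in> convex hull (insert x S)"
      then obtain y u where yu: "z = y + u *\<^sub>R (x - y)" "y \<in> P" "0 \<le> u" "u \<le> 1"
        unfolding convex_hull_insert_seg[OF P(2)] P(1) by blast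
      show "z \<in> \<Union>((\<lambda>V. convex hull V) ` K')"
      proof (cases "z \<in> P")
        case True
        then show ?thesis unfolding K'_def using KU by blast
      next
        case zP: False
        let ?I = "{s. y + s *\<^sub>R (x - y) \<in> P}"
        define I where "I = {0..u} \<inter> ?I"
        have "closed ?I"
          by (rule hrep_closed_on_line[OF hrep_triangulation[OF K Rd(1)] Rd(2)]) (use yu(2) Rd in blast)
        then have "compact I" unfolding I_def by (intro compact_Int_closed) auto
        moreover have "0 \<in> I" using yu by (simp add: I_def)
        ultimately obtain s where s: "s \<in> I" "\<And>t. t \<in> I \<Longrightarrow> t \<le> s"
          using compact_attains_sup[of I] by blast
        \<comment> \<open>The last point of \<open>P\<close> on the segment from \<open>y\<close> to
          \<open>z\<close>; it exists because \<open>P\<close> is closed along lines.\<close>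
        define y1 where "y1 = y + s *\<^sub>R (x - y)"
        have y1: "y1 \<in> P" and su: "0 \<le> s" "s < u"
          using s(1) zP yu(1) by (auto simp: I_def y1_def less_le)
        have on: "y1 + t *\<^sub>R (x - y1) = y + (s + t * (1 - s)) *\<^sub>R (x - y)" for t
          by (simp add: y1_def algebra_simps)
        \<comment> \<open>The parameter of \<open>z\<close> on the segment from \<open>y1\<close> to
          \<open>x\<close>. A point of \<open>P\<close> at a parameter up to \<open>r\<close>
          contradicts the choice of \<open>s\<close>; one beyond \<open>r\<close> would put
          \<open>z\<close> into \<open>P\<close> by convexity.\<close>
        define r where "r = (u - s) / (1 - s)"
        have r: "0 < r" "r \<le> 1" "r * (1 - s) = u - s" using su yu(4) by (auto simp: r_def)
        have zr: "z = y1 + r *\<^sub>R (x - y1)" unfolding on using r(3) yu(1) by simp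
        have vis: "visible x P y1" unfolding visible_def
        proof (intro allI impI notI)
          fix t :: real assume t: "0 < t \<and> t \<le> 1" and inP: "y1 + t *\<^sub>R (x - y1) \<in> P"
          show False
          proof (cases "t \<le> r")
            case True
            have "t * (1 - s) \<le> r * (1 - s)" using True su yu(4) by (intro mult_right_mono) auto
            then have "s + t * (1 - s) \<in> I" using inP su t yu(4) r(3) unfolding on I_def by auto
            then have "t * (1 - s) \<le> 0" using s(2) by fastforce
            moreover have "0 < t * (1 - s)" using t su yu(4) by simp
            ultimately show False by simp
          next
            case False
            have "z = (1 - r / t) *\<^sub>R y1 + (r / t) *\<^sub>R (y1 + t *\<^sub>R (x - y1))"
              using t by (simp add: zr algebra_simps)
            moreover have "\<dots> \<in> P"
              using cP y1 inP r t False by (intro convexD) (auto simp: field_simps)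
            ultimately show False using zP by simp
          qed
        qed
        obtain V lam where V: "V \<in> K" "\<forall>v\<in>V. 0 < lam v" "sum lam V = 1" "y1 = (\<Sum>v\<in>V. lam v *\<^sub>R v)"
          using minimal_carrier[OF K y1] by blast
        have "visible x P w" if "w \<in> convex hull V" for w
          by (rule visible_simplex[OF _ cP hP[OF V(1)] _ V(3,4) vis that]) (use V KV in auto)
        then have VN: "V \<in> N" using V(1) by (simp add: N_def)
        have "y1 \<in> convex hull V"
          unfolding V(4) by (rule convex_sum) (use KV[OF V(1)] V(2,3) in \<open>auto intro: hull_inc less_imp_le\<close>)
        then have "z \<in> convex hull (insert x V)"
          using KV[OF V(1)] r unfolding zr by (auto simp: convex_hull_insert_seg intro: less_imp_le)
        then show ?thesis using VN unfolding K'_def by blast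
      qed
    qed
  qed
  have "finite K'" unfolding K'_def N_def using finK by simp
  then have "triangulation K' (convex hull (insert x S))"
    unfolding triangulation_def using aff face Int U by (intro conjI ballI allI impI) auto
  then show ?thesis by blast
qed

lemma triangulation_exists:
  assumes "finite S" "S \<subseteq> Rd d"
  shows "\<exists>K. triangulation K (convex hull S)"
  using assms
proof (induction S)
  case empty
  then show ?case by (intro exI[of _ "{}"]) (simp add: triangulation_def)
next
  case (insert x S)
  then obtain K where K: "triangulation K (convex hull S)" by auto
  show ?case
  proof (cases "S = {}")
    case True
    have "triangulation {{x}} (convex hull {x})" by (auto simp: triangulation_def)
    then show ?thesis using True by blast
  next
    case False
    show ?thesis
    proof (cases "x \<in> convex hull S")
      case True
      then show ?thesis using K by (metis hull_redundant)
    next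
      case nx: False
      show ?thesis
        by (rule triangulation_insert[OF K refl False nx]) (use insert hull_subset_Rd in auto)
    qed
  qed
qed

subsection \<open>Dimension\<close>

lemma card_affine_independent_Rd:
  assumes "finite V" "\<not> affine_dependent V" "V \<subseteq> Rd d"
  shows "card V \<le> d + 1"
proof (cases "V = {}")
  case False
  then obtain a where a: "a \<in> V" by blast
  let ?B = "(\<lambda>x. - a + x) ` (V - {a})"
  have "independent ?B" using assms(2) affine_dependent_iff_dependent2[OF a] by blast
  moreover have "?B \<subseteq> Rd d"
    using assms(3) a subspace_diff[OF subspace_Rd, of _ d a] by auto
  ultimately have "card ?B \<le> d" using independent_Rd_bound by blast
  moreover have "card ?B = card (V - {a})" by (rule card_image) (auto simp: inj_on_def)
  ultimately show ?thesis using a assms(1) by (simp add: card_Diff_singleton_if)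
qed simp

text \<open>The affine hull of \<open>V\<close> has too small a dimension to contain
  \<open>A\<close>. A functional that vanishes on the directions of \<open>V\<close>, but not on
  \<open>a - v\<close> for some \<open>a\<close> of \<open>A\<close> outside the hull, gives
  \<open>l\<close>.\<close>

lemma affine_fun_separating:
  fixes V A :: "'a::real_vector set"
  assumes V: "finite V" "V \<noteq> {}" and A: "finite A" "\<not> affine_dependent A" "card V < card A"
  shows "\<exists>l. affine_fun l \<and> (\<forall>v\<in>V. l v = 0) \<and> (\<exists>a\<in>A. l a \<noteq> 0)"
proof -
  obtain v where v: "v \<in> V" using V by blast
  obtain a0 where a0: "a0 \<in> A" using A(3) by fastforce
  define W where "W = (\<lambda>x. x - v) ` (V - {v})"
  have W: "finite W" "card W < card V"
  proof -
    show "finite W" using V by (simp add: W_def)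
    have "card W \<le> card (V - {v})" unfolding W_def by (rule card_image_le) (use V in simp)
    also have "\<dots> < card V" using v V(1) by (rule card_Diff1_less[rotated])
    finally show "card W < card V" .
  qed
  have "\<exists>a\<in>A. a - v \<notin> span W"
  proof (rule ccontr)
    assume "\<not> ?thesis"
    then have sp: "a - v \<in> span W" if "a \<in> A" for a using that by blast
    let ?B = "(\<lambda>x. - a0 + x) ` (A - {a0})"
    have "independent ?B" using A(2) affine_dependent_iff_dependent2[OF a0] by blast
    moreover have "?B \<subseteq> span W"
    proof
      fix b assume "b \<in> ?B"
      then obtain a where "a \<in> A" "b = (a - v) - (a0 - v)" by auto
      then show "b \<in> span W" using span_diff[OF sp sp] a0 by blast
    qed
    ultimately have "card ?B \<le> card W" using independent_span_bound[OF W(1)] by blast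
    moreover have "card ?B = card (A - {a0})" by (rule card_image) (auto simp: inj_on_def)
    ultimately have "card A - 1 \<le> card W" using a0 A(1) by simp
    then show False using W(2) A(3) by linarith
  qed
  then obtain a where a: "a \<in> A" "a - v \<notin> span W" by blast
  obtain B where B: "B \<subseteq> W" "independent B" "W \<subseteq> span B"
    using maximal_independent_subset[of W] by blast
  have spB: "span B = span W" using B by (metis span_mono span_span subset_antisym)
  have aB: "a - v \<notin> span B" using a(2) spB by simp
  then have anB: "a - v \<notin> B" using span_base by blast
  have "independent (insert (a - v) B)" using independent_insertI[OF aB B(2)] .
  then obtain g where g: "linear g" "\<forall>x\<in>insert (a - v) B. g x = (if x = a - v then 1 else (0::real))"
    using linear_independent_extend[of "insert (a - v) B" "\<lambda>x. if x = a - v then 1 else (0::real)"]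
    by blast
  have g0: "g x = 0" if "x \<in> span B" for x
    by (rule linear_eq_0_on_span[OF g(1) _ that]) (use g(2) anB in auto)
  define l where "l = (\<lambda>x. g x + - g v)"
  have l: "l x = g (x - v)" for x by (simp add: l_def linear_diff[OF g(1)])
  have "l x = 0" if x: "x \<in> V" for x
  proof (cases "x = v")
    case False
    then have "x - v \<in> W" using x unfolding W_def by blast
    then show ?thesis using B(3) g0 l by auto
  qed (simp add: l linear_0[OF g(1)])
  moreover have "l a \<noteq> 0" using g(2) l by simp
  moreover have "affine_fun l" unfolding l_def by (rule affine_funI[OF g(1)])
  ultimately show ?thesis using a(1) by blast
qed

text \<open>A generic point of the moment curve through the given points avoids all proper affine subspaces spanned
  by smaller simplices.\<close>

lemma triangulation_large_simplex:
  assumes K: "triangulation K P" and P: "convex P" and A: "finite A" "A \<subseteq> P" "\<not> affine_dependent A" "A \<noteq> {}"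
  shows "\<exists>V\<in>K. card A \<le> card V"
proof (rule ccontr)
  assume "\<not> ?thesis"
  then have small: "card V < card A" if "V \<in> K" for V using that by force
  note KD = triangulationD[OF K]
  have "\<forall>V\<in>K. \<exists>l. affine_fun l \<and> (\<forall>v\<in>V. l v = 0) \<and> (\<exists>a\<in>A. l a \<noteq> 0)"
    using affine_fun_separating[OF KD(2) KD(3) A(1,3) small] by blast
  then obtain l where l: "\<forall>V\<in>K. affine_fun (l V) \<and> (\<forall>v\<in>V. l V v = 0) \<and> (\<exists>a\<in>A. l V a \<noteq> 0)"
    unfolding bchoice_iff by blast
  obtain f where f: "bij_betw f {0..<card A} A" using ex_bij_betw_nat_finite[OF A(1)] by blast
  define n where "n = card A - 1"
  have "card A = Suc n" using A(1,4) by (simp add: n_def card_gt_0_iff)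
  then have n: "{0..<card A} = {..n}" by auto
  have f: "f ` {..n} = A" using f unfolding n bij_betw_def by blast
  define S where "S = (\<lambda>t::real. \<Sum>i\<le>n. t ^ i)"
  have S: "0 < S t" if "0 < t" for t using that unfolding S_def by (intro sum_pos) auto
  \<comment> \<open>Division by \<open>S t\<close> turns the powers of \<open>t\<close> into convex
    weights. Once it is cleared, the vanishing of \<open>l V\<close> along the curve is a polynomial
    equation in \<open>t\<close> with coefficients \<open>l V (f i)\<close>, not all 0. Each simplex
    thus accounts for finitely many parameters, although together they must account for all positive
    ones.\<close>
  define \<gamma> where "\<gamma> = (\<lambda>t. \<Sum>i\<le>n. (t ^ i / S t) *\<^sub>R f i)"
  have sum1: "(\<Sum>i\<le>n. t ^ i / S t) = 1" if "0 < t" for t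
    using S[OF that] by (simp add: S_def flip: sum_divide_distrib)
  have \<gamma>P: "\<gamma> t \<in> P" if "0 < t" for t
    unfolding \<gamma>_def by (rule convex_sum[OF _ P sum1[OF that]]) (use that S[OF that] f A(2) in auto)
  define Z where "Z = (\<lambda>V. {t. (\<Sum>i\<le>n. l V (f i) * t ^ i) = 0})"
  have "{0<..} \<subseteq> (\<Union>V\<in>K. Z V)"
  proof
    fix t :: real assume "t \<in> {0<..}"
    then have t: "0 < t" by simp
    obtain V where V: "V \<in> K" "\<gamma> t \<in> convex hull V" using \<gamma>P[OF t] KD(7) by blast
    have lV: "affine_fun (l V)" "\<forall>v\<in>V. l V v = 0" using l V(1) by blast+
    obtain u where u: "sum u V = 1" "(\<Sum>v\<in>V. u v *\<^sub>R v) = \<gamma> t"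
      using V(2) unfolding convex_hull_finite[OF KD(2)[OF V(1)]] by blast
    have "l V (\<gamma> t) = (\<Sum>v\<in>V. u v * l V v)"
      using affine_fun_sum[OF lV(1) u(1), of "\<lambda>v. v"] u(2) by simp
    then have "l V (\<gamma> t) = 0" using lV(2) by simp
    moreover have "l V (\<gamma> t) = (\<Sum>i\<le>n. t ^ i / S t * l V (f i))"
      unfolding \<gamma>_def by (rule affine_fun_sum[OF lV(1) sum1[OF t]])
    moreover have "\<dots> = (\<Sum>i\<le>n. l V (f i) * t ^ i) / S t"
      by (simp add: sum_divide_distrib mult.commute)
    ultimately have "(\<Sum>i\<le>n. l V (f i) * t ^ i) = 0" using S[OF t] by simp
    then show "t \<in> (\<Union>V\<in>K. Z V)" using V(1) unfolding Z_def by blast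
  qed
  moreover have "finite (Z V)" if V: "V \<in> K" for V
  proof -
    obtain a where "a \<in> A" "l V a \<noteq> 0" using l V by blast
    then obtain i where "i \<le> n" "l V (f i) \<noteq> 0" using f by blast
    then show ?thesis unfolding Z_def using polyfun_finite_roots[of "\<lambda>i. l V (f i)" n] by blast
  qed
  ultimately have "finite {0::real<..}" using KD(1) finite_subset by blast
  then show False using infinite_Ioi by blast
qed

lemma polyhedron_subset_Rd: "polyhedron P \<Longrightarrow> \<exists>d. P \<subseteq> Rd d"
  unfolding polyhedron_def using hull_subset_Rd by (metis UN_least)

lemma triangulation_card_le:
  assumes "triangulation K P" "P \<subseteq> Rd d" "V \<in> K"
  shows "card V \<le> d + 1"
proof -
  note K = triangulationD[OF assms(1)]
  have "V \<subseteq> Rd d" using K(7) assms(2,3) hull_subset[of V convex] by blast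
  then show ?thesis using card_affine_independent_Rd K(2,4) assms(3) by blast
qed

lemma poly_dim_le:
  assumes "P \<subseteq> Rd d"
  shows "poly_dim P \<le> d"
proof (cases "{card V - 1 | V K. triangulation K P \<and> V \<in> K} = {}")
  case False
  show ?thesis unfolding poly_dim_def
    by (rule cSup_least[OF False]) (use triangulation_card_le[OF _ assms] in fastforce)
next
  case True
  show ?thesis unfolding poly_dim_def True by simp
qed

lemma convex_polyhedron_hull:
  assumes "polyhedron P" "convex P"
  shows "\<exists>S d. finite S \<and> S \<subseteq> Rd d \<and> P = convex hull S"
proof -
  obtain d \<S> where S: "finite \<S>" "\<forall>S\<in>\<S>. finite S \<and> S \<subseteq> Rd d" "P = \<Union>((\<lambda>S. convex hull S) ` \<S>)"
    using assms(1) unfolding polyhedron_def by blast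
  have "P = convex hull (\<Union>\<S>)"
  proof
    show "P \<subseteq> convex hull (\<Union>\<S>)" unfolding S(3) by (intro UN_least hull_mono Union_upper)
    have "S \<subseteq> P" if "S \<in> \<S>" for S using that hull_subset[of S convex] unfolding S(3) by blast
    then show "convex hull (\<Union>\<S>) \<subseteq> P" by (intro hull_minimal assms(2) Union_least)
  qed
  then show ?thesis using S by (intro exI[of _ "\<Union>\<S>"] exI[of _ d]) auto
qed

text \<open>All triangulations live in one \<open>Rd d\<close>, so the supremum is taken over a
  bounded set, and a large simplex in a single triangulation bounds it from below.\<close>

lemma card_le_poly_dim:
  assumes "polyhedron P" "convex P" and A: "finite A" "A \<subseteq> P" "\<not> affine_dependent A"
  shows "card A \<le> poly_dim P + 1"
proof (cases "A = {}")
  case False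
  obtain S d where S: "finite S" "S \<subseteq> Rd d" "P = convex hull S" using convex_polyhedron_hull assms by blast
  obtain K where K: "triangulation K P" using triangulation_exists[OF S(1,2)] S(3) by blast
  obtain V where V: "V \<in> K" "card A \<le> card V"
    using triangulation_large_simplex[OF K assms(2) A False] by blast
  let ?D = "{card V - 1 | V K. triangulation K P \<and> V \<in> K}"
  have "P \<subseteq> Rd d" using hull_subset_Rd S by simp
  then have "bdd_above ?D" using triangulation_card_le by (intro bdd_aboveI[of _ d]) fastforce
  moreover have "card V - 1 \<in> ?D" using K V(1) by blast
  ultimately have "card V - 1 \<le> poly_dim P" unfolding poly_dim_def by (rule cSup_upper[rotated])
  then show ?thesis using V(2) by linarith
qed simp

subsection \<open>Operations on polyhedra\<close>

lemma polyhedron_empty: "polyhedron {}"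
  unfolding polyhedron_def by (intro exI[of _ 0] exI[of _ "{}"]) simp

lemma polyhedron_convex_hull: "finite S \<Longrightarrow> S \<subseteq> Rd d \<Longrightarrow> polyhedron (convex hull S)"
  unfolding polyhedron_def by (intro exI[of _ d] exI[of _ "{S}"]) simp

lemma polyhedron_Un:
  assumes "polyhedron P" "polyhedron Q"
  shows "polyhedron (P \<union> Q)"
proof -
  obtain d \<S> where S: "finite \<S>" "\<forall>S\<in>\<S>. finite S \<and> S \<subseteq> Rd d" "P = \<Union>((\<lambda>S. convex hull S) ` \<S>)"
    using assms(1) unfolding polyhedron_def by blast
  obtain e \<T> where T: "finite \<T>" "\<forall>S\<in>\<T>. finite S \<and> S \<subseteq> Rd e" "Q = \<Union>((\<lambda>S. convex hull S) ` \<T>)"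
    using assms(2) unfolding polyhedron_def by blast
  have "S \<subseteq> Rd (max d e)" if "S \<in> \<S> \<union> \<T>" for S
    using that S(2) T(2) Rd_mono[of d "max d e"] Rd_mono[of e "max d e"] by (auto 4 4)
  then show ?thesis unfolding polyhedron_def
    using S T by (intro exI[of _ "max d e"] exI[of _ "\<S> \<union> \<T>"]) auto
qed

lemma polyhedron_UN: "finite I \<Longrightarrow> (\<And>i. i \<in> I \<Longrightarrow> polyhedron (f i)) \<Longrightarrow> polyhedron (\<Union>i\<in>I. f i)"
  by (induction I rule: finite_induct) (auto intro: polyhedron_empty polyhedron_Un)

text \<open>The new vertices are the intersections of the hyperplane with the edges it crosses.\<close>

lemma convex_hull_Int_halfspace:
  fixes S :: "'a::real_vector set"
  assumes S: "finite S" and l: "affine_fun l"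
  shows "\<exists>T. finite T \<and> convex hull S \<inter> {x. 0 \<le> l x} = convex hull T"
proof -
  define Sp where "Sp = {v\<in>S. 0 \<le> l v}"
  define Sn where "Sn = {v\<in>S. l v < 0}"
  \<comment> \<open>The point where \<open>l\<close> vanishes on the edge from \<open>v\<close> to
    \<open>w\<close>.\<close>
  define e where "e = (\<lambda>(v, w). (- l w / (l v - l w)) *\<^sub>R v + (l v / (l v - l w)) *\<^sub>R w)"
  define T where "T = Sp \<union> e ` (Sp \<times> Sn)"
  have fin: "finite Sp" "finite Sn" using S by (auto simp: Sp_def Sn_def)
  have c: "0 \<le> - l w / (l v - l w)" "0 \<le> l v / (l v - l w)" "- l w / (l v - l w) + l v / (l v - l w) = 1"
    if "v \<in> Sp" "w \<in> Sn" for v w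
  proof -
    have vw: "0 \<le> l v" "l w < 0" using that by (auto simp: Sp_def Sn_def)
    show "0 \<le> - l w / (l v - l w)" "0 \<le> l v / (l v - l w)"
      by (rule divide_nonneg_nonneg; use vw in linarith)+
    have "- l w / (l v - l w) + l v / (l v - l w) = (- l w + l v) / (l v - l w)"
      by (rule add_divide_distrib[symmetric])
    then show "- l w / (l v - l w) + l v / (l v - l w) = 1" using vw by simp
  qed
  have "convex hull T \<subseteq> convex hull S \<inter> {x. 0 \<le> l x}"
  proof (rule hull_minimal)
    have "convex {x. \<forall>l'\<in>{l}. 0 \<le> l' x}" by (rule convex_affine_nonneg) (use l in blast)
    then show "convex (convex hull S \<inter> {x. 0 \<le> l x})" by (intro convex_Int) auto
    show "T \<subseteq> convex hull S \<inter> {x. 0 \<le> l x}"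
    proof
      fix x assume "x \<in> T"
      then consider "x \<in> Sp" | v w where "v \<in> Sp" "w \<in> Sn" "x = e (v, w)" unfolding T_def by auto
      then show "x \<in> convex hull S \<inter> {x. 0 \<le> l x}"
      proof cases
        case 1
        then show ?thesis using hull_subset[of S convex] by (auto simp: Sp_def)
      next
        case 2
        have "v \<in> convex hull S" "w \<in> convex hull S"
          using 2 hull_subset[of S convex] by (auto simp: Sp_def Sn_def)
        then have "x \<in> convex hull S" unfolding 2(3) e_def prod.case
          using c[OF 2(1,2)] by (intro convexD convex_convex_hull)
        moreover have "l x = 0"
          unfolding 2(3) e_def prod.case affine_fun_comb[OF l c(3)[OF 2(1,2)]] by simp
        ultimately show ?thesis by simp
      qed
    qed
  qed
  moreover have "convex hull S \<inter> {x. 0 \<le> l x} \<subseteq> convex hull T"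
  proof
    fix x assume x: "x \<in> convex hull S \<inter> {x. 0 \<le> l x}"
    obtain u where u: "\<forall>v\<in>S. 0 \<le> u v" "sum u S = 1" "(\<Sum>v\<in>S. u v *\<^sub>R v) = x"
      using x unfolding convex_hull_finite[OF S] by blast
    have split: "sum h S = sum h Sp + sum h Sn" for h :: "'a \<Rightarrow> 'b::comm_monoid_add"
    proof -
      have "S = Sp \<union> Sn" "Sp \<inter> Sn = {}" by (auto simp: Sp_def Sn_def)
      then show ?thesis using sum.union_disjoint[OF fin] by metis
    qed
    \<comment> \<open>The positive part and, in the next line, the negative part of
      \<open>l x\<close>; the hypothesis \<open>0 \<le> l x\<close> becomes
      \<open>B \<le> A\<close>.\<close>
    define A where "A = (\<Sum>v\<in>Sp. u v * l v)"
    define B where "B = (\<Sum>w\<in>Sn. u w * - l w)"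
    have "l x = (\<Sum>v\<in>S. u v * l v)" using affine_fun_sum[OF l u(2), of "\<lambda>v. v"] u(3) by simp
    also have "\<dots> = A - B" by (simp add: split A_def B_def sum_negf)
    finally have AB: "B \<le> A" using x by simp
    have Bt: "0 \<le> u w * - l w" if "w \<in> Sn" for w
      using u(1) that by (intro mult_nonneg_nonneg) (auto simp: Sn_def)
    then have B0: "0 \<le> B" unfolding B_def by (rule sum_nonneg)
    show "x \<in> convex hull T"
    proof (cases "A = 0")
      case True
      then have "B = 0" using AB B0 by simp
      then have "u w * - l w = 0" if "w \<in> Sn" for w
        using sum_nonneg_eq_0_iff[OF fin(2), of "\<lambda>w. u w * - l w"] Bt that unfolding B_def by blast
      then have un: "u w = 0" if "w \<in> Sn" for w using that by (fastforce simp: Sn_def)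
      have "sum u Sp = 1" "(\<Sum>v\<in>Sp. u v *\<^sub>R v) = x"
        using u(2,3) un unfolding split by simp_all
      then have "x \<in> convex hull Sp" unfolding convex_hull_finite[OF fin(1)]
        using u(1) by (intro CollectI exI[of _ u]) (auto simp: Sp_def)
      then show ?thesis using hull_mono[of Sp T convex] by (auto simp: T_def)
    next
      case False
      then have A: "0 < A" using AB B0 by simp
      \<comment> \<open>The share of the edge points at \<open>w\<close>, summed over
        \<open>v\<close>, restores exactly \<open>u w\<close>. Their share at \<open>v\<close>,
        summed over \<open>w\<close>, uses up \<open>B / A * u v\<close>, so the vertex
        \<open>v\<close> itself keeps \<open>(1 - B / A) * u v\<close>.\<close>
      define a where "a = case_sum (\<lambda>v. (1 - B / A) * u v) (\<lambda>(v, w). u v * u w * (l v - l w) / A)"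
      define y where "y = case_sum (\<lambda>v. v) e"
      let ?I = "Sp <+> (Sp \<times> Sn)"
      have prodsum: "(\<Sum>p\<in>Sp \<times> Sn. h p) = (\<Sum>v\<in>Sp. \<Sum>w\<in>Sn. h (v, w))" for h :: "'a \<times> 'a \<Rightarrow> 'b::comm_monoid_add"
        by (simp add: sum.cartesian_product)
      have "sum a ?I = (1 - B / A) * sum u Sp + (\<Sum>v\<in>Sp. \<Sum>w\<in>Sn. u v * u w * (l v - l w) / A)"
        using fin by (simp add: sum.Plus a_def prodsum sum_distrib_left)
      also have "(\<Sum>v\<in>Sp. \<Sum>w\<in>Sn. u v * u w * (l v - l w) / A)
          = (\<Sum>v\<in>Sp. \<Sum>w\<in>Sn. (u v * l v) * (u w / A)) + (\<Sum>v\<in>Sp. \<Sum>w\<in>Sn. (u v / A) * (u w * - l w))"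
        by (simp add: algebra_simps diff_divide_distrib flip: sum.distrib)
      also have "\<dots> = A * (sum u Sn / A) + (sum u Sp / A) * B"
        by (simp only: A_def B_def sum_divide_distrib sum_product)
      finally have "sum a ?I = sum u Sp + sum u Sn" using A by (simp add: algebra_simps)
      then have a1: "sum a ?I = 1" using u(2) split[of u] by simp
      have "(\<Sum>i\<in>?I. a i *\<^sub>R y i)
        = (\<Sum>v\<in>Sp. ((1 - B / A) * u v) *\<^sub>R v) + (\<Sum>v\<in>Sp. \<Sum>w\<in>Sn. (u v * u w * (l v - l w) / A) *\<^sub>R e (v, w))"
        using fin by (simp add: sum.Plus a_def y_def prodsum)
      also have "(\<Sum>v\<in>Sp. \<Sum>w\<in>Sn. (u v * u w * (l v - l w) / A) *\<^sub>R e (v, w))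
         = (\<Sum>v\<in>Sp. \<Sum>w\<in>Sn. ((u w * - l w) * (u v / A)) *\<^sub>R v) + (\<Sum>v\<in>Sp. \<Sum>w\<in>Sn. ((u v * l v) * (u w / A)) *\<^sub>R w)"
      proof -
        have "(u v * u w * (l v - l w) / A) *\<^sub>R e (v, w)
          = ((u w * - l w) * (u v / A)) *\<^sub>R v + ((u v * l v) * (u w / A)) *\<^sub>R w"
          if "v \<in> Sp" "w \<in> Sn" for v w
        proof -
          have "l v - l w \<noteq> 0" using that by (auto simp: Sp_def Sn_def)
          then show ?thesis unfolding e_def prod.case scaleR_add_right scaleR_scaleR by (simp add: mult_ac)
        qed
        then show ?thesis unfolding sum.distrib[symmetric] by (intro sum.cong) auto
      qed
      also have "(\<Sum>v\<in>Sp. \<Sum>w\<in>Sn. ((u w * - l w) * (u v / A)) *\<^sub>R v) = (\<Sum>v\<in>Sp. (B / A * u v) *\<^sub>R v)"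
      proof (rule sum.cong[OF refl])
        fix v
        have "(\<Sum>w\<in>Sn. ((u w * - l w) * (u v / A)) *\<^sub>R v) = (B * (u v / A)) *\<^sub>R v"
          unfolding B_def sum_distrib_right scaleR_sum_left ..
        then show "(\<Sum>w\<in>Sn. ((u w * - l w) * (u v / A)) *\<^sub>R v) = (B / A * u v) *\<^sub>R v" by simp
      qed
      also have "(\<Sum>v\<in>Sp. \<Sum>w\<in>Sn. ((u v * l v) * (u w / A)) *\<^sub>R w) = (\<Sum>w\<in>Sn. u w *\<^sub>R w)"
      proof (subst sum.swap, rule sum.cong[OF refl])
        fix w
        have "(\<Sum>v\<in>Sp. ((u v * l v) * (u w / A)) *\<^sub>R w) = (A * (u w / A)) *\<^sub>R w"
          unfolding A_def sum_distrib_right scaleR_sum_left ..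
        then show "(\<Sum>v\<in>Sp. ((u v * l v) * (u w / A)) *\<^sub>R w) = u w *\<^sub>R w" using False by simp
      qed
      also have "(\<Sum>v\<in>Sp. ((1 - B / A) * u v) *\<^sub>R v) + ((\<Sum>v\<in>Sp. (B / A * u v) *\<^sub>R v) + (\<Sum>w\<in>Sn. u w *\<^sub>R w))
         = (\<Sum>v\<in>Sp. u v *\<^sub>R v) + (\<Sum>w\<in>Sn. u w *\<^sub>R w)"
        by (simp add: left_diff_distrib scaleR_diff_left sum_subtractf)
      finally have xe: "(\<Sum>i\<in>?I. a i *\<^sub>R y i) = x" using u(3) split[of "\<lambda>v. u v *\<^sub>R v"] by simp
      have "(\<Sum>i\<in>?I. a i *\<^sub>R y i) \<in> convex hull T"
      proof (rule convex_sum[OF _ convex_convex_hull a1])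
        show "finite ?I" using fin by simp
        fix i assume i: "i \<in> ?I"
        show "y i \<in> convex hull T"
          using i by (auto simp: y_def T_def intro!: hull_inc)
        have "0 \<le> (1 - B / A) * u v" if "v \<in> Sp" for v
          using that u(1) A AB by (intro mult_nonneg_nonneg) (auto simp: Sp_def)
        moreover have "0 \<le> u v * u w * (l v - l w) / A" if "v \<in> Sp" "w \<in> Sn" for v w
          using that u(1) A by (intro divide_nonneg_nonneg mult_nonneg_nonneg) (auto simp: Sp_def Sn_def)
        ultimately show "0 \<le> a i" using i by (auto simp: a_def)
      qed
      then show ?thesis using xe by simp
    qed
  qed
  ultimately show ?thesis using fin by (intro exI[of _ T]) (auto simp: T_def)
qed

lemma polyhedron_Int_halfspace:
  assumes "polyhedron P" "affine_fun l"
  shows "polyhedron (P \<inter> {x. 0 \<le> l x})"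
proof -
  obtain d \<S> where S: "finite \<S>" "\<forall>S\<in>\<S>. finite S \<and> S \<subseteq> Rd d" "P = \<Union>((\<lambda>S. convex hull S) ` \<S>)"
    using assms(1) unfolding polyhedron_def by blast
  have "polyhedron (convex hull S \<inter> {x. 0 \<le> l x})" if "S \<in> \<S>" for S
  proof -
    have "finite S" using S(2) that by blast
    then obtain T where T: "finite T" "convex hull S \<inter> {x. 0 \<le> l x} = convex hull T"
      using convex_hull_Int_halfspace[OF _ assms(2), of S] by auto
    have "T \<subseteq> convex hull S" using T(2) hull_subset[of T convex] by blast
    then have "T \<subseteq> Rd d" using hull_subset_Rd S(2) that by blast
    then show ?thesis using T polyhedron_convex_hull by simp
  qed
  then have "polyhedron (\<Union>S\<in>\<S>. convex hull S \<inter> {x. 0 \<le> l x})" using S(1) by (intro polyhedron_UN)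
  moreover have "P \<inter> {x. 0 \<le> l x} = (\<Union>S\<in>\<S>. convex hull S \<inter> {x. 0 \<le> l x})" using S(3) by blast
  ultimately show ?thesis by simp
qed

text \<open>A common \<open>d\<close> for both sets lets the inequalities of \<open>Q\<close> be
  tested at every point of \<open>P\<close>.\<close>

lemma hrep_polyhedron:
  assumes "polyhedron Q" "P \<subseteq> Rd e"
  shows "\<exists>d. P \<subseteq> Rd d \<and> Q \<subseteq> Rd d \<and> hrep d Q"
proof -
  obtain d0 \<S> where S: "finite \<S>" "\<forall>S\<in>\<S>. finite S \<and> S \<subseteq> Rd d0" "Q = \<Union>((\<lambda>S. convex hull S) ` \<S>)"
    using assms(1) unfolding polyhedron_def by blast
  define d where "d = max d0 e"
  have d: "S \<subseteq> Rd d" if "S \<in> \<S>" for S using that S(2) Rd_mono[of d0 d] by (fastforce simp: d_def)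
  have "hrep d Q" unfolding S(3)
  proof (rule hrep_UN[OF S(1)])
    fix S assume "S \<in> \<S>"
    then obtain K where "triangulation K (convex hull S)" using triangulation_exists S(2) by blast
    then show "hrep d (convex hull S)" by (rule hrep_triangulation) (use hull_subset_Rd d \<open>S \<in> \<S>\<close> in blast)
  qed
  moreover have "Q \<subseteq> Rd d" unfolding S(3) using hull_subset_Rd d by blast
  moreover have "P \<subseteq> Rd d" using assms(2) Rd_mono[of e d] by (auto simp: d_def)
  ultimately show ?thesis by blast
qed


subsection \<open>The poset of sign cells\<close>

definition sgn_le :: "('a \<Rightarrow> real) list \<Rightarrow> 'a \<Rightarrow> 'a \<Rightarrow> bool" where
  "sgn_le L x y \<longleftrightarrow> (\<forall>l\<in>set L. l x \<noteq> 0 \<longrightarrow> sgn (l y) = sgn (l x))"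

text \<open>Sign vectors are coded as numbers because the frames of \<open>kvalid\<close> live on
  sets of naturals.\<close>

definition sgn_code :: "('a \<Rightarrow> real) list \<Rightarrow> 'a \<Rightarrow> nat" where
  "sgn_code L x = list_encode (map (\<lambda>l. if l x < 0 then 0 else if l x = 0 then 1 else 2) L)"

definition cells :: "('a \<Rightarrow> real) list \<Rightarrow> 'a set \<Rightarrow> nat set" where
  "cells L P = sgn_code L ` P"

text \<open>Stated through representatives in \<open>P\<close>; \<open>cell_le_iff\<close> shows
  that their choice does not matter.\<close>

definition cell_le :: "('a \<Rightarrow> real) list \<Rightarrow> 'a set \<Rightarrow> nat \<Rightarrow> nat \<Rightarrow> bool" where
  "cell_le L P u w \<longleftrightarrow> (\<exists>x\<in>P. \<exists>y\<in>P. u = sgn_code L x \<and> w = sgn_code L y \<and> sgn_le L x y)"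

lemma sgn_code_eq_iff: "sgn_code L x = sgn_code L y \<longleftrightarrow> (\<forall>l\<in>set L. sgn (l x) = sgn (l y))"
proof -
  have "(if a < 0 then 0 else if a = 0 then 1 else 2) = (if b < 0 then 0 else if b = 0 then 1 else (2::nat))
     \<longleftrightarrow> sgn a = sgn b" for a b :: real
    by (auto simp: sgn_if)
  then show ?thesis unfolding sgn_code_def list_encode_eq by simp
qed

lemma sgn_le_refl [simp]: "sgn_le L x x"
  by (simp add: sgn_le_def)

lemma sgn_le_trans: "sgn_le L x y \<Longrightarrow> sgn_le L y z \<Longrightarrow> sgn_le L x z"
  unfolding sgn_le_def by (metis sgn_0_0)

lemma sgn_le_antisym: "sgn_le L x y \<Longrightarrow> sgn_le L y x \<Longrightarrow> sgn_code L x = sgn_code L y"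
  unfolding sgn_le_def sgn_code_eq_iff by (metis sgn_0_0)

lemma sgn_le_if_code_eq: "sgn_code L x = sgn_code L y \<Longrightarrow> sgn_le L x y"
  unfolding sgn_le_def sgn_code_eq_iff by simp

lemma cell_le_iff:
  assumes "x \<in> P" "y \<in> P"
  shows "cell_le L P (sgn_code L x) (sgn_code L y) \<longleftrightarrow> sgn_le L x y"
proof
  assume "cell_le L P (sgn_code L x) (sgn_code L y)"
  then obtain x' y' where "sgn_code L x = sgn_code L x'" "sgn_code L y' = sgn_code L y" "sgn_le L x' y'"
    unfolding cell_le_def by metis
  then show "sgn_le L x y" using sgn_le_trans sgn_le_if_code_eq by metis
qed (use assms in \<open>auto simp: cell_le_def\<close>)

lemma poset_cells: "poset (cells L P) (cell_le L P)"
  unfolding poset_def cells_def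
proof (intro conjI ballI impI)
  fix u v w assume "u \<in> sgn_code L ` P" "v \<in> sgn_code L ` P" "w \<in> sgn_code L ` P"
    and *: "cell_le L P u v \<and> cell_le L P v w"
  then obtain x y z where "x \<in> P" "y \<in> P" "z \<in> P" "u = sgn_code L x" "v = sgn_code L y" "w = sgn_code L z"
    by blast
  then show "cell_le L P u w" using * sgn_le_trans[of L x y z] by (simp add: cell_le_iff)
next
  fix u v assume "u \<in> sgn_code L ` P" "v \<in> sgn_code L ` P"
    and *: "cell_le L P u v \<and> cell_le L P v u"
  then obtain x y where "x \<in> P" "y \<in> P" "u = sgn_code L x" "v = sgn_code L y"
    by blast
  then show "u = v" using * sgn_le_antisym[of L x y] by (simp add: cell_le_iff)
qed (auto simp: cell_le_iff)

lemma finite_cells: "finite (cells L P)"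
proof -
  have "cells L P \<subseteq> list_encode ` {xs. set xs \<subseteq> {0,1,2} \<and> length xs = length L}"
    unfolding cells_def sgn_code_def by auto
  then show ?thesis by (rule finite_subset) (simp add: finite_lists_length_eq)
qed

lemma sgn_convex_comb:
  fixes a b t :: real
  assumes "a \<noteq> 0 \<longrightarrow> sgn b = sgn a" "0 < t" "t \<le> 1"
  shows "sgn ((1 - t) * a + t * b) = sgn b"
proof (cases "a = 0")
  case True
  then show ?thesis using assms by (simp add: sgn_mult)
next
  case False
  then have s: "sgn b = sgn a" using assms by simp
  show ?thesis
  proof (cases "a > 0")
    case True
    then have "b > 0" using s by (metis sgn_1_pos sgn_pos)
    then have "(1 - t) * a + t * b > 0" using True assms by (intro add_nonneg_pos) auto
    then show ?thesis using \<open>b > 0\<close> by simp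
  next
    case neg: False
    then have an: "a < 0" using False by simp
    then have "b < 0" using s by (metis sgn_1_neg sgn_neg)
    have "(1 - t) * a \<le> 0" using an assms by (intro mult_nonneg_nonpos) auto
    moreover have "t * b < 0" using \<open>b < 0\<close> assms by (simp add: mult_pos_neg)
    ultimately have "(1 - t) * a + t * b < 0" by simp
    then show ?thesis using \<open>b < 0\<close> by simp
  qed
qed

lemma sgn_code_segment:
  assumes L: "\<forall>l\<in>set L. affine_fun l" and "sgn_le L x y" "0 < t" "t \<le> 1"
  shows "sgn_code L (x + t *\<^sub>R (y - x)) = sgn_code L y"
  unfolding sgn_code_eq_iff
proof
  fix l assume l: "l \<in> set L"
  show "sgn (l (x + t *\<^sub>R (y - x))) = sgn (l y)"
    using L l assms unfolding sgn_le_def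
    by (simp add: affine_fun_segment sgn_convex_comb)
qed

lemma upset_cell_le:
  assumes "upset (cells L P) (cell_le L P) U" "x \<in> P" "y \<in> P" "sgn_le L x y" "sgn_code L x \<in> U"
  shows "sgn_code L y \<in> U"
  using upsetD[OF assms(1,5), of "sgn_code L y"] assms(2-4) by (simp add: cells_def cell_le_iff)

text \<open>Each strict sign condition at \<open>q\<close> relaxes to a weak inequality and each
  zero condition to a pair of opposite ones, so half-spaces are cut off one function at a
  time.\<close>

lemma polyhedron_closed_cell:
  assumes "polyhedron P" "\<forall>l\<in>set L. affine_fun l"
  shows "polyhedron {x\<in>P. sgn_le L x q}"
  using assms(2)
proof (induction L)
  case Nil
  then show ?case using assms(1) by (simp add: sgn_le_def)
next
  case (Cons l L)
  let ?Q = "{x\<in>P. sgn_le L x q}"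
  have Q: "polyhedron ?Q" and l: "affine_fun l" using Cons by auto
  have pos: "polyhedron (?Q \<inter> {x. 0 \<le> l x})" by (rule polyhedron_Int_halfspace[OF Q l])
  have neg: "polyhedron (X \<inter> {x. 0 \<le> - l x})" if "polyhedron X" for X
    by (rule polyhedron_Int_halfspace[OF that affine_fun_uminus[OF l]])
  have eq: "sgn_le (l # L) x q \<longleftrightarrow> (l x \<noteq> 0 \<longrightarrow> sgn (l q) = sgn (l x)) \<and> sgn_le L x q" for x
    by (auto simp: sgn_le_def)
  consider "l q > 0" | "l q < 0" | "l q = 0" by linarith
  then show ?case
  proof cases
    case 1
    then have "{x\<in>P. sgn_le (l # L) x q} = ?Q \<inter> {x. 0 \<le> l x}"
      unfolding eq by (auto simp: sgn_if split: if_splits)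
    then show ?thesis using pos by simp
  next
    case 2
    then have "{x\<in>P. sgn_le (l # L) x q} = ?Q \<inter> {x. 0 \<le> - l x}"
      unfolding eq by (auto simp: sgn_if split: if_splits)
    then show ?thesis using neg[OF Q] by simp
  next
    case 3
    then have "{x\<in>P. sgn_le (l # L) x q} = ?Q \<inter> {x. 0 \<le> l x} \<inter> {x. 0 \<le> - l x}"
      unfolding eq by (auto simp: sgn_if split: if_splits)
    then show ?thesis using neg[OF pos] by simp
  qed
qed

text \<open>The complement is the union of the closed cells spanned by representatives
  \<open>r w\<close> of the finitely many codes outside \<open>U\<close>. Since \<open>U\<close> is
  an upset, these closed cells contain no point with code in \<open>U\<close>.\<close>

lemma upset_cells_in_Sub_o:
  assumes P: "polyhedron P" and L: "\<forall>l\<in>set L. affine_fun l" and U: "upset (cells L P) (cell_le L P) U"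
  shows "{x\<in>P. sgn_code L x \<in> U} \<in> Sub_o P"
proof -
  let ?D = "cells L P - U"
  define r where "r = (\<lambda>w. SOME x. x \<in> P \<and> sgn_code L x = w)"
  have r: "r w \<in> P \<and> sgn_code L (r w) = w" if "w \<in> cells L P" for w
  proof -
    have "\<exists>x. x \<in> P \<and> sgn_code L x = w" using that unfolding cells_def by blast
    then show ?thesis unfolding r_def by (rule someI_ex)
  qed
  let ?Q = "\<Union>w\<in>?D. {x\<in>P. sgn_le L x (r w)}"
  have poly: "polyhedron ?Q"
    using finite_cells by (intro polyhedron_UN polyhedron_closed_cell[OF P L]) auto
  have mem: "x \<in> ?Q \<longleftrightarrow> sgn_code L x \<notin> U" if x: "x \<in> P" for x
  proof
    assume "x \<in> ?Q"
    then obtain w where w: "w \<in> cells L P" "w \<notin> U" "sgn_le L x (r w)" by blast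
    then show "sgn_code L x \<notin> U" using upset_cell_le[OF U x _ w(3)] r[OF w(1)] by auto
  next
    assume nU: "sgn_code L x \<notin> U"
    have D: "sgn_code L x \<in> cells L P" using x by (simp add: cells_def)
    then have "sgn_le L x (r (sgn_code L x))" using r[OF D] by (intro sgn_le_if_code_eq) simp
    then show "x \<in> ?Q" using D nU x by blast
  qed
  have "{x\<in>P. sgn_code L x \<in> U} = P - ?Q" using mem by auto
  then show ?thesis unfolding Sub_o_def using poly by blast
qed

text \<open>Only implication is at stake. One inclusion holds because the points forcing
  \<open>Imp a b\<close> themselves form an open subpolyhedron. For the other, a point of a
  competing open subpolyhedron is moved a little towards a point of a higher cell: it enters that
  cell at once and has not yet left the open set.\<close>

lemma heval_cells:
  assumes P: "polyhedron P" "convex P" and L: "\<forall>l\<in>set L. affine_fun l"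
    and V: "\<And>p. upset (cells L P) (cell_le L P) (V p)"
    and v: "\<And>p. p \<in> vars a \<Longrightarrow> v p = {x\<in>P. sgn_code L x \<in> V p}"
  shows "heval P v a = {x\<in>P. kforces (cells L P) (cell_le L P) V (sgn_code L x) a}"
  using v
proof (induction a)
  case (Imp a b)
  let ?W = "cells L P" and ?R = "cell_le L P"
  let ?U = "{w\<in>?W. kforces ?W ?R V w (Imp a b)}"
  have a: "heval P v a = {x\<in>P. kforces ?W ?R V (sgn_code L x) a}"
    and b: "heval P v b = {x\<in>P. kforces ?W ?R V (sgn_code L x) b}"
    using Imp by auto
  have W: "sgn_code L x \<in> ?W" if "x \<in> P" for x using that by (simp add: cells_def)
  have up: "upset ?W ?R ?U" by (rule upset_forced[OF poset_cells V])
  let ?C = "{x\<in>P. sgn_code L x \<in> ?U}"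
  show ?case
  proof
    have "?C \<in> Sub_o P" by (rule upset_cells_in_Sub_o[OF P(1) L up])
    moreover have "?C \<inter> heval P v a \<subseteq> heval P v b"
    proof
      fix x assume x: "x \<in> ?C \<inter> heval P v a"
      then have "x \<in> P" "kforces ?W ?R V (sgn_code L x) (Imp a b)" "kforces ?W ?R V (sgn_code L x) a"
        unfolding a by auto
      then have "kforces ?W ?R V (sgn_code L x) b"
        using W[of x] poset_refl[OF poset_cells W[of x]] by simp
      then show "x \<in> heval P v b" using \<open>x \<in> P\<close> unfolding b by simp
    qed
    ultimately have "?C \<subseteq> heval P v (Imp a b)" by auto
    then show "{x\<in>P. kforces ?W ?R V (sgn_code L x) (Imp a b)} \<subseteq> heval P v (Imp a b)"
      using W by auto
  next
    show "heval P v (Imp a b) \<subseteq> {x\<in>P. kforces ?W ?R V (sgn_code L x) (Imp a b)}"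
    proof
      fix x assume "x \<in> heval P v (Imp a b)"
      then obtain c where c: "c \<in> Sub_o P" "c \<inter> heval P v a \<subseteq> heval P v b" "x \<in> c" by auto
      then obtain Q where Q: "c = P - Q" "polyhedron Q" unfolding Sub_o_def by blast
      have x: "x \<in> P" "x \<notin> Q" using c(3) Q by auto
      have "kforces ?W ?R V w b" if w: "w \<in> ?W" "?R (sgn_code L x) w" "kforces ?W ?R V w a" for w
      proof -
        obtain y where y: "y \<in> P" "w = sgn_code L y" using w(1) unfolding cells_def by blast
        have xy: "sgn_le L x y" using w(2) x(1) y by (simp add: cell_le_iff)
        obtain e where "P \<subseteq> Rd e" using polyhedron_subset_Rd[OF P(1)] by blast
        then obtain d where d: "P \<subseteq> Rd d" "hrep d Q" using hrep_polyhedron[OF Q(2)] by blast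
        have "closed {s. x + s *\<^sub>R (y - x) \<in> Q}"
          by (rule hrep_closed_on_line[OF d(2)]) (use d(1) x y in auto)
        then have "open (- {s. x + s *\<^sub>R (y - x) \<in> Q})" by (rule open_Compl)
        moreover have "0 \<in> - {s. x + s *\<^sub>R (y - x) \<in> Q}" using x by simp
        ultimately obtain \<epsilon> where e: "0 < \<epsilon>" "ball 0 \<epsilon> \<subseteq> - {s. x + s *\<^sub>R (y - x) \<in> Q}"
          using open_contains_ball by blast
        define t where "t = min 1 (\<epsilon> / 2)"
        have t: "0 < t" "t \<le> 1" "t \<in> ball 0 \<epsilon>" using e(1) by (auto simp: t_def)
        define z where "z = x + t *\<^sub>R (y - x)"
        have "z = (1 - t) *\<^sub>R x + t *\<^sub>R y" by (simp add: z_def algebra_simps)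
        then have "z \<in> P" using P(2) x y t by (auto intro: convexD)
        moreover have "z \<notin> Q" using e(2) t(3) unfolding z_def by blast
        moreover have zw: "sgn_code L z = w"
          unfolding z_def y(2) by (rule sgn_code_segment[OF L xy t(1,2)])
        ultimately have "z \<in> c \<inter> heval P v a" using Q(1) w(3) unfolding a by simp
        then have "z \<in> heval P v b" using c(2) by blast
        then show ?thesis using zw unfolding b by simp
      qed
      then show "x \<in> {x\<in>P. kforces ?W ?R V (sgn_code L x) (Imp a b)}" using x by simp
    qed
  qed
qed auto

text \<open>\<open>L0\<close> lists the functions in an inequality description of the removed
  polyhedron \<open>Q\<close>. If such a function is nonnegative at \<open>y\<close>, it is
  nonnegative at every \<open>x\<close> with \<open>sgn_le L x y\<close>, because a negative sign at
  \<open>x\<close> would persist at \<open>y\<close>. Hence \<open>Q\<close> meets \<open>P\<close>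
  in a downward closed union of cells, for every list extending \<open>L0\<close>.\<close>

lemma Sub_o_cells:
  assumes P: "P \<subseteq> Rd e" and c: "c \<in> Sub_o P"
  shows "\<exists>L0. (\<forall>l\<in>set L0. affine_fun l) \<and> (\<forall>L. set L0 \<subseteq> set L \<longrightarrow>
    upset (cells L P) (cell_le L P) (sgn_code L ` c) \<and> c = {x\<in>P. sgn_code L x \<in> sgn_code L ` c})"
proof -
  obtain Q where Q: "c = P - Q" "polyhedron Q" using c unfolding Sub_o_def by blast
  obtain d where d: "P \<subseteq> Rd d" "hrep d Q" using hrep_polyhedron[OF Q(2) P] by blast
  obtain \<A> where A: "finite \<A>" "\<forall>A\<in>\<A>. finite A \<and> (\<forall>l\<in>A. affine_fun l)"
    "\<forall>x\<in>Rd d. x \<in> Q \<longleftrightarrow> (\<exists>A\<in>\<A>. \<forall>l\<in>A. 0 \<le> l x)"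
    using d(2) unfolding hrep_def by blast
  have "finite (\<Union>\<A>)" using A by blast
  then obtain L0 where L0: "set L0 = \<Union>\<A>" using finite_list by blast
  have aff: "\<forall>l\<in>set L0. affine_fun l" using L0 A(2) by blast
  have down: "x \<in> Q" if xy: "set L0 \<subseteq> set L" "x \<in> P" "y \<in> P" "sgn_le L x y" "y \<in> Q" for L x y
  proof -
    have Rd: "x \<in> Rd d" "y \<in> Rd d" using xy(2,3) d(1) by auto
    obtain A where B: "A \<in> \<A>" "\<forall>l\<in>A. 0 \<le> l y"
      using A(3)[rule_format, OF Rd(2)] xy(5) by auto
    have "0 \<le> l x" if l: "l \<in> A" for l
    proof (rule ccontr)
      assume n: "\<not> ?thesis"
      have "l \<in> set L" using l B(1) L0 \<open>set L0 \<subseteq> set L\<close> by blast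
      then have "sgn (l y) = sgn (l x)" using n \<open>sgn_le L x y\<close> unfolding sgn_le_def by force
      then show False using n B(2) l by (auto simp: sgn_if split: if_splits)
    qed
    then show ?thesis using A(3)[rule_format, OF Rd(1)] B(1) by auto
  qed
  show ?thesis
  proof (intro exI[of _ L0] conjI allI impI)
    show "\<forall>l\<in>set L0. affine_fun l" by (rule aff)
    fix L :: "(vec \<Rightarrow> real) list" assume L: "set L0 \<subseteq> set L"
    show "upset (cells L P) (cell_le L P) (sgn_code L ` c)"
    proof (rule upsetI)
      show "sgn_code L ` c \<subseteq> cells L P" using Q(1) by (auto simp: cells_def)
      fix u w assume "u \<in> sgn_code L ` c" "w \<in> cells L P" "cell_le L P u w"
      then obtain x y where xy: "x \<in> c" "y \<in> P" "u = sgn_code L x" "w = sgn_code L y" "cell_le L P u w"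
        unfolding cells_def by blast
      then have "sgn_le L x y" using Q(1) by (simp add: cell_le_iff)
      then have "y \<notin> Q" using down[OF L _ xy(2)] xy(1) Q(1) by blast
      then show "w \<in> sgn_code L ` c" using xy Q(1) by blast
    qed
    show "c = {x\<in>P. sgn_code L x \<in> sgn_code L ` c}"
    proof
      show "c \<subseteq> {x\<in>P. sgn_code L x \<in> sgn_code L ` c}" using Q(1) by blast
      show "{x\<in>P. sgn_code L x \<in> sgn_code L ` c} \<subseteq> c"
      proof
        fix x assume "x \<in> {x\<in>P. sgn_code L x \<in> sgn_code L ` c}"
        then obtain y where y: "x \<in> P" "y \<in> c" "sgn_code L y = sgn_code L x" by auto
        have "x \<notin> Q" using down[OF L _ y(1) sgn_le_if_code_eq[OF y(3)]] y(2) Q(1) by blast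
        then show "x \<in> c" using y(1) Q(1) by blast
      qed
    qed
  qed
qed

text \<open>A formula has finitely many variables, so one list, joining those supplied by
  \<open>Sub_o_cells\<close>, captures a given valuation.\<close>

theorem poly_valid_iff_cells:
  assumes P: "polyhedron P" "convex P"
  shows "poly_valid P a \<longleftrightarrow> (\<forall>L. (\<forall>l\<in>set L. affine_fun l) \<longrightarrow> kvalid (cells L P) (cell_le L P) a)"
proof
  assume val: "poly_valid P a"
  show "\<forall>L. (\<forall>l\<in>set L. affine_fun l) \<longrightarrow> kvalid (cells L P) (cell_le L P) a"
    unfolding kvalid_def
  proof (intro allI impI ballI)
    fix L and V :: "nat \<Rightarrow> nat set" and w
    assume L: "\<forall>l\<in>set L. affine_fun l" and V: "\<forall>p. upset (cells L P) (cell_le L P) (V p)"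
      and w: "w \<in> cells L P"
    define v where "v = (\<lambda>p. {x\<in>P. sgn_code L x \<in> V p})"
    have "\<forall>p. v p \<in> Sub_o P" using upset_cells_in_Sub_o[OF P(1) L] V by (simp add: v_def)
    then have "heval P v a = P" using val by (simp add: poly_valid_def)
    moreover have "heval P v a = {x\<in>P. kforces (cells L P) (cell_le L P) V (sgn_code L x) a}"
      by (rule heval_cells[OF P L]) (use V v_def in auto)
    ultimately show "kforces (cells L P) (cell_le L P) V w a" using w unfolding cells_def by blast
  qed
next
  assume val: "\<forall>L. (\<forall>l\<in>set L. affine_fun l) \<longrightarrow> kvalid (cells L P) (cell_le L P) a"
  show "poly_valid P a" unfolding poly_valid_def
  proof (intro allI impI)
    fix v :: "nat \<Rightarrow> vec set" assume v: "\<forall>p. v p \<in> Sub_o P"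
    obtain e where e: "P \<subseteq> Rd e" using polyhedron_subset_Rd[OF P(1)] by blast
    define good where "good = (\<lambda>(p::nat) L0. (\<forall>l\<in>set L0. affine_fun l) \<and> (\<forall>L. set L0 \<subseteq> set L \<longrightarrow>
      upset (cells L P) (cell_le L P) (sgn_code L ` v p) \<and> v p = {x\<in>P. sgn_code L x \<in> sgn_code L ` v p}))"
    have "\<forall>p. \<exists>L0. good p L0" unfolding good_def using Sub_o_cells[OF e] v by blast
    then obtain LL where LL: "\<And>p. good p (LL p)" by metis
    obtain L where L: "set L = (\<Union>p\<in>vars a. set (LL p))"
      using finite_list[of "\<Union>p\<in>vars a. set (LL p)"] by auto
    have aff: "\<forall>l\<in>set L. affine_fun l" using L LL unfolding good_def by blast
    \<comment> \<open>Variables that do not occur in \<open>a\<close> receive the empty upset as a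
      default.\<close>
    define V where "V = (\<lambda>p. if p \<in> vars a then sgn_code L ` v p else {})"
    have "set (LL p) \<subseteq> set L" if "p \<in> vars a" for p using that L by blast
    then have up: "upset (cells L P) (cell_le L P) (sgn_code L ` v p)"
      and eq: "v p = {x\<in>P. sgn_code L x \<in> sgn_code L ` v p}" if "p \<in> vars a" for p
      using that LL[of p] unfolding good_def by blast+
    have V: "upset (cells L P) (cell_le L P) (V p)" for p
      using up unfolding V_def by (auto simp: upset_def)
    have "heval P v a = {x\<in>P. kforces (cells L P) (cell_le L P) V (sgn_code L x) a}"
      by (rule heval_cells[OF P aff V]) (use eq in \<open>simp add: V_def\<close>)
    moreover have "kforces (cells L P) (cell_le L P) V (sgn_code L x) a" if "x \<in> P" for x
      using val aff V that unfolding kvalid_def cells_def by blast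
    ultimately show "heval P v a = P" by blast
  qed
qed

subsection \<open>Soundness\<close>

text \<open>The largest cell \<open>m\<close> is split off. Some function of \<open>L\<close>
  vanishes at the next largest cell \<open>q\<close> but not at \<open>m\<close>; it then vanishes
  at all smaller cells and on the affine hull of their points, which therefore misses the point
  chosen in \<open>m\<close>.\<close>

lemma chain_affine_independent:
  assumes L: "\<forall>l\<in>set L. affine_fun l" and "finite X" "X \<subseteq> cells L P"
    and "\<forall>u\<in>X. \<forall>w\<in>X. cell_le L P u w \<or> cell_le L P w u"
    and r: "\<And>w. w \<in> X \<Longrightarrow> r w \<in> P \<and> sgn_code L (r w) = w"
  shows "\<not> affine_dependent (r ` X)"
  using assms(2-)
proof (induction "card X" arbitrary: X)
  case 0
  then show ?case by simp
next
  case (Suc k)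
  note po = poset_cells[of L P]
  have "X \<noteq> {}" using Suc(2) by auto
  then obtain m where m: "m \<in> X" "\<And>u. u \<in> X \<Longrightarrow> cell_le L P m u \<Longrightarrow> u = m"
  proof -
    obtain s where s: "s \<in> X" using \<open>X \<noteq> {}\<close> by blast
    obtain m where "m \<in> X" "\<forall>u\<in>above (cells L P) (cell_le L P) m. u \<notin> X"
      using maximal_witness[OF finite_cells po Suc(4) s] by blast
    then show ?thesis using that[of m] Suc(4) unfolding above_def by blast
  qed
  have le: "cell_le L P u m" if "u \<in> X" for u using Suc.prems(3) m that by blast
  let ?Y = "X - {m}"
  have IH: "\<not> affine_dependent (r ` ?Y)"
    by (rule Suc(1)) (use Suc m(1) in auto)
  have sl: "sgn_le L (r u) (r m)" if "u \<in> X" for u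
    using le[OF that] Suc.prems(4)[OF that] Suc.prems(4)[OF m(1)] cell_le_iff by metis
  have "r m \<notin> affine hull (r ` ?Y)"
  proof (cases "?Y = {}")
    case False
    then obtain s where s: "s \<in> ?Y" by blast
    have YW: "?Y \<subseteq> cells L P" using Suc(4) by blast
    obtain q where q: "q \<in> ?Y" "\<forall>u\<in>above (cells L P) (cell_le L P) q. u \<notin> ?Y"
      using maximal_witness[OF finite_cells po YW s] by blast
    have qX: "q \<in> X" "q \<noteq> m" using q by auto
    have leq: "cell_le L P u q" if u: "u \<in> ?Y" for u
    proof (rule ccontr)
      assume n: "\<not> ?thesis"
      then have "cell_le L P q u" using Suc.prems(3) u qX by blast
      moreover have "u \<noteq> q" using n poset_refl[OF po] YW u by blast
      ultimately show False using q(2) u YW unfolding above_def by blast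
    qed
    have slq: "sgn_le L (r u) (r q)" if u: "u \<in> ?Y" for u
    proof -
      have "u \<in> X" using u by blast
      then show ?thesis using leq[OF u] Suc.prems(4)[of u] Suc.prems(4)[OF qX(1)] cell_le_iff by metis
    qed
    have "\<not> sgn_le L (r m) (r q)"
      using sgn_le_antisym[OF sl[OF qX(1)]] Suc.prems(4)[OF qX(1)] Suc.prems(4)[OF m(1)] qX(2) by auto
    then obtain l where l: "l \<in> set L" "l (r m) \<noteq> 0" "sgn (l (r q)) \<noteq> sgn (l (r m))"
      unfolding sgn_le_def by blast
    have lq: "l (r q) = 0" using sl[OF qX(1)] l unfolding sgn_le_def by force
    have lY: "l (r u) = 0" if u: "u \<in> ?Y" for u
      using slq[OF u] lq l(1) unfolding sgn_le_def by (metis sgn_0 sgn_0_0)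
    have "l x = 0" if x: "x \<in> affine hull (r ` ?Y)" for x
    proof -
      have fin: "finite (r ` ?Y)" using Suc(3) by simp
      obtain u where u: "sum u (r ` ?Y) = 1" "(\<Sum>v\<in>r ` ?Y. u v *\<^sub>R v) = x"
        using x unfolding affine_hull_finite[OF fin] by blast
      have "l x = (\<Sum>v\<in>r ` ?Y. u v * l v)"
        using affine_fun_sum[OF L[rule_format, OF l(1)] u(1), of "\<lambda>v. v"] u(2) by simp
      then show ?thesis using lY by (simp add: sum.neutral)
    qed
    then show ?thesis using l(2) by blast
  next
    case True
    show ?thesis unfolding True by simp
  qed
  then have "\<not> affine_dependent (insert (r m) (r ` ?Y))" using affine_independent_insert'[OF IH] by blast
  moreover have "r ` X = insert (r m) (r ` ?Y)" using m(1) by blast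
  ultimately show ?case by simp
qed

lemma height_le_cells:
  assumes P: "polyhedron P" "convex P" "poly_dim P \<le> n" and L: "\<forall>l\<in>set L. affine_fun l"
  shows "height_le (cells L P) (cell_le L P) n"
  unfolding height_le_def
proof (intro allI impI)
  fix X assume X: "X \<subseteq> cells L P \<and> (\<forall>u\<in>X. \<forall>w\<in>X. cell_le L P u w \<or> cell_le L P w u)"
  have fin: "finite X" using X finite_cells finite_subset by blast
  define r where "r = (\<lambda>w. SOME x. x \<in> P \<and> sgn_code L x = w)"
  have r: "r w \<in> P \<and> sgn_code L (r w) = w" if "w \<in> X" for w
  proof -
    have "\<exists>x. x \<in> P \<and> sgn_code L x = w" using that X unfolding cells_def by blast
    then show ?thesis unfolding r_def by (rule someI_ex)
  qed
  have "\<not> affine_dependent (r ` X)"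
    by (rule chain_affine_independent[OF L fin _ _ r]) (use X in auto)
  then have "card (r ` X) \<le> poly_dim P + 1"
    by (intro card_le_poly_dim[OF P(1,2)]) (use fin r in auto)
  moreover have "card (r ` X) = card X"
    by (rule card_image, rule inj_onI) (metis r)
  ultimately show "finite X \<and> card X \<le> n + 1" using fin P(3) by linarith
qed

text \<open>If two points of \<open>P\<close> in different components above a cell were not on opposite sides of that cell,
  the segment joining them would connect the components.\<close>

lemma opposite_cells:
  assumes P: "convex P" and L: "\<forall>l\<in>set L. affine_fun l" and x: "x \<in> P"
    and A: "upset (cells L P) (cell_le L P) A" and B: "upset (cells L P) (cell_le L P) B"
    and AB: "A \<union> B = above (cells L P) (cell_le L P) (sgn_code L x)" "A \<inter> B = {}"
    and y: "y \<in> P" "sgn_code L y \<in> A" and z: "z \<in> P" "sgn_code L z \<in> B" and l: "l \<in> set L"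
  shows "sgn (l z) = (if l x = 0 then - sgn (l y) else sgn (l x))"
proof -
  let ?W = "cells L P" and ?R = "cell_le L P"
  define g where "g = (\<lambda>t. y + t *\<^sub>R (z - y))"
  have gP: "g t \<in> P" if "t \<in> {0..1}" for t
  proof -
    have "g t = (1 - t) *\<^sub>R y + t *\<^sub>R z" by (simp add: g_def algebra_simps)
    then show ?thesis using P y z that by (auto intro: convexD)
  qed
  have lg: "l (g t) = (1 - t) * l y + t * l z" if "l \<in> set L" for l t
    using L that by (simp add: g_def affine_fun_segment)
  have xy: "sgn_le L x y" "sgn_le L x z"
  proof -
    have "sgn_code L y \<in> above ?W ?R (sgn_code L x)" "sgn_code L z \<in> above ?W ?R (sgn_code L x)"
      using AB y z by auto
    then show "sgn_le L x y" "sgn_le L x z" using x y z by (auto simp: above_def cell_le_iff)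
  qed
  have xg: "sgn_le L x (g t)" if t: "t \<in> {0..1}" for t
    unfolding sgn_le_def
  proof (intro ballI impI)
    fix l assume l: "l \<in> set L" "l x \<noteq> 0"
    have s: "sgn (l y) = sgn (l x)" "sgn (l z) = sgn (l x)" using xy l unfolding sgn_le_def by auto
    show "sgn (l (g t)) = sgn (l x)"
    proof (cases "t = 0")
      case False
      then show ?thesis unfolding lg[OF l(1)]
        using sgn_convex_comb[of "l y" "l z" t] s t by auto
    qed (simp add: g_def s)
  qed
  have "\<exists>t\<in>{0..1}. sgn_code L (g t) = sgn_code L x"
  proof (rule ccontr)
    assume n: "\<not> ?thesis"
    have gAB: "sgn_code L (g t) \<in> A \<union> B" if t: "t \<in> {0..1}" for t
      unfolding AB above_def using gP[OF t] xg[OF t] n x t by (auto simp: cells_def cell_le_iff)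
    have "(\<lambda>t. sgn_code L (g t) \<in> A) constant_on {0..1::real}"
    proof (rule locally_constant_imp_constant)
      show "connected {0..1::real}" by (rule connected_Icc)
      fix a :: real assume a: "a \<in> {0..1}"
      let ?L = "{l\<in>set L. l (g a) \<noteq> 0}"
      \<comment> \<open>Near \<open>a\<close> the functions that are nonzero at \<open>g a\<close>
        keep their signs, so the cell of \<open>g t\<close> lies above that of \<open>g a\<close>.
        As \<open>A\<close> and \<open>B\<close> are disjoint upsets, the segment cannot change from
        one to the other at \<open>a\<close>.\<close>
      define T where "T = {0..1} \<inter> (\<Inter>l\<in>?L. {t. 0 < l (g a) * ((1 - t) * l y + t * l z)})"
      have "open (\<Inter>l\<in>?L. {t. 0 < l (g a) * ((1 - t) * l y + t * l z)})"
        by (intro open_INT ballI open_Collect_less continuous_intros) simp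
      then have "openin (top_of_set {0..1}) T" unfolding T_def by (rule openin_open_Int)
      moreover have "a \<in> T" unfolding T_def using a by (auto simp: lg[symmetric] zero_less_mult_iff)
      moreover have "(sgn_code L (g t) \<in> A) = (sgn_code L (g a) \<in> A)" if t: "t \<in> T" for t
      proof -
        have t01: "t \<in> {0..1}" using t by (simp add: T_def)
        have "sgn_le L (g a) (g t)" unfolding sgn_le_def
        proof (intro ballI impI)
          fix l assume l: "l \<in> set L" "l (g a) \<noteq> 0"
          have "\<forall>l\<in>?L. 0 < l (g a) * ((1 - t) * l y + t * l z)" using t by (simp add: T_def)
          then have "0 < l (g a) * l (g t)" using l by (simp add: lg)
          then show "sgn (l (g t)) = sgn (l (g a))" by (auto simp: zero_less_mult_iff)
        qed
        then have "sgn_code L (g a) \<in> A \<Longrightarrow> sgn_code L (g t) \<in> A"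
          "sgn_code L (g a) \<in> B \<Longrightarrow> sgn_code L (g t) \<in> B"
          using upset_cell_le[OF A gP[OF a] gP[OF t01]] upset_cell_le[OF B gP[OF a] gP[OF t01]] by blast+
        then show ?thesis using gAB[OF a] gAB[OF t01] AB(2) by blast
      qed
      ultimately show "\<exists>T. openin (top_of_set {0..1}) T \<and> a \<in> T
          \<and> (\<forall>t\<in>T. (sgn_code L (g t) \<in> A) = (sgn_code L (g a) \<in> A))" by blast
    qed
    then have "(sgn_code L (g 0) \<in> A) = (sgn_code L (g 1) \<in> A)"
      unfolding constant_on_def by force
    then show False using y z AB(2) by (auto simp: g_def)
  qed
  then obtain t where t: "t \<in> {0..1}" "sgn_code L (g t) = sgn_code L x" by blast
  show ?thesis
  proof (cases "l x = 0")
    case False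
    then show ?thesis using xy l unfolding sgn_le_def by simp
  next
    case True
    then have g0: "(1 - t) * l y + t * l z = 0"
      using t(2) l lg[OF l, of t] unfolding sgn_code_eq_iff by (metis sgn_0 sgn_0_0)
    have "t \<noteq> 0"
    proof
      assume "t = 0"
      then have "sgn_code L y = sgn_code L x" using t(2) by (simp add: g_def)
      then show False using AB y by (auto simp: above_def)
    qed
    moreover have "t \<noteq> 1"
    proof
      assume "t = 1"
      then have "sgn_code L z = sgn_code L x" using t(2) by (simp add: g_def)
      then show False using AB z by (auto simp: above_def)
    qed
    ultimately have t': "0 < t" "t < 1" using t(1) by auto
    have "sgn (t * l z) = sgn (- ((1 - t) * l y))" using g0 by (simp add: add_eq_0_iff)
    then have "sgn (l z) = - sgn (l y)" using t' by (simp add: sgn_mult)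
    then show ?thesis using True by simp
  qed
qed

text \<open>Once a point \<open>y\<close> of one part is fixed, all signs at a point of the other
  part are determined by those at \<open>x\<close> and \<open>y\<close>. The other part is thus a
  single cell, and the roles can be exchanged.\<close>

lemma pl_frame_cells:
  assumes P: "convex P" and L: "\<forall>l\<in>set L. affine_fun l"
  shows "pl_frame (cells L P) (cell_le L P)"
proof -
  let ?W = "cells L P" and ?R = "cell_le L P"
  have single: "is_singleton B"
    if w: "w \<in> ?W" and A: "upset ?W ?R A" and B: "upset ?W ?R B" and AB: "A \<union> B = above ?W ?R w" "A \<inter> B = {}"
      and ne: "A \<noteq> {}" "B \<noteq> {}" for w A B
  proof -
    obtain x where x: "x \<in> P" "w = sgn_code L x" using w unfolding cells_def by blast
    obtain y where y: "y \<in> P" "sgn_code L y \<in> A"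
      using ne(1) upset_subset[OF A] unfolding cells_def by blast
    note opp = opposite_cells[OF P L x(1) A B AB(1)[unfolded x(2)] AB(2) y]
    have "u = v" if uv: "u \<in> B" "v \<in> B" for u v
    proof -
      obtain z z' where z: "z \<in> P" "u = sgn_code L z" "z' \<in> P" "v = sgn_code L z'"
        using uv upset_subset[OF B] unfolding cells_def by blast
      have "sgn (l z) = sgn (l z')" if "l \<in> set L" for l
        using opp[OF z(1) _ that] opp[OF z(3) _ that] uv z by simp
      then show ?thesis unfolding z sgn_code_eq_iff by blast
    qed
    then show ?thesis using ne(2) by (metis is_singletonI')
  qed
  show ?thesis unfolding pl_frame_def
  proof (intro ballI allI impI)
    fix w A B assume w: "w \<in> ?W"
      and *: "upset ?W ?R A \<and> upset ?W ?R B \<and> A \<union> B = above ?W ?R w \<and> A \<inter> B = {} \<and> A \<noteq> {} \<and> B \<noteq> {}"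
    then show "is_singleton A \<and> is_singleton B"
      using single[OF w, of A B] single[OF w, of B A] by (simp add: Un_commute Int_commute)
  qed
qed

theorem PLn_sound:
  assumes a: "a \<in> PLn n" and P: "P \<in> Convex n"
  shows "poly_valid P a"
proof -
  have P: "polyhedron P" "convex P" "poly_dim P \<le> n" using P by (auto simp: Convex_def)
  have "kvalid (cells L P) (cell_le L P) a" if L: "\<forall>l\<in>set L. affine_fun l" for L
  proof (rule kvalid_logic_gen[OF poset_cells _ a[unfolded PLn_def]])
    fix b assume "b \<in> BD n \<union> {chi_fork3, chi_scott}"
    then consider "b \<in> BD n" | "b = chi_fork3" | "b = chi_scott" by blast
    then show "kvalid (cells L P) (cell_le L P) b"
    proof cases
      case 1
      then show ?thesis using finite_cells poset_cells height_le_cells[OF P L] unfolding BD_def by blast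
    next
      case 2
      then show ?thesis using pl_frame_chi_fork3[OF finite_cells poset_cells pl_frame_cells[OF P(2) L]] by simp
    next
      case 3
      then show ?thesis using pl_frame_chi_scott[OF finite_cells poset_cells pl_frame_cells[OF P(2) L]] by simp
    qed
  qed
  then show ?thesis using poly_valid_iff_cells[OF P(1,2)] by blast
qed

subsection \<open>Realising frames by cones\<close>

text \<open>Labellings of the cone depend on finitely many coordinates only, so that one infinite-dimensional cone
  serves all dimensions. Coordinate 0 is unrestricted and is the direction of gluing.\<close>

definition cone_D :: "vec set" where
  "cone_D = {x. \<forall>i\<ge>1. 0 \<le> x i \<and> x i \<le> x (Suc i)}"

definition coord_linear :: "nat \<Rightarrow> (vec \<Rightarrow> real) \<Rightarrow> bool" where
  "coord_linear h l \<longleftrightarrow> linear l \<and> (\<forall>x y. (\<forall>i<h. x i = y i) \<longrightarrow> l x = l y)"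

text \<open>Because the functions are linear and not merely affine, such a labelling is invariant
  under positive scaling.\<close>

definition sgn_determined :: "nat \<Rightarrow> (vec \<Rightarrow> nat) \<Rightarrow> bool" where
  "sgn_determined h f \<longleftrightarrow> (\<exists>L. finite L \<and> (\<forall>l\<in>L. coord_linear h l)
     \<and> (\<forall>x y. (\<forall>l\<in>L. sgn (l x) = sgn (l y)) \<longrightarrow> f x = f y))"

text \<open>The p-morphism conditions in the form of germs, for short moves from \<open>p\<close>.
  Directions taken from \<open>cone_D\<close> itself suffice, since adding a positive multiple of a
  point of a higher cell leads into that cell.\<close>

definition open_onto :: "nat set \<Rightarrow> (nat \<Rightarrow> nat \<Rightarrow> bool) \<Rightarrow> vec set \<Rightarrow> (vec \<Rightarrow> nat) \<Rightarrow> bool" where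
  "open_onto W R E f \<longleftrightarrow> (\<forall>p\<in>E. f p \<in> W
     \<and> (\<forall>q\<in>cone_D. \<forall>\<^sub>F t in at_right 0. R (f p) (f (p + t *\<^sub>R q)))
     \<and> (\<forall>z\<in>W. R (f p) z \<longrightarrow> (\<exists>q\<in>cone_D. \<forall>\<^sub>F t in at_right 0. f (p + t *\<^sub>R q) = z)))"

text \<open>Far to the left the label is \<open>a\<close>, far to the right it is \<open>b\<close>,
  where distance is measured in units of coordinate \<open>h\<close>. These constant ends are the
  places for gluing.\<close>

definition has_ends :: "vec set \<Rightarrow> nat \<Rightarrow> nat \<Rightarrow> nat \<Rightarrow> (vec \<Rightarrow> nat) \<Rightarrow> bool" where
  "has_ends E h a b f \<longleftrightarrow> (\<exists>N\<ge>0. \<forall>x\<in>E. (x 0 < - N * x h \<longrightarrow> f x = a) \<and> (N * x h < x 0 \<longrightarrow> f x = b))"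

definition half_D :: "nat \<Rightarrow> vec set" where
  "half_D h = {x\<in>cone_D. 0 < x h}"

text \<open>The labelling depends on coordinates below \<open>h\<close> only, while its ends are
  measured by coordinate \<open>h\<close>; this prepares the use of that coordinate as a
  scale.\<close>

definition is_cell :: "nat set \<Rightarrow> (nat \<Rightarrow> nat \<Rightarrow> bool) \<Rightarrow> nat \<Rightarrow> nat \<Rightarrow> nat \<Rightarrow> nat \<Rightarrow> (vec \<Rightarrow> nat) \<Rightarrow> bool" where
  "is_cell W R h y a b f \<longleftrightarrow> sgn_determined h f \<and> open_onto W R cone_D f \<and> has_ends cone_D h a b f \<and> f 0 = y"

text \<open>The piece without an apex, over the part where the scale \<open>x h\<close> is positive.
  \<open>Z\<close> records exactly the labels that occur, so that none is lost or added by
  gluing.\<close>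

definition is_strip :: "nat set \<Rightarrow> (nat \<Rightarrow> nat \<Rightarrow> bool) \<Rightarrow> nat \<Rightarrow> nat set \<Rightarrow> nat \<Rightarrow> nat \<Rightarrow> (vec \<Rightarrow> nat) \<Rightarrow> bool" where
  "is_strip W R h Z a b f \<longleftrightarrow> sgn_determined (Suc h) f \<and> open_onto W R (half_D h) f
     \<and> has_ends (half_D h) h a b f \<and> f ` half_D h = Z"

lemma cone_D_add: "x \<in> cone_D \<Longrightarrow> y \<in> cone_D \<Longrightarrow> x + y \<in> cone_D"
  unfolding cone_D_def by (auto intro: add_mono)

lemma cone_D_scale: "x \<in> cone_D \<Longrightarrow> 0 \<le> t \<Longrightarrow> t *\<^sub>R x \<in> cone_D"
  unfolding cone_D_def scaleR_fun_def by (auto intro: mult_left_mono)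

lemma zero_cone_D: "0 \<in> cone_D"
  by (simp add: cone_D_def)

lemma cone_D_nonneg: "x \<in> cone_D \<Longrightarrow> 1 \<le> i \<Longrightarrow> 0 \<le> x i"
  by (simp add: cone_D_def)

text \<open>This is the reason for the shape of the cone. Where coordinate \<open>h\<close> is 0,
  all coordinates from 1 to \<open>h\<close> vanish; and a distance that is large compared with
  \<open>x (Suc h)\<close> is also large compared with \<open>x h\<close>.\<close>

lemma cone_D_mono:
  assumes "x \<in> cone_D" "1 \<le> i" "i \<le> j"
  shows "x i \<le> x j"
  using assms(3)
proof (induction rule: dec_induct)
  case (step k)
  have "x k \<le> x (Suc k)" using assms(1,2) step(1) by (simp add: cone_D_def)
  then show ?case using step by simp
qed simp

lemma ray_coord: "(t *\<^sub>R q) i = t * q i" for q :: vec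
  by (simp add: scaleR_fun_def)

lemma half_D_subset: "half_D h \<subseteq> cone_D"
  by (auto simp: half_D_def)

lemma half_D_add:
  assumes "p \<in> half_D h" "q \<in> cone_D" "0 \<le> t" "1 \<le> h"
  shows "p + t *\<^sub>R q \<in> half_D h"
  using assms cone_D_add[of p "t *\<^sub>R q"] cone_D_scale[of q t] cone_D_nonneg[of q h]
  by (auto simp: half_D_def scaleR_fun_def intro: add_pos_nonneg)

lemma eventually_right_pos: "\<forall>\<^sub>F t in at_right (0::real). 0 < t"
  by (rule eventually_at_right_less)

lemma eventually_affine_pos:
  fixes a c :: real
  assumes "0 < a"
  shows "\<forall>\<^sub>F t in at_right 0. 0 < a + t * c"
proof -
  have "((\<lambda>t. a + t * c) \<longlongrightarrow> a + 0 * c) (at_right 0)" by (intro tendsto_intros)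
  then show ?thesis using assms by (intro order_tendstoD) auto
qed

lemma coord_linear_mono: "h \<le> k \<Longrightarrow> coord_linear h l \<Longrightarrow> coord_linear k l"
  unfolding coord_linear_def by (meson order_less_le_trans)

lemma sgn_determined_mono: "h \<le> k \<Longrightarrow> sgn_determined h f \<Longrightarrow> sgn_determined k f"
  unfolding sgn_determined_def using coord_linear_mono by meson

lemma sgn_determined_agree:
  assumes "sgn_determined h f" "\<And>i. i < h \<Longrightarrow> x i = y i"
  shows "f x = f y"
proof -
  obtain L where L: "\<forall>l\<in>L. coord_linear h l" "\<forall>x y. (\<forall>l\<in>L. sgn (l x) = sgn (l y)) \<longrightarrow> f x = f y"
    using assms(1) unfolding sgn_determined_def by blast
  have "l x = l y" if "l \<in> L" for l using L(1) that assms(2) unfolding coord_linear_def by blast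
  then have "\<forall>l\<in>L. sgn (l x) = sgn (l y)" by metis
  then show ?thesis using L(2) by blast
qed

lemma sgn_determined_scale:
  assumes "sgn_determined h f" "0 < t"
  shows "f (t *\<^sub>R x) = f x"
proof -
  obtain L where L: "\<forall>l\<in>L. coord_linear h l" "\<forall>x y. (\<forall>l\<in>L. sgn (l x) = sgn (l y)) \<longrightarrow> f x = f y"
    using assms(1) unfolding sgn_determined_def by blast
  have "sgn (l (t *\<^sub>R x)) = sgn (l x)" if "l \<in> L" for l
  proof -
    have "linear l" using L(1) that unfolding coord_linear_def by blast
    then show ?thesis using assms(2) by (simp add: linear_cmul sgn_mult)
  qed
  then show ?thesis by (intro L(2)[rule_format]) simp
qed

lemma linear_coord: "linear (\<lambda>x::vec. x i)"
  by (rule linearI) (auto simp: scaleR_fun_def)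

lemma coord_linear_coord: "i < h \<Longrightarrow> coord_linear h (\<lambda>x. x i)"
  unfolding coord_linear_def using linear_coord by blast

section \<open>Shears and reflections of coordinate 0\<close>

definition shear :: "nat \<Rightarrow> real \<Rightarrow> vec \<Rightarrow> vec" where
  "shear h c x = x(0 := x 0 + c * x h)"

definition mirror :: "vec \<Rightarrow> vec" where
  "mirror x = x(0 := - x 0)"

lemma linear_shear: "linear (shear h c)"
  by (rule linearI) (auto simp: shear_def scaleR_fun_def fun_eq_iff algebra_simps)

lemma linear_mirror: "linear mirror"
  by (rule linearI) (auto simp: mirror_def scaleR_fun_def fun_eq_iff)

lemma shear_inverse: "1 \<le> h \<Longrightarrow> c + d = 0 \<Longrightarrow> shear h c (shear h d x) = x"
proof -
  assume h: "1 \<le> h" and "c + d = 0"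
  then have "d = - c" by simp
  then show ?thesis using h by (auto simp: shear_def fun_eq_iff)
qed

lemma mirror_mirror [simp]: "mirror (mirror x) = x"
  by (auto simp: mirror_def)

lemma shear_half_D: "1 \<le> h \<Longrightarrow> shear h c x \<in> half_D k \<longleftrightarrow> x \<in> half_D k" if "1 \<le> k"
  using that by (auto simp: shear_def half_D_def cone_D_def)

lemma shear_cone_D: "shear h c x \<in> cone_D \<longleftrightarrow> x \<in> cone_D"
  by (auto simp: shear_def cone_D_def)

lemma mirror_cone_D: "mirror x \<in> cone_D \<longleftrightarrow> x \<in> cone_D"
  by (auto simp: mirror_def cone_D_def)

lemma mirror_half_D: "1 \<le> h \<Longrightarrow> mirror x \<in> half_D h \<longleftrightarrow> x \<in> half_D h"
  by (auto simp: half_D_def mirror_cone_D) (auto simp: mirror_def)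

lemma coord_linear_shear:
  assumes "coord_linear (Suc h) l"
  shows "coord_linear (Suc h) (\<lambda>x. l (shear h c x))"
proof -
  have "linear (l \<circ> shear h c)"
    using assms linear_shear unfolding coord_linear_def by (intro linear_compose) auto
  moreover have "l (shear h c x) = l (shear h c y)" if "\<forall>i<Suc h. x i = y i" for x y
  proof -
    have "\<forall>i<Suc h. shear h c x i = shear h c y i" using that by (auto simp: shear_def)
    then show ?thesis using assms unfolding coord_linear_def by blast
  qed
  ultimately show ?thesis unfolding coord_linear_def comp_def by blast
qed

lemma coord_linear_mirror:
  assumes "coord_linear h l"
  shows "coord_linear h (\<lambda>x. l (mirror x))"
proof -
  have "linear (l \<circ> mirror)"
    using assms linear_mirror unfolding coord_linear_def by (intro linear_compose) auto
  moreover have "l (mirror x) = l (mirror y)" if "\<forall>i<h. x i = y i" for x y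
  proof -
    have "\<forall>i<h. mirror x i = mirror y i" using that by (auto simp: mirror_def)
    then show ?thesis using assms unfolding coord_linear_def by blast
  qed
  ultimately show ?thesis unfolding coord_linear_def comp_def by blast
qed

lemma sgn_determined_shear:
  assumes "sgn_determined (Suc h) f"
  shows "sgn_determined (Suc h) (\<lambda>x. f (shear h c x))"
proof -
  obtain L where L: "finite L" "\<forall>l\<in>L. coord_linear (Suc h) l"
    "\<forall>x y. (\<forall>l\<in>L. sgn (l x) = sgn (l y)) \<longrightarrow> f x = f y"
    using assms unfolding sgn_determined_def by blast
  show ?thesis unfolding sgn_determined_def
  proof (intro exI[of _ "(\<lambda>l x. l (shear h c x)) ` L"] conjI)
    show "\<forall>l\<in>(\<lambda>l x. l (shear h c x)) ` L. coord_linear (Suc h) l"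
      using L(2) coord_linear_shear by blast
  qed (use L(1,3) in auto)
qed

lemma sgn_determined_mirror:
  assumes "sgn_determined h f"
  shows "sgn_determined h (\<lambda>x. f (mirror x))"
proof -
  obtain L where L: "finite L" "\<forall>l\<in>L. coord_linear h l"
    "\<forall>x y. (\<forall>l\<in>L. sgn (l x) = sgn (l y)) \<longrightarrow> f x = f y"
    using assms unfolding sgn_determined_def by blast
  show ?thesis unfolding sgn_determined_def
  proof (intro exI[of _ "(\<lambda>l x. l (mirror x)) ` L"] conjI)
    show "\<forall>l\<in>(\<lambda>l x. l (mirror x)) ` L. coord_linear h l"
      using L(2) coord_linear_mirror by blast
  qed (use L(1,3) in auto)
qed

lemma sgn_determined_If:
  assumes "sgn_determined h f" "sgn_determined h g" "i < h" "\<And>x y. sgn (x i) = sgn (y i) \<Longrightarrow> c x = c y"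
  shows "sgn_determined h (\<lambda>x. if c x then f x else g x)"
proof -
  obtain L where L: "finite L" "\<forall>l\<in>L. coord_linear h l"
    "\<forall>x y. (\<forall>l\<in>L. sgn (l x) = sgn (l y)) \<longrightarrow> f x = f y"
    using assms(1) unfolding sgn_determined_def by blast
  obtain M where M: "finite M" "\<forall>l\<in>M. coord_linear h l"
    "\<forall>x y. (\<forall>l\<in>M. sgn (l x) = sgn (l y)) \<longrightarrow> g x = g y"
    using assms(2) unfolding sgn_determined_def by blast
  show ?thesis unfolding sgn_determined_def
  proof (intro exI[of _ "insert (\<lambda>x. x i) (L \<union> M)"] conjI allI impI)
    fix x y :: vec assume s: "\<forall>l\<in>insert (\<lambda>x. x i) (L \<union> M). sgn (l x) = sgn (l y)"
    then have "f x = f y" by (intro L(3)[rule_format]) blast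
    moreover have "g x = g y" using s by (intro M(3)[rule_format]) blast
    moreover have "c x = c y" by (rule assms(4)) (use s in simp)
    ultimately show "(if c x then f x else g x) = (if c y then f y else g y)" by simp
  qed (use L(1,2) M(1,2) coord_linear_coord[OF assms(3)] in auto)
qed

lemma sgn_determined_const: "sgn_determined h (\<lambda>_. y)"
  unfolding sgn_determined_def by (intro exI[of _ "{}"]) simp

section \<open>Gluing labelled cones over a frame with the splitting property\<close>

locale pl_poset =
  fixes W :: "nat set" and R :: "nat \<Rightarrow> nat \<Rightarrow> bool"
  assumes fin: "finite W" and pos: "poset W R" and pl: "pl_frame W R"
begin

definition tops :: "nat \<Rightarrow> nat set" where
  "tops z = {a\<in>W. R z a \<and> above W R a = {}}"

lemma topD: "a \<in> tops z \<Longrightarrow> u \<in> W \<Longrightarrow> R a u \<Longrightarrow> u = a"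
  by (auto simp: tops_def above_def)

lemma tops_W: "a \<in> tops z \<Longrightarrow> a \<in> W"
  by (simp add: tops_def)

lemma tops_mono: "z \<in> W \<Longrightarrow> u \<in> W \<Longrightarrow> R z u \<Longrightarrow> tops u \<subseteq> tops z"
  unfolding tops_def using poset_trans[OF pos] by blast

lemma tops_nonempty:
  assumes "z \<in> W"
  shows "\<exists>a. a \<in> tops z"
proof -
  obtain m where m: "m \<in> W" "R z m" "\<forall>u\<in>above W R m. u \<notin> W"
    using maximal_witness[OF fin pos order_refl assms] by blast
  have "above W R m \<subseteq> W" unfolding above_def by blast
  then have "above W R m = {}" using m(3) by blast
  then show ?thesis using m unfolding tops_def by blast
qed

lemma open_ontoI:
  assumes "\<And>p. p \<in> E \<Longrightarrow> f p \<in> W"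
    and "\<And>p q. p \<in> E \<Longrightarrow> q \<in> cone_D \<Longrightarrow> \<forall>\<^sub>F t in at_right 0. R (f p) (f (p + t *\<^sub>R q))"
    and "\<And>p z. p \<in> E \<Longrightarrow> z \<in> W \<Longrightarrow> R (f p) z \<Longrightarrow> \<exists>q\<in>cone_D. \<forall>\<^sub>F t in at_right 0. f (p + t *\<^sub>R q) = z"
  shows "open_onto W R E f"
  using assms unfolding open_onto_def by blast

lemma open_ontoD:
  assumes "open_onto W R E f" "p \<in> E"
  shows "f p \<in> W" "q \<in> cone_D \<Longrightarrow> \<forall>\<^sub>F t in at_right 0. R (f p) (f (p + t *\<^sub>R q))"
    "z \<in> W \<Longrightarrow> R (f p) z \<Longrightarrow> \<exists>q\<in>cone_D. \<forall>\<^sub>F t in at_right 0. f (p + t *\<^sub>R q) = z"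
  using assms unfolding open_onto_def by blast+

lemma lift_self: "\<exists>q\<in>cone_D. \<forall>\<^sub>F t in at_right 0. f (p + t *\<^sub>R q) = f p"
  by (rule bexI[of _ 0]) (simp_all add: zero_cone_D)

lemma eventually_top:
  assumes "b \<in> tops z" "\<forall>\<^sub>F t in at_right 0. f (p + t *\<^sub>R q) = b" "f p = b"
  shows "\<forall>\<^sub>F t in at_right 0. R (f p) (f (p + t *\<^sub>R q))"
  using assms(2) by (rule eventually_mono) (simp add: assms(3) poset_refl[OF pos tops_W[OF assms(1)]])

text \<open>By scaling, the label of \<open>x\<close> also occurs arbitrarily close to the apex,
  where openness compares it with \<open>y\<close>.\<close>

lemma cell_above:
  assumes f: "is_cell W R h y a b f" and x: "x \<in> cone_D"
  shows "R y (f x)"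
proof -
  have "\<forall>\<^sub>F t in at_right 0. R y (f (0 + t *\<^sub>R x))"
    using f x open_ontoD(2)[of cone_D f 0 x] zero_cone_D unfolding is_cell_def by auto
  then have "\<forall>\<^sub>F t in at_right 0. 0 < t \<and> R y (f (0 + t *\<^sub>R x))"
    using eventually_conj eventually_right_pos by blast
  then obtain t where "0 < t" "R y (f (0 + t *\<^sub>R x))"
    using eventually_happens'[of "at_right (0::real)"] by force
  then show ?thesis using sgn_determined_scale[of h f t x] f unfolding is_cell_def by simp
qed

text \<open>The labelling ignores coordinate \<open>h\<close>, which is thus free to act as the
  scale. The point \<open>p\<close>, with zero coordinates below \<open>h\<close>, carries the label
  of the apex although its scale is positive, and by openness all labels above \<open>y\<close>
  occur near it.\<close>

lemma strip_of_cell: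
  assumes f: "is_cell W R h y a b f" and h: "1 \<le> h"
  shows "is_strip W R h {u\<in>W. R y u} a b f"
proof -
  have c: "sgn_determined h f" "open_onto W R cone_D f" "has_ends cone_D h a b f" "f 0 = y"
    using f by (simp_all add: is_cell_def)
  define p :: vec where "p = (\<lambda>i. if h \<le> i then 1 else 0)"
  have p: "p \<in> half_D h" by (simp add: p_def half_D_def cone_D_def)
  have fp: "f p = y" using sgn_determined_agree[OF c(1), of p 0] c(4) by (simp add: p_def)
  have "f ` half_D h = {u\<in>W. R y u}"
  proof
    show "f ` half_D h \<subseteq> {u\<in>W. R y u}"
      using cell_above[OF f] open_ontoD(1)[OF c(2)] half_D_subset by blast
    show "{u\<in>W. R y u} \<subseteq> f ` half_D h"
    proof
      fix u assume u: "u \<in> {u\<in>W. R y u}"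
      have "p \<in> cone_D" using p half_D_subset by blast
      then obtain q where q: "q \<in> cone_D" "\<forall>\<^sub>F t in at_right 0. f (p + t *\<^sub>R q) = u"
        using open_ontoD(3)[OF c(2), of p u] u fp by blast
      then have "\<forall>\<^sub>F t in at_right 0. 0 < t \<and> f (p + t *\<^sub>R q) = u"
        using eventually_conj eventually_right_pos by blast
      then obtain t where "0 < t" "f (p + t *\<^sub>R q) = u"
        using eventually_happens'[of "at_right (0::real)"] by force
      moreover have "p + t *\<^sub>R q \<in> half_D h" using half_D_add[OF p q(1) _ h] \<open>0 < t\<close> by simp
      ultimately show "u \<in> f ` half_D h" by blast
    qed
  qed
  moreover have "open_onto W R (half_D h) f"
    using c(2) half_D_subset unfolding open_onto_def by blast
  moreover have "has_ends (half_D h) h a b f"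
    using c(3) half_D_subset unfolding has_ends_def by blast
  ultimately show ?thesis using sgn_determined_mono[of h "Suc h"] c(1) unfolding is_strip_def by simp
qed

lemma strip_mirror:
  assumes f: "is_strip W R h Z a b f" and h: "1 \<le> h"
  shows "is_strip W R h Z b a (\<lambda>x. f (mirror x))"
proof -
  have c: "sgn_determined (Suc h) f" "open_onto W R (half_D h) f" "has_ends (half_D h) h a b f" "f ` half_D h = Z"
    using f by (simp_all add: is_strip_def)
  have lin: "mirror (p + t *\<^sub>R q) = mirror p + t *\<^sub>R mirror q" for p q t
    using linear_mirror by (simp add: linear_add linear_cmul)
  have "open_onto W R (half_D h) (\<lambda>x. f (mirror x))"
  proof (rule open_ontoI)
    fix p assume "p \<in> half_D h"
    then have p: "mirror p \<in> half_D h" using h by (simp add: mirror_half_D)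
    show "f (mirror p) \<in> W" using open_ontoD(1)[OF c(2) p] .
    show "\<forall>\<^sub>F t in at_right 0. R (f (mirror p)) (f (mirror (p + t *\<^sub>R q)))" if "q \<in> cone_D" for q
      unfolding lin using open_ontoD(2)[OF c(2) p, of "mirror q"] that by (simp add: mirror_cone_D)
    show "\<exists>q\<in>cone_D. \<forall>\<^sub>F t in at_right 0. f (mirror (p + t *\<^sub>R q)) = z" if z: "z \<in> W" "R (f (mirror p)) z" for z
    proof -
      obtain q where q: "q \<in> cone_D" "\<forall>\<^sub>F t in at_right 0. f (mirror p + t *\<^sub>R q) = z"
        using open_ontoD(3)[OF c(2) p z] by blast
      then show ?thesis by (intro bexI[of _ "mirror q"]) (simp_all add: lin mirror_cone_D)
    qed
  qed
  moreover have "has_ends (half_D h) h b a (\<lambda>x. f (mirror x))"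
  proof -
    obtain N where N: "0 \<le> N" "\<forall>x\<in>half_D h. (x 0 < - N * x h \<longrightarrow> f x = a) \<and> (N * x h < x 0 \<longrightarrow> f x = b)"
      using c(3) unfolding has_ends_def by blast
    have "(x 0 < - N * x h \<longrightarrow> f (mirror x) = b) \<and> (N * x h < x 0 \<longrightarrow> f (mirror x) = a)"
      if "x \<in> half_D h" for x
    proof -
      have "mirror x \<in> half_D h" using that h by (simp add: mirror_half_D)
      moreover have "mirror x 0 = - x 0" "mirror x h = x h" using h by (auto simp: mirror_def)
      ultimately show ?thesis using N(2)[rule_format, of "mirror x"] by auto
    qed
    then show ?thesis using N(1) unfolding has_ends_def by blast
  qed
  moreover have "(\<lambda>x. f (mirror x)) ` half_D h = Z"
  proof -
    have "mirror ` half_D h = half_D h"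
    proof (intro equalityI subsetI)
      fix x assume "x \<in> half_D h"
      then have "mirror x \<in> half_D h" using h by (simp add: mirror_half_D)
      then show "x \<in> mirror ` half_D h" using mirror_mirror[of x] by (metis imageI)
    qed (use h in \<open>auto simp: mirror_half_D\<close>)
    then show ?thesis using c(4) by (metis image_image)
  qed
  ultimately show ?thesis using sgn_determined_mirror[OF c(1)] unfolding is_strip_def by blast
qed

text \<open>The shears move both strips so far apart that their middle parts fall on different sides of
  the hyperplane where the zeroth coordinate vanishes; near that hyperplane both have label \<open>b\<close>.\<close>

lemma strip_concat:
  assumes f: "is_strip W R h Z a b f" and g: "is_strip W R h Y b c g" and h: "1 \<le> h"
    and b: "b \<in> tops w"
  shows "\<exists>k. is_strip W R h (Z \<union> Y) a c k"
proof -
  have F: "sgn_determined (Suc h) f" "open_onto W R (half_D h) f" "has_ends (half_D h) h a b f" "f ` half_D h = Z"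
    using f by (simp_all add: is_strip_def)
  have G: "sgn_determined (Suc h) g" "open_onto W R (half_D h) g" "has_ends (half_D h) h b c g" "g ` half_D h = Y"
    using g by (simp_all add: is_strip_def)
  obtain N1 where N1: "0 \<le> N1" "\<forall>x\<in>half_D h. (x 0 < - N1 * x h \<longrightarrow> f x = a) \<and> (N1 * x h < x 0 \<longrightarrow> f x = b)"
    using F(3) unfolding has_ends_def by blast
  obtain N2 where N2: "0 \<le> N2" "\<forall>x\<in>half_D h. (x 0 < - N2 * x h \<longrightarrow> g x = b) \<and> (N2 * x h < x 0 \<longrightarrow> g x = c)"
    using G(3) unfolding has_ends_def by blast
  \<comment> \<open>The extra 1 leaves a seam, from \<open>- x h\<close> to \<open>x h\<close> in
    coordinate 0, on which both shifted labellings are already equal to \<open>b\<close>.\<close>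
  define M where "M = 1 + N1 + N2"
  let ?T = "shear h M" and ?S = "shear h (- M)"
  have hpos: "0 < x h" if "x \<in> half_D h" for x using that by (simp add: half_D_def)
  have T0: "?T x 0 = x 0 + M * x h" "?S x 0 = x 0 - M * x h" "?T x h = x h" "?S x h = x h" for x
    using h by (auto simp: shear_def)
  have TD: "?T x \<in> half_D h" "?S x \<in> half_D h" if "x \<in> half_D h" for x
    using that h by (simp_all add: shear_half_D)
  have ST: "?S (?T x) = x" "?T (?S x) = x" for x using h by (simp_all add: shear_inverse)
  have lin: "shear h m (p + t *\<^sub>R q) = shear h m p + t *\<^sub>R shear h m q" for m p q t
    using linear_shear[of h m] by (simp add: linear_add linear_cmul)
  have fa: "f (?T x) = a" if "x \<in> half_D h" "x 0 < - (M + N1) * x h" for x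
    using N1(2)[rule_format, OF TD(1)[OF that(1)]] that(2) by (simp add: T0 algebra_simps)
  have fb: "f (?T x) = b" if "x \<in> half_D h" "0 < x 0 + x h" for x
  proof -
    have "0 \<le> N2 * x h" using N2(1) hpos[OF that(1)] by simp
    then have "N1 * x h < x 0 + M * x h" using that(2) by (simp add: M_def algebra_simps)
    then show ?thesis using N1(2)[rule_format, OF TD(1)[OF that(1)]] by (simp add: T0)
  qed
  have gb: "g (?S x) = b" if "x \<in> half_D h" "0 < - x 0 + x h" for x
  proof -
    have "0 \<le> N1 * x h" using N1(1) hpos[OF that(1)] by simp
    then have "x 0 - M * x h < - N2 * x h" using that(2) by (simp add: M_def algebra_simps)
    then show ?thesis using N2(2)[rule_format, OF TD(2)[OF that(1)]] by (simp add: T0)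
  qed
  have gc: "g (?S x) = c" if "x \<in> half_D h" "(M + N2) * x h < x 0" for x
    using N2(2)[rule_format, OF TD(2)[OF that(1)]] that(2) by (simp add: T0 algebra_simps)
  define k where "k = (\<lambda>x. if x 0 \<le> 0 then f (?T x) else g (?S x))"
  have "sgn_determined (Suc h) k" unfolding k_def
    by (rule sgn_determined_If[where i = 0])
      (use sgn_determined_shear F(1) G(1) in \<open>auto simp: sgn_if split: if_splits\<close>)
  moreover have "open_onto W R (half_D h) k"
  proof (rule open_ontoI)
    fix p assume p: "p \<in> half_D h"
    show "k p \<in> W" using open_ontoD(1)[OF F(2) TD(1)[OF p]] open_ontoD(1)[OF G(2) TD(2)[OF p]] by (simp add: k_def)
    have neg: "\<forall>\<^sub>F t in at_right 0. k (p + t *\<^sub>R q) = f (?T p + t *\<^sub>R ?T q)" if p0: "p 0 < 0" for q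
    proof -
      have "\<forall>\<^sub>F t in at_right 0. 0 < - p 0 + t * (- q 0)" by (rule eventually_affine_pos) (use p0 in simp)
      then show ?thesis by (rule eventually_mono) (simp add: k_def lin ray_coord)
    qed
    have posi: "\<forall>\<^sub>F t in at_right 0. k (p + t *\<^sub>R q) = g (?S p + t *\<^sub>R ?S q)" if p0: "0 < p 0" for q
    proof -
      have "\<forall>\<^sub>F t in at_right 0. 0 < p 0 + t * q 0" by (rule eventually_affine_pos) (use p0 in simp)
      then show ?thesis by (rule eventually_mono) (simp add: k_def lin ray_coord)
    qed
    have kb: "k x = b" if "x \<in> half_D h" "0 < - x 0 + x h" "0 < x 0 + x h" for x
      using fb gb that by (simp add: k_def)
    \<comment> \<open>From a point of the seam every short move stays where the label is
      \<open>b\<close>; as \<open>b\<close> is maximal, no other label has to be reached.\<close>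
    have zero: "\<forall>\<^sub>F t in at_right 0. k (p + t *\<^sub>R q) = b" if p0: "p 0 = 0" and q: "q \<in> cone_D" for q
    proof -
      have "\<forall>\<^sub>F t in at_right 0. 0 < p h + t * (- q 0 + q h)" "\<forall>\<^sub>F t in at_right 0. 0 < p h + t * (q 0 + q h)"
        by (rule eventually_affine_pos, rule hpos[OF p])+
      with eventually_right_pos show ?thesis
      proof eventually_elim
        case (elim t)
        have "p + t *\<^sub>R q \<in> half_D h" using half_D_add[OF p q _ h] elim(1) by simp
        then show ?case using elim by (intro kb) (auto simp: p0 ray_coord algebra_simps)
      qed
    qed
    have kp0: "k p = b" if "p 0 = 0" using kb[OF p] hpos[OF p] that by simp
    consider "p 0 < 0" | "p 0 = 0" | "0 < p 0" by linarith
    note cases = this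
    show "\<forall>\<^sub>F t in at_right 0. R (k p) (k (p + t *\<^sub>R q))" if q: "q \<in> cone_D" for q
      using cases
    proof cases
      case 1
      have "\<forall>\<^sub>F t in at_right 0. R (f (?T p)) (f (?T p + t *\<^sub>R ?T q))"
        using open_ontoD(2)[OF F(2) TD(1)[OF p]] q by (simp add: shear_cone_D)
      with neg[OF 1, of q] show ?thesis by eventually_elim (use 1 in \<open>simp add: k_def\<close>)
    next
      case 2
      then show ?thesis using eventually_top[OF b, where f = k and p = p and q = q, OF zero[OF 2 q] kp0[OF 2]] by simp
    next
      case 3
      have "\<forall>\<^sub>F t in at_right 0. R (g (?S p)) (g (?S p + t *\<^sub>R ?S q))"
        using open_ontoD(2)[OF G(2) TD(2)[OF p]] q by (simp add: shear_cone_D)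
      with posi[OF 3, of q] show ?thesis by eventually_elim (use 3 in \<open>simp add: k_def\<close>)
    qed
    show "\<exists>q\<in>cone_D. \<forall>\<^sub>F t in at_right 0. k (p + t *\<^sub>R q) = z" if z: "z \<in> W" "R (k p) z" for z
      using cases
    proof cases
      case 1
      then obtain q where q: "q \<in> cone_D" "\<forall>\<^sub>F t in at_right 0. f (?T p + t *\<^sub>R q) = z"
        using open_ontoD(3)[OF F(2) TD(1)[OF p]] z by (auto simp: k_def)
      have "\<forall>\<^sub>F t in at_right 0. k (p + t *\<^sub>R ?S q) = z"
        using neg[OF 1, of "?S q"] q(2) by eventually_elim (simp add: ST)
      then show ?thesis using q(1) shear_cone_D by blast
    next
      case 2
      have "z = k p" using topD[OF b z(1)] z(2) kp0[OF 2] by simp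
      then show ?thesis using lift_self[of k p] by simp
    next
      case 3
      then obtain q where q: "q \<in> cone_D" "\<forall>\<^sub>F t in at_right 0. g (?S p + t *\<^sub>R q) = z"
        using open_ontoD(3)[OF G(2) TD(2)[OF p]] z by (auto simp: k_def)
      have "\<forall>\<^sub>F t in at_right 0. k (p + t *\<^sub>R ?T q) = z"
        using posi[OF 3, of "?T q"] q(2) by eventually_elim (simp add: ST)
      then show ?thesis using q(1) shear_cone_D by blast
    qed
  qed
  moreover have "has_ends (half_D h) h a c k"
    unfolding has_ends_def
  proof (intro exI[of _ "M + N1 + N2"] conjI ballI impI)
    show "0 \<le> M + N1 + N2" using N1 N2 by (simp add: M_def)
    fix x assume x: "x \<in> half_D h"
    have p: "0 \<le> M * x h" "0 \<le> N1 * x h" "0 \<le> N2 * x h"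
      using N1(1) N2(1) hpos[OF x] by (auto simp: M_def)
    show "k x = a" if "x 0 < - (M + N1 + N2) * x h"
      using fa[OF x] that p by (simp add: k_def algebra_simps)
    show "k x = c" if "(M + N1 + N2) * x h < x 0"
      using gc[OF x] that p by (simp add: k_def algebra_simps)
  qed
  moreover have "k ` half_D h = Z \<union> Y"
  proof
    show "k ` half_D h \<subseteq> Z \<union> Y" using F(4) G(4) TD unfolding k_def by auto
    have bk: "b \<in> k ` half_D h" if "x \<in> half_D h" for x
    proof -
      have x0: "x(0 := 0) \<in> half_D h" using that h by (auto simp: half_D_def cone_D_def)
      have "k (x(0 := 0)) = b" using fb[OF x0] hpos[OF that] h by (simp add: k_def)
      then show ?thesis using x0 by blast
    qed
    \<comment> \<open>Where the shifted \<open>f\<close> is overruled by \<open>g\<close> its value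
      is \<open>b\<close>, and this label occurs on the seam in any case.\<close>
    have "f x \<in> k ` half_D h" if x: "x \<in> half_D h" for x
    proof (cases "?S x 0 \<le> 0")
      case True
      then have "k (?S x) = f x" by (simp add: k_def ST)
      then show ?thesis using TD(2)[OF x] by (metis imageI)
    next
      case False
      then have "f (?T (?S x)) = b" by (intro fb TD x) (use hpos[OF x] in \<open>simp add: T0\<close>)
      then show ?thesis using bk[OF x] ST by simp
    qed
    moreover have "g x \<in> k ` half_D h" if x: "x \<in> half_D h" for x
    proof (cases "?T x 0 \<le> 0")
      case False
      then have "k (?T x) = g x" by (simp add: k_def ST)
      then show ?thesis using TD(1)[OF x] by (metis imageI)
    next
      case True
      then have "g (?S (?T x)) = b" by (intro gb TD x) (use hpos[OF x] in \<open>simp add: T0\<close>)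
      then show ?thesis using bk[OF x] ST by simp
    qed
    ultimately show "Z \<union> Y \<subseteq> k ` half_D h" using F(4) G(4) by blast
  qed
  ultimately show ?thesis unfolding is_strip_def by blast
qed

text \<open>On the face where coordinate \<open>h\<close> is 0 only coordinate 0 is left, and there
  \<open>y\<close> is placed at the origin with \<open>a\<close> and \<open>b\<close> on its two
  sides. By scaling, every label of the strip occurs along a ray starting at the origin, so all
  points above \<open>y\<close> are reached from it.\<close>

lemma cell_of_strip:
  assumes g: "is_strip W R h Z a b g" and h: "1 \<le> h" and y: "y \<in> W"
    and Z: "Z \<subseteq> {u\<in>W. R y u}" "above W R y \<subseteq> Z" and ab: "a \<in> tops y" "b \<in> tops y"
  shows "\<exists>f. is_cell W R (Suc h) y a b f"
proof -
  have G: "sgn_determined (Suc h) g" "open_onto W R (half_D h) g" "has_ends (half_D h) h a b g" "g ` half_D h = Z"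
    using g by (simp_all add: is_strip_def)
  obtain N where N: "0 \<le> N" "\<forall>x\<in>half_D h. (x 0 < - N * x h \<longrightarrow> g x = a) \<and> (N * x h < x 0 \<longrightarrow> g x = b)"
    using G(3) unfolding has_ends_def by blast
  define f where "f = (\<lambda>x::vec. if 0 < x h then g x else if x 0 < 0 then a else if x 0 = 0 then y else b)"
  have det: "sgn_determined (Suc h) f" unfolding f_def
    apply (rule sgn_determined_If[where i = h], rule G(1))
      apply (rule sgn_determined_If[where i = 0], rule sgn_determined_const)
        apply (rule sgn_determined_If[where i = 0], rule sgn_determined_const, rule sgn_determined_const)
         apply (auto simp: sgn_if split: if_splits)
    done
  have Dh: "0 \<le> x h" if "x \<in> cone_D" for x using cone_D_nonneg[OF that h] .
  have fy: "R y (f x) \<and> f x \<in> W" if x: "x \<in> cone_D" for x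
  proof (cases "0 < x h")
    case True
    then have "g x \<in> Z" using G(4) x unfolding half_D_def by blast
    then show ?thesis using True Z(1) by (auto simp: f_def)
  next
    case False
    then show ?thesis using ab y poset_refl[OF pos y] by (auto simp: f_def tops_def)
  qed
  have fa: "f x = a" if "x \<in> cone_D" "x 0 < - N * x h" for x
  proof (cases "0 < x h")
    case True
    then show ?thesis using N(2) that by (auto simp: f_def half_D_def)
  next
    case False
    then have "x h = 0" using Dh[OF that(1)] by simp
    then show ?thesis using that by (simp add: f_def)
  qed
  have fb: "f x = b" if "x \<in> cone_D" "N * x h < x 0" for x
  proof (cases "0 < x h")
    case True
    then show ?thesis using N(2) that by (auto simp: f_def half_D_def)
  next
    case False
    then have "x h = 0" using Dh[OF that(1)] by simp
    then show ?thesis using that by (simp add: f_def)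
  qed
  have inD: "p + t *\<^sub>R q \<in> cone_D" if "p \<in> cone_D" "q \<in> cone_D" "0 < t" for p q t
    using cone_D_add[OF that(1) cone_D_scale[OF that(2)]] that(3) by simp
  have "open_onto W R cone_D f"
  proof (rule open_ontoI)
    fix p assume p: "p \<in> cone_D"
    show "f p \<in> W" using fy[OF p] by simp
    have inner: "f (p + t *\<^sub>R q) = g (p + t *\<^sub>R q)" if "0 < p h" "q \<in> cone_D" "0 < t" for q t
      using that Dh[OF that(2)] by (simp add: f_def ray_coord add_pos_nonneg)
    \<comment> \<open>A short move from the left half of that face stays to the left of
      \<open>- N\<close> times coordinate \<open>h\<close>, in the constant end of the
      strip.\<close>
    have left: "\<forall>\<^sub>F t in at_right 0. f (p + t *\<^sub>R q) = a" if "p h = 0" "p 0 < 0" "q \<in> cone_D" for q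
    proof -
      have "\<forall>\<^sub>F t in at_right 0. 0 < - p 0 + t * (- q 0 - N * q h)"
        by (rule eventually_affine_pos) (use that in simp)
      with eventually_right_pos show ?thesis
        by eventually_elim (rule fa, use inD p that in \<open>auto simp: ray_coord algebra_simps\<close>)
    qed
    have right: "\<forall>\<^sub>F t in at_right 0. f (p + t *\<^sub>R q) = b" if "p h = 0" "0 < p 0" "q \<in> cone_D" for q
    proof -
      have "\<forall>\<^sub>F t in at_right 0. 0 < p 0 + t * (q 0 - N * q h)"
        by (rule eventually_affine_pos) (use that in simp)
      with eventually_right_pos show ?thesis
        by eventually_elim (rule fb, use inD p that in \<open>auto simp: ray_coord algebra_simps\<close>)
    qed
    have "0 < p h \<or> p h = 0" using Dh[OF p] by auto
    then consider "0 < p h" | "p h = 0" "p 0 < 0" | "p h = 0" "p 0 = 0" | "p h = 0" "0 < p 0" by linarith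
    note cases = this
    show "\<forall>\<^sub>F t in at_right 0. R (f p) (f (p + t *\<^sub>R q))" if q: "q \<in> cone_D" for q
      using cases
    proof cases
      case 1
      then have "\<forall>\<^sub>F t in at_right 0. R (g p) (g (p + t *\<^sub>R q))"
        using open_ontoD(2)[OF G(2) _ q] p by (simp add: half_D_def)
      with eventually_right_pos show ?thesis
        by eventually_elim (use 1 inner[OF 1 q] in \<open>simp add: f_def\<close>)
    next
      case 2
      have "f p = a" using 2 by (simp add: f_def)
      then show ?thesis using eventually_top[OF ab(1), where f = f and p = p and q = q, OF left[OF 2 q]] by simp
    next
      case 3
      then have "f p = y" by (simp add: f_def)
      then show ?thesis using eventually_right_pos fy inD[OF p q] by (auto elim: eventually_mono)
    next
      case 4
      have "f p = b" using 4 by (simp add: f_def)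
      then show ?thesis using eventually_top[OF ab(2), where f = f and p = p and q = q, OF right[OF 4 q]] by simp
    qed
    show "\<exists>q\<in>cone_D. \<forall>\<^sub>F t in at_right 0. f (p + t *\<^sub>R q) = z" if z: "z \<in> W" "R (f p) z" for z
    proof (cases "z = f p")
      case True
      then show ?thesis using lift_self[of f p] by simp
    next
      case False
      from cases show ?thesis
      proof cases
        case 1
        then obtain q where q: "q \<in> cone_D" "\<forall>\<^sub>F t in at_right 0. g (p + t *\<^sub>R q) = z"
          using open_ontoD(3)[OF G(2), of p z] p z by (auto simp: half_D_def f_def)
        have "\<forall>\<^sub>F t in at_right 0. f (p + t *\<^sub>R q) = z"
          using eventually_right_pos q(2) by eventually_elim (use inner[OF 1 q(1)] in simp)
        then show ?thesis using q(1) by blast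
      next
        case 2
        then show ?thesis using topD[OF ab(1) z(1)] z(2) False by (simp add: f_def)
      next
        case 4
        then show ?thesis using topD[OF ab(2) z(1)] z(2) False by (simp add: f_def)
      next
        case 3
        then have fp: "f p = y" by (simp add: f_def)
        then have "z \<in> Z" using z False Z(2) by (auto simp: above_def)
        then obtain x where x: "x \<in> cone_D" "0 < x h" "g x = z" using G(4) by (auto simp: half_D_def)
        have "f (p + t *\<^sub>R x) = z" if t: "0 < t" for t
        proof -
          have "p i = 0" if "i < Suc h" for i
          proof (cases "i = 0")
            case False
            then have "p i \<le> p h" "0 \<le> p i" using cone_D_mono[OF p, of i h] cone_D_nonneg[OF p, of i] that by auto
            then show ?thesis using 3 by simp
          qed (use 3 in simp)
          then have "f (p + t *\<^sub>R x) = f (t *\<^sub>R x)" by (intro sgn_determined_agree[OF det]) simp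
          also have "\<dots> = f x" by (rule sgn_determined_scale[OF det t])
          finally show ?thesis using x by (simp add: f_def)
        qed
        then have "\<forall>\<^sub>F t in at_right 0. f (p + t *\<^sub>R x) = z"
          by (rule eventually_mono[OF eventually_right_pos])
        then show ?thesis using x(1) by blast
      qed
    qed
  qed
  moreover have "has_ends cone_D (Suc h) a b f"
    unfolding has_ends_def
  proof (intro exI[of _ N] conjI ballI impI)
    fix x assume x: "x \<in> cone_D"
    have "N * x h \<le> N * x (Suc h)"
      using cone_D_mono[OF x h, of "Suc h"] N(1) by (intro mult_left_mono) auto
    then show "x 0 < - N * x (Suc h) \<Longrightarrow> f x = a" "N * x (Suc h) < x 0 \<Longrightarrow> f x = b"
      using fa[OF x] fb[OF x] by auto
  qed (rule N(1))
  moreover have "f 0 = y" by (simp add: f_def)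
  ultimately show ?thesis using det unfolding is_cell_def by blast
qed

text \<open>The start of the construction. Only the sign of coordinate 0 is available, so at most
  two labels besides \<open>y\<close> can be placed.\<close>

lemma cell_1:
  assumes y: "y \<in> W" and up: "\<And>u. u \<in> W \<Longrightarrow> R y u \<Longrightarrow> u \<in> {y, a, b}" and ab: "a \<in> tops y" "b \<in> tops y"
  shows "\<exists>f. is_cell W R 1 y a b f"
proof -
  define f where "f = (\<lambda>x::vec. if x 0 < 0 then a else if x 0 = 0 then y else b)"
  have det: "sgn_determined 1 f" unfolding f_def
    apply (rule sgn_determined_If[where i = 0], rule sgn_determined_const)
     apply (rule sgn_determined_If[where i = 0], rule sgn_determined_const, rule sgn_determined_const)
      apply (auto simp: sgn_if split: if_splits)
    done
  have fy: "R y (f x) \<and> f x \<in> W" for x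
    using ab y poset_refl[OF pos y] by (auto simp: f_def tops_def)
  have "open_onto W R cone_D f"
  proof (rule open_ontoI)
    fix p assume p: "p \<in> cone_D"
    show "f p \<in> W" using fy by simp
    have left: "\<forall>\<^sub>F t in at_right 0. f (p + t *\<^sub>R q) = a" if "p 0 < 0" for q
    proof -
      have "\<forall>\<^sub>F t in at_right 0. 0 < - p 0 + t * (- q 0)" by (rule eventually_affine_pos) (use that in simp)
      then show ?thesis by (rule eventually_mono) (simp add: f_def ray_coord)
    qed
    have right: "\<forall>\<^sub>F t in at_right 0. f (p + t *\<^sub>R q) = b" if "0 < p 0" for q
    proof -
      have "\<forall>\<^sub>F t in at_right 0. 0 < p 0 + t * q 0" by (rule eventually_affine_pos) (use that in simp)
      then show ?thesis by (rule eventually_mono) (simp add: f_def ray_coord)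
    qed
    consider "p 0 < 0" | "p 0 = 0" | "0 < p 0" by linarith
    note cases = this
    show "\<forall>\<^sub>F t in at_right 0. R (f p) (f (p + t *\<^sub>R q))" for q
      using cases
    proof cases
      case 1
      have "f p = a" using 1 by (simp add: f_def)
      then show ?thesis using eventually_top[OF ab(1), where f = f and p = p and q = q, OF left[OF 1]] by simp
    next
      case 2
      then have "f p = y" by (simp add: f_def)
      then show ?thesis using fy by simp
    next
      case 3
      have "f p = b" using 3 by (simp add: f_def)
      then show ?thesis using eventually_top[OF ab(2), where f = f and p = p and q = q, OF right[OF 3]] by simp
    qed
    show "\<exists>q\<in>cone_D. \<forall>\<^sub>F t in at_right 0. f (p + t *\<^sub>R q) = z" if z: "z \<in> W" "R (f p) z" for z
    proof (cases "z = f p")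
      case True
      then show ?thesis using lift_self[of f p] by simp
    next
      case False
      from cases show ?thesis
      proof cases
        case 1
        then show ?thesis using topD[OF ab(1) z(1)] z(2) False by (simp add: f_def)
      next
        case 3
        then show ?thesis using topD[OF ab(2) z(1)] z(2) False by (simp add: f_def)
      next
        case 2
        then have fp: "f p = y" by (simp add: f_def)
        then have zab: "z = a \<or> z = b" using up[OF z(1)] z(2) False by auto
        define q :: vec where "q = (\<lambda>i. if i = 0 then (if z = a then - 1 else 1) else 0)"
        have "f (p + t *\<^sub>R q) = z" if "0 < t" for t
          using zab 2 that by (auto simp: f_def q_def ray_coord)
        then have "\<forall>\<^sub>F t in at_right 0. f (p + t *\<^sub>R q) = z"
          by (rule eventually_mono[OF eventually_right_pos])
        moreover have "q \<in> cone_D" by (simp add: q_def cone_D_def)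
        ultimately show ?thesis by blast
      qed
    qed
  qed
  moreover have "has_ends cone_D 1 a b f"
    unfolding has_ends_def by (intro exI[of _ 0]) (simp add: f_def)
  moreover have "f 0 = y" by (simp add: f_def)
  ultimately show ?thesis using det unfolding is_cell_def by blast
qed

text \<open>The strip is followed by its mirror image: a walk to \<open>c\<close> and back.\<close>

lemma strip_loop:
  assumes h: "1 \<le> h" and c: "is_strip W R h Z a c f" and a: "a \<in> tops z" "c \<in> tops z'"
  shows "\<exists>g. is_strip W R h Z a a g"
  using strip_concat[OF c strip_mirror[OF c h] h a(2)] by simp

text \<open>By induction on \<open>h\<close>. In the step, all tops above \<open>z\<close> are linked by strips since the frame splits
  nowhere above points of larger depth; walking along such strips one passes every point above \<open>z\<close>.\<close>

lemma cell_exists: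
  assumes "1 \<le> h" "z \<in> W" "depth_le W R h z"
  shows "(\<forall>a\<in>tops z. \<forall>b\<in>tops z. a \<noteq> b \<longrightarrow> (\<exists>f. is_cell W R h z a b f))
    \<and> (\<forall>a\<in>tops z. \<exists>b\<in>tops z. \<exists>f. is_cell W R h z a b f)"
  using assms
proof (induction h arbitrary: z rule: dec_induct)
  case base
  have top: "u \<in> tops z" if "u \<in> above W R z" for u
    using that base by (auto simp: tops_def above_def)
  \<comment> \<open>All points above \<open>z\<close> are maximal here, so any set of them is an
    upset. A third point would give a splitting into \<open>{a}\<close> and a part that is not a
    singleton.\<close>
  have two: "u = a \<or> u = b" if ab: "a \<in> above W R z" "b \<in> above W R z" "a \<noteq> b" and u: "u \<in> above W R z" for a b u
  proof (rule ccontr)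
    assume n: "\<not> ?thesis"
    let ?B = "above W R z - {a}"
    have up: "upset W R X" if "X \<subseteq> above W R z" for X
    proof (rule upsetI)
      show "X \<subseteq> W" using that by (auto simp: above_def)
      fix x y assume x: "x \<in> X" and y: "y \<in> W" "R x y"
      have "y = x" using topD[OF top y] x that by blast
      then show "y \<in> X" using x by simp
    qed
    have "is_singleton ?B"
    proof -
      have "upset W R {a}" "upset W R ?B" by (rule up, use ab in blast)+
      moreover have "{a} \<union> ?B = above W R z" "{a} \<inter> ?B = {}" "{a} \<noteq> {}" "?B \<noteq> {}" using ab by auto
      ultimately show ?thesis
        using pl[unfolded pl_frame_def, rule_format, OF base.prems(1), of "{a}" ?B] by simp
    qed
    then obtain t where t: "?B = {t}" unfolding is_singleton_def by blast
    have "b \<in> ?B" "u \<in> ?B" using ab u n by auto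
    then have "b = t" "u = t" unfolding t by simp_all
    then show False using n by simp
  qed
  have tz: "a = z \<or> a \<in> above W R z" if "a \<in> tops z" for a using that by (auto simp: tops_def above_def)
  have cell: "\<exists>f. is_cell W R 1 z a b f"
    if "a \<in> tops z" "b \<in> tops z" "above W R z \<subseteq> {a, b}" for a b
    by (rule cell_1[OF base.prems(1) _ that(1,2)]) (use that(3) in \<open>auto simp: above_def\<close>)
  \<comment> \<open>With a single coordinate and two tops, a cell with \<open>a\<close> at both ends
    would miss the other top. For this reason the second claim leaves the opposite end to be
    chosen.\<close>
  show ?case
  proof (intro conjI ballI impI)
    fix a b assume a: "a \<in> tops z" and b: "b \<in> tops z" and ab: "a \<noteq> b"
    have "a \<noteq> z" using topD[OF a tops_W[OF b]] b ab by (auto simp: tops_def)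
    moreover have "b \<noteq> z" using topD[OF b tops_W[OF a]] a ab by (auto simp: tops_def)
    ultimately have "above W R z \<subseteq> {a, b}" using two[OF _ _ ab] tz a b by blast
    then show "\<exists>f. is_cell W R 1 z a b f" by (rule cell[OF a b])
  next
    fix a assume a: "a \<in> tops z"
    show "\<exists>b\<in>tops z. \<exists>f. is_cell W R 1 z a b f"
    proof (cases "above W R z \<subseteq> {a}")
      case True
      then show ?thesis using cell[OF a a] a by auto
    next
      case False
      then obtain b where b: "b \<in> above W R z" "b \<noteq> a" by blast
      have "a \<noteq> z" using topD[OF a, of b] b by (auto simp: above_def)
      then have "above W R z \<subseteq> {a, b}" using two[of a b] tz[OF a] b by blast
      then show ?thesis using cell[OF a top[OF b(1)]] top[OF b(1)] by blast
    qed
  qed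
next
  case (step h)
  note h = step.hyps(1)
  have z: "z \<in> W" by (rule step.prems)
  let ?U = "\<lambda>w. {u\<in>W. R w u}"
  \<comment> \<open>With one more coordinate available equal ends become possible: a strip from
    \<open>a\<close> to some \<open>c\<close> and its mirror image are joined.\<close>
  have strip: "\<exists>f. is_strip W R h (?U w) a b f"
    if w: "w \<in> W" "depth_le W R h w" and ab: "a \<in> tops w" "b \<in> tops w" for w a b
  proof (cases "a = b")
    case False
    then obtain f where "is_cell W R h w a b f" using step.IH[OF w] ab by blast
    then show ?thesis using strip_of_cell h by blast
  next
    case True
    obtain c f where c: "c \<in> tops w" "is_cell W R h w a c f" using step.IH[OF w] ab(1) by blast
    then show ?thesis using strip_loop[OF h strip_of_cell[OF c(2) h] ab(1) c(1)] True by blast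
  qed
  have all: "\<exists>f. is_cell W R (Suc h) z a b f" if a: "a \<in> tops z" and b: "b \<in> tops z" for a b
  proof (cases "depth_le W R h z")
    \<comment> \<open>A strip that carries all labels from \<open>z\<close> upwards exists already
      and only needs an apex. This covers in particular a point with just two tops above it, where
      no walk from one to the other avoids the label \<open>z\<close>.\<close>
    case True
    then obtain f where "is_strip W R h (?U z) a b f" using strip[OF z True a b] by blast
    then show ?thesis using cell_of_strip[OF _ h z order_refl _ a b] by (auto simp: above_def)
  next
    case False
    let ?A = "above W R z"
    have Adepth: "depth_le W R h w" "w \<in> W" "R z w" if "w \<in> ?A" for w
      using that step.prems(2) by (auto simp: above_def)
    have Aup: "?U w \<subseteq> ?A" if "w \<in> ?A" for w
      using upset_above[OF pos z] that unfolding upset_def by blast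
    have ts: "tops w \<subseteq> tops z" if "w \<in> ?A" for w using tops_mono[OF z Adepth(2,3)[OF that]] .
    define link where "link = (\<lambda>c d. \<exists>Z f. Z \<subseteq> ?A \<and> is_strip W R h Z c d f)"
    have link_w: "link c d" if "w \<in> ?A" "c \<in> tops w" "d \<in> tops w" for w c d
      using strip[OF Adepth(2,1)[OF that(1)] that(2,3)] Aup[OF that(1)] unfolding link_def by blast
    have link_trans: "link c e" if cde: "link c d" "link d e" "d \<in> tops z" for c d e
    proof -
      obtain Z f Y g where "Z \<subseteq> ?A" "is_strip W R h Z c d f" "Y \<subseteq> ?A" "is_strip W R h Y d e g"
        using cde(1,2) unfolding link_def by blast
      moreover obtain k where "is_strip W R h (Z \<union> Y) c e k"
        using strip_concat[OF calculation(2,4) h cde(3)] by blast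
      ultimately show ?thesis unfolding link_def by blast
    qed
    have nd1: "\<exists>s\<in>?A. above W R s \<noteq> {}"
    proof (rule ccontr)
      assume "\<not> ?thesis"
      then have "depth_le W R 1 z" by auto
      then show False using False depth_le_mono[OF h] by blast
    qed
    have tA: "c \<in> ?A" if "c \<in> tops z" for c
    proof -
      obtain s where s: "s \<in> ?A" using nd1 by blast
      have "c \<noteq> z" using topD[OF that, of s] s by (auto simp: above_def)
      then show ?thesis using that by (simp add: tops_def above_def)
    qed
    have tt: "c \<in> tops c" if "c \<in> tops z" for c
      using that poset_refl[OF pos] by (auto simp: tops_def)
    \<comment> \<open>The points with a top that can be reached from \<open>a\<close> without
      meeting the label \<open>z\<close>. Both \<open>A1\<close> and its complement in
      \<open>?A\<close> turn out to be upsets. If the complement were nonempty, both would be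
      singletons and all points above \<open>z\<close> maximal, which contradicts the depth of
      \<open>z\<close>.\<close>
    define A1 where "A1 = {w\<in>?A. \<exists>c\<in>tops w. link a c}"
    have A1_all: "link a d" if wd: "w \<in> A1" "d \<in> tops w" for w d
    proof -
      obtain c where c: "w \<in> ?A" "c \<in> tops w" "link a c" using wd(1) by (auto simp: A1_def)
      show ?thesis using link_trans[OF c(3) link_w[OF c(1,2) wd(2)]] ts[OF c(1)] c(2) by blast
    qed
    have up1: "upset W R A1"
    proof (rule upsetI)
      fix w u assume w: "w \<in> A1" and u: "u \<in> W" "R w u"
      have wA: "w \<in> ?A" using w by (simp add: A1_def)
      obtain d where d: "d \<in> tops u" using tops_nonempty[OF u(1)] by blast
      then have "d \<in> tops w" using tops_mono[OF Adepth(2)[OF wA] u] by blast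
      then have "link a d" by (rule A1_all[OF w])
      then show "u \<in> A1" using Aup[OF wA] u d by (auto simp: A1_def)
    qed (auto simp: A1_def above_def)
    have up2: "upset W R (?A - A1)"
    proof (rule upsetI)
      fix w u assume w: "w \<in> ?A - A1" and u: "u \<in> W" "R w u"
      have uA: "u \<in> ?A" using Aup[of w] w u by blast
      have "u \<notin> A1"
      proof
        assume u1: "u \<in> A1"
        obtain d where d: "d \<in> tops u" using tops_nonempty[OF u(1)] by blast
        then have "d \<in> tops w" using tops_mono[OF Adepth(2) u] w by blast
        then show False using A1_all[OF u1 d] w by (auto simp: A1_def)
      qed
      then show "u \<in> ?A - A1" using uA by blast
    qed (auto simp: above_def)
    have aA: "a \<in> A1" using link_w[OF tA[OF a] tt[OF a] tt[OF a]] tA[OF a] tt[OF a] by (auto simp: A1_def)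
    have A1: "A1 = ?A"
    proof (rule ccontr)
      assume n: "A1 \<noteq> ?A"
      have sub: "A1 \<subseteq> ?A" by (auto simp: A1_def)
      have "is_singleton A1 \<and> is_singleton (?A - A1)"
        by (rule pl[unfolded pl_frame_def, rule_format, OF z]) (use up1 up2 sub n aA in auto)
      then obtain p q where pq: "A1 = {p}" "?A - A1 = {q}" unfolding is_singleton_def by blast
      have "above W R s = {}" if s: "s \<in> ?A" for s
      proof -
        have "u = s" if u: "u \<in> W" "R s u" for u
        proof (cases "s \<in> A1")
          case True
          then show ?thesis using upsetD[OF up1 True u] pq(1) by simp
        next
          case False
          then have "s \<in> ?A - A1" using s by blast
          then show ?thesis using upsetD[OF up2 _ u] unfolding pq(2) by simp
        qed
        then show ?thesis by (auto simp: above_def)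
      qed
      then show False using nd1 by blast
    qed
    \<comment> \<open>One point \<open>w\<close> is visited at a time: a link leads from
      \<open>a\<close> to a top of \<open>w\<close>, the strip of \<open>w\<close> is passed, and
      the whole walk is reflected to return to \<open>a\<close>.\<close>
    have loop: "\<exists>Z f. X \<subseteq> Z \<and> Z \<subseteq> ?A \<and> is_strip W R h Z a a f" if "finite X" "X \<subseteq> ?A" for X
      using that
    proof (induction X rule: finite_induct)
      case empty
      then show ?case using link_w[OF tA[OF a] tt[OF a] tt[OF a]] unfolding link_def by blast
    next
      case (insert w X)
      then obtain Z f where Z: "X \<subseteq> Z" "Z \<subseteq> ?A" "is_strip W R h Z a a f" by auto
      have w: "w \<in> ?A" using insert by blast
      obtain c where c: "c \<in> tops w" using tops_nonempty[OF Adepth(2)[OF w]] by blast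
      have cz: "c \<in> tops z" using ts[OF w] c by blast
      have "link a c" using A1_all[of w c] w c A1 by blast
      then obtain Y g where Y: "Y \<subseteq> ?A" "is_strip W R h Y a c g" unfolding link_def by blast
      obtain e where e: "is_strip W R h (?U w) c c e" using strip[OF Adepth(2,1)[OF w] c c] by blast
      obtain k1 where k1: "is_strip W R h (Z \<union> Y) a c k1" using strip_concat[OF Z(3) Y(2) h a] by blast
      obtain k2 where k2: "is_strip W R h (Z \<union> Y \<union> ?U w) a c k2" using strip_concat[OF k1 e h cz] by blast
      obtain k3 where k3: "is_strip W R h (Z \<union> Y \<union> ?U w) a a k3" using strip_loop[OF h k2 a cz] by blast
      have "insert w X \<subseteq> Z \<union> Y \<union> ?U w" using Z(1) Adepth(2)[OF w] poset_refl[OF pos] by blast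
      moreover have "Z \<union> Y \<union> ?U w \<subseteq> ?A" using Z(2) Y(1) Aup[OF w] by blast
      ultimately show ?case using k3 by blast
    qed
    obtain Z f where Z: "?A \<subseteq> Z" "Z \<subseteq> ?A" "is_strip W R h Z a a f"
      using loop[OF finite_above[OF fin] order_refl] by blast
    have "link a b" using A1_all[of b b] tA[OF b] tt[OF b] A1 by blast
    then obtain Y g where Y: "Y \<subseteq> ?A" "is_strip W R h Y a b g" unfolding link_def by blast
    obtain k where k: "is_strip W R h (Z \<union> Y) a b k" using strip_concat[OF Z(3) Y(2) h a] by blast
    show ?thesis
      by (rule cell_of_strip[OF k h z _ _ a b]) (use Z Y(1) in \<open>auto simp: above_def\<close>)
  qed
  then show ?case by blast
qed

lemma realisation:
  assumes "y \<in> W" "depth_le W R n y"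
  shows "\<exists>f. sgn_determined n f \<and> open_onto W R cone_D f \<and> f 0 = y"
proof (cases "n = 0")
  case True
  then have "u = y" if "u \<in> W" "R y u" for u using assms(2) that by (auto simp: above_def)
  then have "open_onto W R cone_D (\<lambda>_. y)"
    using assms(1) poset_refl[OF pos assms(1)] lift_self[of "\<lambda>_. y"] by (intro open_ontoI) auto
  then show ?thesis using sgn_determined_const by blast
next
  case False
  obtain a where "a \<in> tops y" using tops_nonempty[OF assms(1)] by blast
  then obtain b f where "is_cell W R n y a b f"
    using cell_exists[OF _ assms] False by (metis One_nat_def Suc_leI neq0_conv)
  then show ?thesis unfolding is_cell_def by blast
qed

end

section \<open>From the cone to a convex polytope\<close>

definition first_unit :: "nat \<Rightarrow> vec" where
  "first_unit n = (\<lambda>i. if i = 0 \<and> 0 < n then 1 else 0)"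

text \<open>Together with the first unit vector and its negative, these generate the cone formed by
  the first \<open>n\<close> coordinates of points of \<open>cone_D\<close>. For
  \<open>j = n\<close> the vector is 0.\<close>

definition step_vec :: "nat \<Rightarrow> nat \<Rightarrow> vec" where
  "step_vec n j = (\<lambda>i. if j \<le> i \<and> i < n then 1 else 0)"

definition cone_polytope :: "nat \<Rightarrow> vec set" where
  "cone_polytope n = convex hull ({first_unit n, - first_unit n} \<union> step_vec n ` {1..n})"

lemma cone_polytope_Rd: "{first_unit n, - first_unit n} \<union> step_vec n ` {1..n} \<subseteq> Rd n"
  by (auto simp: Rd_def first_unit_def step_vec_def)

lemma cone_polytope_polyhedron: "polyhedron (cone_polytope n)"
  unfolding cone_polytope_def by (rule polyhedron_convex_hull[OF _ cone_polytope_Rd]) simp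

lemma cone_polytope_Convex: "cone_polytope n \<in> Convex n"
  using cone_polytope_polyhedron poly_dim_le[OF hull_subset_Rd[OF cone_polytope_Rd]]
  unfolding Convex_def cone_polytope_def by simp

lemma zero_cone_polytope: "0 \<in> cone_polytope n"
proof -
  have "first_unit n \<in> cone_polytope n" "- first_unit n \<in> cone_polytope n"
    unfolding cone_polytope_def by (simp_all add: hull_inc)
  then have "(1/2) *\<^sub>R first_unit n + (1/2) *\<^sub>R (- first_unit n) \<in> cone_polytope n"
    unfolding cone_polytope_def by (intro convexD convex_convex_hull) auto
  then show ?thesis by simp
qed

lemma cone_polytope_in_cone:
  assumes "p \<in> cone_polytope n"
  shows "\<exists>x\<in>cone_D. \<forall>i<n. x i = p i"
proof -
  let ?C = "{p. \<exists>x\<in>cone_D. \<forall>i<n. x i = p i}"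
  have "convex ?C"
  proof (rule convexI)
    fix p q :: vec and u v :: real assume p: "p \<in> ?C" and q: "q \<in> ?C" and uv: "0 \<le> u" "0 \<le> v" "u + v = 1"
    obtain x y where xy: "x \<in> cone_D" "\<forall>i<n. x i = p i" "y \<in> cone_D" "\<forall>i<n. y i = q i" using p q by blast
    have "u *\<^sub>R x + v *\<^sub>R y \<in> cone_D" using xy uv by (intro cone_D_add cone_D_scale) auto
    moreover have "\<forall>i<n. (u *\<^sub>R x + v *\<^sub>R y) i = (u *\<^sub>R p + v *\<^sub>R q) i" using xy by (simp add: ray_coord)
    ultimately show "u *\<^sub>R p + v *\<^sub>R q \<in> ?C" by blast
  qed
  moreover have "{first_unit n, - first_unit n} \<union> step_vec n ` {1..n} \<subseteq> ?C"
  proof -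
    have "first_unit n \<in> cone_D" "- first_unit n \<in> cone_D" by (auto simp: first_unit_def cone_D_def)
    moreover have "step_vec n j \<in> ?C" if "j \<in> {1..n}" for j
    proof (rule CollectI)
      show "\<exists>x\<in>cone_D. \<forall>i<n. x i = step_vec n j i"
        by (rule bexI[of _ "\<lambda>i. if j \<le> i then 1 else 0"]) (use that in \<open>auto simp: step_vec_def cone_D_def\<close>)
    qed
    moreover have "first_unit n \<in> ?C" "- first_unit n \<in> ?C" using calculation(1,2) by blast+
    ultimately show ?thesis by blast
  qed
  ultimately show ?thesis using assms hull_minimal[of _ ?C convex] unfolding cone_polytope_def by blast
qed

lemma sum_scaleR_coord: "(\<Sum>j\<in>A. c j *\<^sub>R v j) i = (\<Sum>j\<in>A. c j * v j i)" for v :: "'b \<Rightarrow> vec"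
  by (induction A rule: infinite_finite_induct) (auto simp: ray_coord)

text \<open>The points with a positive multiple in the polytope form a convex cone \<open>K\<close>,
  since the polytope is convex and contains 0. The first \<open>n\<close> coordinates of
  \<open>x\<close> are a nonnegative combination of generators: the coefficients \<open>c j\<close>
  of the step vectors are the increments of the monotone coordinates, and their partial sums
  telescope.\<close>

lemma cone_in_cone_polytope:
  assumes x: "x \<in> cone_D"
  shows "\<exists>p\<in>cone_polytope n. \<exists>e>0. \<forall>i<n. p i = e * x i"
proof -
  let ?P = "cone_polytope n"
  have cP: "convex ?P" by (simp add: cone_polytope_def)
  have star: "t *\<^sub>R p \<in> ?P" if "p \<in> ?P" "0 \<le> t" "t \<le> 1" for p t
    using convexD[OF cP that(1) zero_cone_polytope, of t "1 - t"] that by simp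
  define K where "K = {x. \<exists>e>0. e *\<^sub>R x \<in> ?P}"
  have K_P: "p \<in> K" if "p \<in> ?P" for p unfolding K_def using that by (intro CollectI exI[of _ 1]) simp
  have K_scale: "t *\<^sub>R p \<in> K" if p: "p \<in> K" and t: "0 \<le> t" for p t
  proof (cases "t = 0")
    case True
    then show ?thesis using K_P[OF zero_cone_polytope] by simp
  next
    case False
    obtain e where "0 < e" "e *\<^sub>R p \<in> ?P" using p unfolding K_def by blast
    then show ?thesis unfolding K_def using False t by (intro CollectI exI[of _ "e / t"]) auto
  qed
  have K_add: "p + q \<in> K" if pq: "p \<in> K" "q \<in> K" for p q
  proof -
    obtain e d where ed: "0 < e" "e *\<^sub>R p \<in> ?P" "0 < d" "d *\<^sub>R q \<in> ?P"
      using pq unfolding K_def by blast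
    define m where "m = min e d"
    have m: "0 < m" "m \<le> e" "m \<le> d" using ed by (auto simp: m_def)
    have "(m / e) *\<^sub>R (e *\<^sub>R p) \<in> ?P" by (rule star[OF ed(2)]) (use m ed in auto)
    moreover have "(m / d) *\<^sub>R (d *\<^sub>R q) \<in> ?P" by (rule star[OF ed(4)]) (use m ed in auto)
    ultimately have "m *\<^sub>R p \<in> ?P" "m *\<^sub>R q \<in> ?P" using ed by auto
    then have "(1/2) *\<^sub>R (m *\<^sub>R p) + (1/2) *\<^sub>R (m *\<^sub>R q) \<in> ?P" by (intro convexD cP) auto
    then have "(m / 2) *\<^sub>R (p + q) \<in> ?P" by (simp add: scaleR_add_right)
    then show ?thesis unfolding K_def using m by (intro CollectI exI[of _ "m / 2"]) simp
  qed
  have K_sum: "(\<Sum>j\<in>A. f j) \<in> K" if "finite A" "\<And>j. j \<in> A \<Longrightarrow> f j \<in> K" for A :: "nat set" and f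
    using that by (induction A rule: finite_induct) (auto intro: K_add K_P zero_cone_polytope)
  define c where "c = (\<lambda>j. if j = 1 then x 1 else x j - x (j - 1))"
  have c0: "0 \<le> c j" if j: "1 \<le> j" for j
  proof (cases "j = 1")
    case False
    then have "x (j - 1) \<le> x j" using cone_D_mono[OF x, of "j - 1" j] j by simp
    then show ?thesis using False by (simp add: c_def)
  qed (use x in \<open>simp add: c_def cone_D_def\<close>)
  have csum: "(\<Sum>j=1..i. c j) = x i" if "1 \<le> i" for i
    using that by (induction i rule: dec_induct) (auto simp: c_def)
  define q where "q = x 0 *\<^sub>R first_unit n + (\<Sum>j=1..n. c j *\<^sub>R step_vec n j)"
  have ax: "first_unit n \<in> ?P" "- first_unit n \<in> ?P" "\<And>j. j \<in> {1..n} \<Longrightarrow> step_vec n j \<in> ?P"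
    unfolding cone_polytope_def by (simp_all add: hull_inc)
  have "x 0 *\<^sub>R first_unit n \<in> K"
  proof (cases "0 \<le> x 0")
    case False
    then have "(- x 0) *\<^sub>R (- first_unit n) \<in> K" by (intro K_scale K_P ax) simp
    then show ?thesis by simp
  qed (intro K_scale K_P ax)
  moreover have "(\<Sum>j=1..n. c j *\<^sub>R step_vec n j) \<in> K"
    by (intro K_sum K_scale K_P ax) (auto intro: c0)
  ultimately have "q \<in> K" unfolding q_def by (rule K_add)
  then obtain e where e: "0 < e" "e *\<^sub>R q \<in> ?P" unfolding K_def by blast
  have "q i = x i" if i: "i < n" for i
  proof -
    have "q i = x 0 * first_unit n i + (\<Sum>j=1..n. c j * step_vec n j i)"
      by (simp add: q_def ray_coord sum_scaleR_coord)
    also have "(\<Sum>j=1..n. c j * step_vec n j i) = (\<Sum>j=1..i. c j)"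
      by (rule sum.mono_neutral_cong_right) (use i in \<open>auto simp: step_vec_def\<close>)
    finally show ?thesis using csum[of i] i by (cases "i = 0") (auto simp: first_unit_def)
  qed
  then show ?thesis using e by (intro bexI[OF _ e(2)] exI[of _ e]) (simp add: ray_coord)
qed

lemma sgn_add_mult:
  fixes a b t :: real
  assumes "a \<noteq> 0 \<longrightarrow> sgn b = sgn a" "0 < t"
  shows "sgn (a + t * b) = sgn b"
proof -
  consider "a = 0" | "0 < a" "0 < b" | "a < 0" "b < 0"
    using assms(1) by (cases "a = 0"; cases "0 < a"; cases "0 < b") (auto simp: sgn_if split: if_splits)
  then show ?thesis
  proof cases
    case 1
    then show ?thesis using assms(2) by (simp add: sgn_mult)
  next
    case 2
    then have "0 < a + t * b" using assms(2) by (intro add_pos_pos) auto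
    then show ?thesis using 2 by simp
  next
    case 3
    then have "a + t * b < 0" using assms(2) by (intro add_neg_neg) (auto simp: mult_pos_neg)
    then show ?thesis using 3 by simp
  qed
qed

text \<open>The polytope and \<open>cone_D\<close> realise the same sign vectors, because the
  functions in \<open>M\<close> see the first \<open>n\<close> coordinates only and signs are
  invariant under positive scaling. The labelling thus induces a p-morphism from the cells of the
  polytope into the finite frame, and the refuting valuation is pulled back along it.\<close>

theorem PLn_complete:
  assumes "\<phi> \<notin> PLn n"
  shows "\<exists>P\<in>Convex n. \<not> poly_valid P \<phi>"
proof -
  obtain W R where WR: "finite W" "poset W R" "pl_frame W R" "\<forall>x\<in>W. depth_le W R n x" "\<not> kvalid W R \<phi>"
    using PLn_finite_model[OF assms] by blast
  then obtain V y where V: "\<forall>p. upset W R (V p)" and y: "y \<in> W" "\<not> kforces W R V y \<phi>"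
    unfolding kvalid_def by blast
  interpret pl_poset W R by standard (use WR in auto)
  obtain f where f: "sgn_determined n f" "open_onto W R cone_D f" "f 0 = y"
    using realisation[OF y(1)] WR(4) y(1) by blast
  obtain M where M: "finite M" "\<forall>l\<in>M. coord_linear n l" "\<forall>x y. (\<forall>l\<in>M. sgn (l x) = sgn (l y)) \<longrightarrow> f x = f y"
    using f(1) unfolding sgn_determined_def by blast
  obtain L where L: "set L = M" using finite_list[OF M(1)] by blast
  define P where "P = cone_polytope n"
  have lin: "linear l" and agree: "\<And>x y. (\<And>i. i < n \<Longrightarrow> x i = y i) \<Longrightarrow> l x = l y" if "l \<in> M" for l
    using M(2) that unfolding coord_linear_def by blast+
  have aff: "\<forall>l\<in>set L. affine_fun l"
  proof
    fix l assume "l \<in> set L"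
    then have "affine_fun (\<lambda>x. l x + 0)" using lin L by (intro affine_funI) auto
    then show "affine_fun l" by simp
  qed
  have code_f: "f x = f x'" if "sgn_code L x = sgn_code L x'" for x x'
    using that M(3) L unfolding sgn_code_eq_iff by blast
  have code_agree: "sgn_code L x = sgn_code L x'" if "\<And>i. i < n \<Longrightarrow> x i = x' i" for x x'
  proof -
    have "l x = l x'" if "l \<in> set L" for l by (rule agree) (use that L \<open>\<And>i. i < n \<Longrightarrow> x i = x' i\<close> in auto)
    then show ?thesis unfolding sgn_code_eq_iff by metis
  qed
  have repD: "\<exists>x'\<in>cone_D. sgn_code L x' = sgn_code L x" if "x \<in> P" for x
    using cone_polytope_in_cone[of x n] that code_agree unfolding P_def by blast
  have repP: "\<exists>x\<in>P. sgn_code L x = sgn_code L x'" if x': "x' \<in> cone_D" for x'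
  proof -
    obtain p e where p: "p \<in> P" "0 < e" "\<forall>i<n. p i = e * x' i"
      using cone_in_cone_polytope[OF x', of n] unfolding P_def by blast
    have "sgn_code L p = sgn_code L (e *\<^sub>R x')" by (rule code_agree) (simp add: p(3) ray_coord)
    also have "\<dots> = sgn_code L x'" unfolding sgn_code_eq_iff
      using p(2) lin L by (simp add: linear_cmul sgn_mult)
    finally show ?thesis using p(1) by blast
  qed
  have fW: "f x \<in> W" if "x \<in> P" for x
    using repD[OF that] code_f open_ontoD(1)[OF f(2)] by metis
  \<comment> \<open>Adding a positive multiple of \<open>z'\<close> to \<open>x'\<close> leads into
    the cell of \<open>z'\<close>; for a small multiple \<open>open_onto\<close> compares the
    labels.\<close>
  have mono: "R (f x) (f z)" if x: "x \<in> P" and z: "z \<in> P" and le: "sgn_le L x z" for x z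
  proof -
    obtain x' where x': "x' \<in> cone_D" "sgn_code L x' = sgn_code L x" using repD[OF x] by blast
    obtain z' where z': "z' \<in> cone_D" "sgn_code L z' = sgn_code L z" using repD[OF z] by blast
    have le': "sgn_le L x' z'"
      using sgn_le_trans[OF sgn_le_trans[OF sgn_le_if_code_eq[OF x'(2)] le] sgn_le_if_code_eq[OF z'(2)[symmetric]]] .
    have "\<forall>\<^sub>F t in at_right 0. 0 < t \<and> R (f x') (f (x' + t *\<^sub>R z'))"
      using open_ontoD(2)[OF f(2) x'(1) z'(1)] eventually_right_pos by (simp add: eventually_conj)
    then obtain t where t: "0 < t" "R (f x') (f (x' + t *\<^sub>R z'))"
      using eventually_happens'[of "at_right (0::real)"] by force
    have "sgn_code L (x' + t *\<^sub>R z') = sgn_code L z'" unfolding sgn_code_eq_iff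
    proof
      fix l assume l: "l \<in> set L"
      have "l (x' + t *\<^sub>R z') = l x' + t * l z'" using lin l L by (simp add: linear_add linear_cmul)
      moreover have "l x' \<noteq> 0 \<longrightarrow> sgn (l z') = sgn (l x')" using le' l unfolding sgn_le_def by blast
      moreover have "sgn (a + t * b) = sgn b" if "a \<noteq> 0 \<longrightarrow> sgn b = sgn a" for a b :: real
        by (rule sgn_add_mult[OF that t(1)])
      ultimately show "sgn (l (x' + t *\<^sub>R z')) = sgn (l z')" by simp
    qed
    then show ?thesis using t(2) code_f x'(2) z'(2) by metis
  qed
  \<comment> \<open>The move supplied by \<open>open_onto\<close> is taken so short that the nonzero
    signs at \<open>x'\<close> persist; as there are finitely many functions, one \<open>t\<close>
    serves for all of them.\<close>
  have lift: "\<exists>z\<in>P. sgn_le L x z \<and> f z = u" if x: "x \<in> P" and u: "u \<in> W" "R (f x) u" for x u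
  proof -
    obtain x' where x': "x' \<in> cone_D" "sgn_code L x' = sgn_code L x" using repD[OF x] by blast
    have "R (f x') u" using u(2) code_f[OF x'(2)] by simp
    then obtain q where q: "q \<in> cone_D" "\<forall>\<^sub>F t in at_right 0. f (x' + t *\<^sub>R q) = u"
      using open_ontoD(3)[OF f(2) x'(1) u(1)] by blast
    have "\<forall>\<^sub>F t in at_right 0. l x' \<noteq> 0 \<longrightarrow> sgn (l (x' + t *\<^sub>R q)) = sgn (l x')" if l: "l \<in> M" for l
    proof -
      have e: "l (x' + t *\<^sub>R q) = l x' + t * l q" for t using lin[OF l] by (simp add: linear_add linear_cmul)
      consider "l x' > 0" | "l x' < 0" | "l x' = 0" by linarith
      then show ?thesis
      proof cases
        case 1
        then show ?thesis using eventually_affine_pos[OF 1, of "l q"] unfolding e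
          by (auto elim: eventually_mono)
      next
        case 2
        then have "\<forall>\<^sub>F t in at_right 0. 0 < - l x' + t * (- l q)" by (intro eventually_affine_pos) simp
        then show ?thesis unfolding e by (rule eventually_mono) (use 2 in auto)
      qed simp
    qed
    then have "\<forall>\<^sub>F t in at_right 0. \<forall>l\<in>M. l x' \<noteq> 0 \<longrightarrow> sgn (l (x' + t *\<^sub>R q)) = sgn (l x')"
      by (simp add: eventually_ball_finite_distrib M(1))
    then have "\<forall>\<^sub>F t in at_right 0. 0 < t \<and> f (x' + t *\<^sub>R q) = u \<and> sgn_le L x' (x' + t *\<^sub>R q)"
      using q(2) eventually_right_pos unfolding sgn_le_def L by (simp add: eventually_conj)
    then obtain t where t: "0 < t" "f (x' + t *\<^sub>R q) = u" "sgn_le L x' (x' + t *\<^sub>R q)"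
      using eventually_happens'[of "at_right (0::real)"] by force
    have "x' + t *\<^sub>R q \<in> cone_D" using cone_D_add[OF x'(1) cone_D_scale[OF q(1)]] t(1) by simp
    then obtain z where z: "z \<in> P" "sgn_code L z = sgn_code L (x' + t *\<^sub>R q)" using repP by blast
    have "sgn_le L x z"
      using sgn_le_trans[OF sgn_le_trans[OF sgn_le_if_code_eq[OF x'(2)[symmetric]] t(3)] sgn_le_if_code_eq[OF z(2)[symmetric]]] .
    moreover have "f z = u" using code_f[OF z(2)] t(2) by simp
    ultimately show ?thesis using z(1) by blast
  qed
  define V' where "V' = (\<lambda>p. sgn_code L ` {x\<in>P. f x \<in> V p})"
  have V'_iff: "sgn_code L x \<in> V' p \<longleftrightarrow> f x \<in> V p" if "x \<in> P" for x p
  proof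
    assume "sgn_code L x \<in> V' p"
    then obtain z where "sgn_code L x = sgn_code L z" "f z \<in> V p" unfolding V'_def by blast
    then show "f x \<in> V p" using code_f[of x z] by simp
  qed (use that in \<open>auto simp: V'_def\<close>)
  have V'_up: "upset (cells L P) (cell_le L P) (V' p)" for p
  proof (rule upsetI)
    show "V' p \<subseteq> cells L P" by (auto simp: V'_def cells_def)
    fix u w assume "u \<in> V' p" "w \<in> cells L P" "cell_le L P u w"
    then obtain x z where xz: "x \<in> P" "u = sgn_code L x" "f x \<in> V p" "z \<in> P" "w = sgn_code L z"
      unfolding V'_def cells_def by blast
    then have "R (f x) (f z)" using mono \<open>cell_le L P u w\<close> by (simp add: cell_le_iff)
    then have "f z \<in> V p" using upsetD[of W R "V p"] V xz fW by blast
    then show "w \<in> V' p" using xz V'_iff by simp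
  qed
  have "kforces (cells L P) (cell_le L P) V' (sgn_code L x) a \<longleftrightarrow> kforces W R V (f x) a" if "x \<in> P" for x a
    using that
  proof (induction a arbitrary: x)
    case (Imp a b)
    have "(\<forall>w\<in>cells L P. cell_le L P (sgn_code L x) w \<longrightarrow> kforces (cells L P) (cell_le L P) V' w a
          \<longrightarrow> kforces (cells L P) (cell_le L P) V' w b)
       \<longleftrightarrow> (\<forall>z\<in>P. sgn_le L x z \<longrightarrow> kforces W R V (f z) a \<longrightarrow> kforces W R V (f z) b)"
    proof -
      have "(\<forall>w\<in>cells L P. Q w) \<longleftrightarrow> (\<forall>z\<in>P. Q (sgn_code L z))" for Q by (auto simp: cells_def)
      then show ?thesis using Imp by (simp add: cell_le_iff)
    qed
    also have "\<dots> \<longleftrightarrow> (\<forall>u\<in>W. R (f x) u \<longrightarrow> kforces W R V u a \<longrightarrow> kforces W R V u b)"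
      using mono[OF Imp.prems] lift[OF Imp.prems] fW by metis
    finally show ?case by simp
  qed (simp_all add: V'_iff)
  then have "\<not> kforces (cells L P) (cell_le L P) V' (sgn_code L 0) \<phi>"
    using y(2) f(3) zero_cone_polytope[of n] unfolding P_def by simp
  moreover have "sgn_code L 0 \<in> cells L P" using zero_cone_polytope[of n] by (simp add: cells_def P_def)
  ultimately have "\<not> kvalid (cells L P) (cell_le L P) \<phi>" using V'_up unfolding kvalid_def by blast
  moreover have "P \<in> Convex n" unfolding P_def by (rule cone_polytope_Convex)
  ultimately show ?thesis using poly_valid_iff_cells[of P \<phi>] aff unfolding Convex_def by blast
qed

theorem theorem5p2:
  fixes n :: nat
  shows "PLn n = Logic (Convex n)"
  using PLn_sound PLn_complete unfolding Logic_def by blast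

end
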